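(* Let $A$ be a $2\times 2$ real symmetric positive-semidefinite matrix and let $f:\mathbb{H}\times\mathbb{R}^2\to\mathbb{R}$ satisfy: (A1) there exists $L_1>0$ such that $|f(p,w_1)-f(p,w_2)|\le L_1|w_1-w_2|$ for all $p\in\mathbb{H}$, $w_1,w_2\in\mathbb{R}^2$; (A2) for every $\rho>0$ there exists $L_2(\rho)>0$ such that $|f(p,w)-f(q,w)|\le L_2(\rho)\,|p\cdot q^{-1}|_G$ for all $p,q\in\mathbb{H}$ with $|p|,|q|\le\rho$ and all $w\in\mathbb{R}^2$. Let $u_0\in C(\mathbb{H})$. Then there is at most one continuous viscosity solution $u$ of $$u_t-\operatorname{tr}\left(A(\nabla_H^2u)^\ast\right)+f(p,\nabla_Hu)=0\ \text{ in }\mathbb{H}\times(0,\infty),\qquad u(\cdot,0)=u_0\ \text{ in }\mathbb{H},$$ satisfying the exponential growth condition (G) for any $T>0$ there exist $k>0$ and $C_T>0$ such that $|u(p,t)|\le C_Te^{k\langle p\rangle}$ for all $(p,t)\in\mathbb{H}\times[0,T]$.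
   Context: The Heisenberg group $\mathbb{H}$ is $\mathbb{R}^3$ with the group law $(x_p,y_p,z_p)\cdot(x_q,y_q,z_q)=\left(x_p+x_q,\,y_p+y_q,\,z_p+z_q+\tfrac12(x_py_q-x_qy_p)\right)$; the inverse of $p=(x,y,z)$ is $p^{-1}=(-x,-y,-z)$. The Korányi gauge is $|p|_G=\left((x^2+y^2)^2+16z^2\right)^{1/4}$; $|p|$ is the Euclidean norm; $\langle p\rangle=(1+x^4+y^4+16z^2)^{1/4}$ for $p=(x,y,z)$. Left-invariant vector fields: $X_1=\partial_x-\tfrac y2\partial_z$, $X_2=\partial_y+\tfrac x2\partial_z$. The horizontal gradient is $\nabla_Hu=(X_1u,X_2u)$, and the symmetrized horizontal Hessian $(\nabla_H^2u)^\ast$ is the symmetric $2\times2$ matrix with diagonal entries $X_1^2u$, $X_2^2u$ and off-diagonal entries $\tfrac12(X_1X_2u+X_2X_1u)$ (derivatives in the space variable only). Viscosity notions: an upper semicontinuous (resp. lower semicontinuous) function $u$ is a viscosity subsolution (resp. supersolution) of the equation in $\mathbb{H}\times(0,\infty)$ if, whenever $\phi$ is $C^2$ near $(p_0,t_0)\in\mathbb{H}\times(0,\infty)$ and $u-\phi$ has a local maximum (resp. minimum) at $(p_0,t_0)$, one has $\phi_t-\operatorname{tr}(A(\nabla_H^2\phi)^\ast)+f(p_0,\nabla_H\phi)\le0$ (resp. $\ge0$) at $(p_0,t_0)$. A continuous viscosity solution of the initial value problem is a continuous function on $\mathbb{H}\times[0,\infty)$ that is both and equals $u_0$ at $t=0$.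 *)

theory Defs
  imports "HOL-Analysis.Analysis"
begin

section \<open>The Heisenberg group\<close>

text \<open>The underlying set is \<open>real ^ 3\<close>, so that \<open>norm\<close> is the Euclidean norm and the topology
  is the Euclidean one.\<close>

type_synonym heis = "real ^ 3"

definition heis_mult :: "heis \<Rightarrow> heis \<Rightarrow> heis" (infixl "\<cdot>\<^sub>H" 70) where
  "p \<cdot>\<^sub>H q = vector [p$1 + q$1, p$2 + q$2, p$3 + q$3 + (1/2) * (p$1 * q$2 - q$1 * p$2)]"

definition heis_inv :: "heis \<Rightarrow> heis" where
  "heis_inv p = vector [- p$1, - p$2, - p$3]"

definition koranyi :: "heis \<Rightarrow> real" where
  "koranyi p = root 4 (((p$1)\<^sup>2 + (p$2)\<^sup>2)\<^sup>2 + 16 * (p$3)\<^sup>2)"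

definition heis_bracket :: "heis \<Rightarrow> real" where
  "heis_bracket p = root 4 (1 + (p$1)^4 + (p$2)^4 + 16 * (p$3)\<^sup>2)"


section \<open>Horizontal derivatives\<close>

definition partial :: "3 \<Rightarrow> (heis \<Rightarrow> real) \<Rightarrow> heis \<Rightarrow> real" where
  "partial i u p = deriv (\<lambda>s. u (p + s *\<^sub>R axis i 1)) 0"

definition X1 :: "(heis \<Rightarrow> real) \<Rightarrow> heis \<Rightarrow> real" where
  "X1 u p = partial 1 u p - (p$2 / 2) * partial 3 u p"

definition X2 :: "(heis \<Rightarrow> real) \<Rightarrow> heis \<Rightarrow> real" where
  "X2 u p = partial 2 u p + (p$1 / 2) * partial 3 u p"

definition hgrad :: "(heis \<Rightarrow> real) \<Rightarrow> heis \<Rightarrow> real ^ 2" where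
  "hgrad u p = vector [X1 u p, X2 u p]"

definition hhess_sym :: "(heis \<Rightarrow> real) \<Rightarrow> heis \<Rightarrow> real ^ 2 ^ 2" where
  "hhess_sym u p =
     (let m = (1/2) * (X1 (X2 u) p + X2 (X1 u) p)
      in vector [vector [X1 (X1 u) p, m], vector [m, X2 (X2 u) p]])"


section \<open>Regularity notions\<close>

definition C2_on :: "'a::real_normed_vector set \<Rightarrow> ('a \<Rightarrow> real) \<Rightarrow> bool" where
  "C2_on U \<phi> \<longleftrightarrow>
     (\<exists>(\<phi>' :: 'a \<Rightarrow> 'a \<Rightarrow>\<^sub>L real) (\<phi>'' :: 'a \<Rightarrow> 'a \<Rightarrow>\<^sub>L ('a \<Rightarrow>\<^sub>L real)).
        (\<forall>x\<in>U. (\<phi> has_derivative blinfun_apply (\<phi>' x)) (at x)) \<and>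
        (\<forall>x\<in>U. (\<phi>' has_derivative blinfun_apply (\<phi>'' x)) (at x)) \<and>
        continuous_on U \<phi>'')"

definition C2_near :: "'a::real_normed_vector \<Rightarrow> ('a \<Rightarrow> real) \<Rightarrow> bool" where
  "C2_near x \<phi> \<longleftrightarrow> (\<exists>U. open U \<and> x \<in> U \<and> C2_on U \<phi>)"

definition usc_on :: "'a::topological_space set \<Rightarrow> ('a \<Rightarrow> real) \<Rightarrow> bool" where
  "usc_on S u \<longleftrightarrow> (\<forall>x\<in>S. \<forall>c. u x < c \<longrightarrow> (\<forall>\<^sub>F y in at x within S. u y < c))"

definition lsc_on :: "'a::topological_space set \<Rightarrow> ('a \<Rightarrow> real) \<Rightarrow> bool" where
  "lsc_on S u \<longleftrightarrow> (\<forall>x\<in>S. \<forall>c. c < u x \<longrightarrow> (\<forall>\<^sub>F y in at x within S. c < u y))"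

definition local_max_at :: "('a::topological_space \<Rightarrow> real) \<Rightarrow> 'a \<Rightarrow> bool" where
  "local_max_at g x \<longleftrightarrow> (\<forall>\<^sub>F y in nhds x. g y \<le> g x)"

definition local_min_at :: "('a::topological_space \<Rightarrow> real) \<Rightarrow> 'a \<Rightarrow> bool" where
  "local_min_at g x \<longleftrightarrow> (\<forall>\<^sub>F y in nhds x. g x \<le> g y)"

definition symmetric_psd :: "real ^ 'n ^ 'n \<Rightarrow> bool" where
  "symmetric_psd A \<longleftrightarrow> transpose A = A \<and> (\<forall>v. 0 \<le> v \<bullet> (A *v v))"


section \<open>Viscosity solutions\<close>

text \<open>A function on space-time is a total function on \<open>heis \<times> real\<close>; only its values at times
  \<open>t \<ge> 0\<close> matter. Since the contact point has \<open>t0 > 0\<close>, a local extremum in \<open>heis \<times> real\<close> is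
  the same as one relative to \<open>heis \<times> {0<..}\<close>.\<close>

definition pde_lhs ::
  "real ^ 2 ^ 2 \<Rightarrow> (heis \<Rightarrow> real ^ 2 \<Rightarrow> real) \<Rightarrow> (heis \<times> real \<Rightarrow> real) \<Rightarrow> heis \<Rightarrow> real \<Rightarrow> real"
where
  "pde_lhs A f \<phi> p t =
     deriv (\<lambda>s. \<phi> (p, s)) t
       - trace (A ** hhess_sym (\<lambda>q. \<phi> (q, t)) p)
       + f p (hgrad (\<lambda>q. \<phi> (q, t)) p)"

definition viscosity_subsolution ::
  "real ^ 2 ^ 2 \<Rightarrow> (heis \<Rightarrow> real ^ 2 \<Rightarrow> real) \<Rightarrow> (heis \<times> real \<Rightarrow> real) \<Rightarrow> bool"
where
  "viscosity_subsolution A f u \<longleftrightarrow>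
     usc_on (UNIV \<times> {0<..}) u \<and>
     (\<forall>\<phi> p0 t0. t0 > 0 \<longrightarrow> C2_near (p0, t0) \<phi> \<longrightarrow>
        local_max_at (\<lambda>q. u q - \<phi> q) (p0, t0) \<longrightarrow> pde_lhs A f \<phi> p0 t0 \<le> 0)"

definition viscosity_supersolution ::
  "real ^ 2 ^ 2 \<Rightarrow> (heis \<Rightarrow> real ^ 2 \<Rightarrow> real) \<Rightarrow> (heis \<times> real \<Rightarrow> real) \<Rightarrow> bool"
where
  "viscosity_supersolution A f u \<longleftrightarrow>
     lsc_on (UNIV \<times> {0<..}) u \<and>
     (\<forall>\<phi> p0 t0. t0 > 0 \<longrightarrow> C2_near (p0, t0) \<phi> \<longrightarrow>
        local_min_at (\<lambda>q. u q - \<phi> q) (p0, t0) \<longrightarrow> pde_lhs A f \<phi> p0 t0 \<ge> 0)"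

definition continuous_viscosity_solution ::
  "real ^ 2 ^ 2 \<Rightarrow> (heis \<Rightarrow> real ^ 2 \<Rightarrow> real) \<Rightarrow> (heis \<Rightarrow> real) \<Rightarrow> (heis \<times> real \<Rightarrow> real) \<Rightarrow> bool"
where
  "continuous_viscosity_solution A f u0 u \<longleftrightarrow>
     continuous_on (UNIV \<times> {0..}) u \<and>
     viscosity_subsolution A f u \<and> viscosity_supersolution A f u \<and>
     (\<forall>p. u (p, 0) = u0 p)"

definition exponential_growth :: "(heis \<times> real \<Rightarrow> real) \<Rightarrow> bool" where
  "exponential_growth u \<longleftrightarrow>
     (\<forall>T>0. \<exists>k>0. \<exists>C>0. \<forall>p. \<forall>t\<in>{0..T}. \<bar>u (p, t)\<bar> \<le> C * exp (k * heis_bracket p))"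

end

theory Submission
  imports Defs
begin

text \<open>
  Write \<open>A = a a\<^sup>T + b b\<^sup>T\<close>, so that the second-order part is \<open>L = Y\<^sub>a\<^sup>2 + Y\<^sub>b\<^sup>2\<close> with left-invariant fields. It suffices
  that \<open>w = u - v\<close> is a viscosity subsolution of \<open>w\<^sub>t - L w - L\<^sub>1 |\<nabla>\<^sub>H w| = 0\<close>: the function
  \<open>\<sigma> exp (\<kappa> \<langle>p\<rangle> + K t)\<close> is then a smooth supersolution which dominates \<open>w\<close> at infinity.

  To see this, regularise \<open>u\<close> and \<open>- v\<close> by sup-convolution over left translations, which commute with \<open>L\<close>; by (A2)
  this costs only a small constant. A sup-convolution is touched from below by a smooth function at every point, so at
  a maximum point of the regularised \<open>u - v - \<phi>\<close> its slope is unique, and the slopes of all test functions at nearby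
  points are close to it. Hence near that point \<open>f(p, \<nabla>\<^sub>H u)\<close> may be replaced by a constant, and the
  equations become linear.

  For linear equations with constant right-hand sides the sum of subsolutions is a subsolution, and this is
  proved without Jensen's lemma or Alexandrov's theorem: start the equation from smooth data \<open>g\<close> close to \<open>u\<close> at time
  \<open>t\<^sub>1 - h\<close>, evolve \<open>g\<close> by a random walk with steps along \<open>Y\<^sub>a\<close>, \<open>Y\<^sub>b\<close>, and compare the resulting smooth
  function \<open>U\<close> with \<open>u\<close> from above and \<open>\<phi> - U\<close> with \<open>- v\<close> from above. The unknown lateral values cost
  \<open>O(h\<^sup>2)\<close>, less than the gain proportional to \<open>h\<close>.
\<close>

section \<open>Second-order jets along horizontal fields\<close>

text \<open>The equation is nonlinear in the gradient, so a sum theorem for linear equations applies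
  only where the slopes of test functions are almost constant; this is why uniqueness of the slope
  at a contact point matters. Left translations suit (A2) because the translation taking
  \<open>q\<close> to \<open>p\<close> is by \<open>p \<cdot>\<^sub>H heis_inv q\<close>, the very
  quantity that (A2) measures. \<open>A\<close> may be degenerate, so smooth solutions with given
  boundary values cannot be expected; the random walk only needs smooth data. Its steps multiply on
  the right and do not commute with left-invariant fields: differentiating
  \<open>g (x \<cdot>\<^sub>H s)\<close> in \<open>x\<close> produces factors growing with
  \<open>s\<close>. Data built from polynomials times Gaussians keep these derivatives bounded for
  bounded \<open>x\<close> and all \<open>s\<close>, so one constant serves any number of steps. The
  order of choice matters: the barrier and \<open>h\<close> depend only on the sizes of
  \<open>u\<close>, \<open>v\<close> and the test function; then the data \<open>g\<close> are
  chosen; the step \<open>k\<close> comes last, because the derivative bounds of \<open>g\<close>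
  are not controlled by its quality of approximation.\<close>

definition hvec :: "real ^ 2 \<Rightarrow> heis \<Rightarrow> heis" where
  "hvec e p = vector [e$1, e$2, (p$1 * e$2 - p$2 * e$1) / 2]"

lemma hvec_nth [simp]:
  "hvec e p $ 1 = e$1" "hvec e p $ 2 = e$2" "hvec e p $ 3 = (p$1 * e$2 - p$2 * e$1) / 2"
  by (auto simp: hvec_def)

lemma heis_mult_nth [simp]:
  "(p \<cdot>\<^sub>H q) $ 1 = p$1 + q$1" "(p \<cdot>\<^sub>H q) $ 2 = p$2 + q$2"
  "(p \<cdot>\<^sub>H q) $ 3 = p$3 + q$3 + (1/2) * (p$1 * q$2 - q$1 * p$2)"
  by (auto simp: heis_mult_def)

lemma heis_inv_nth [simp]:
  "heis_inv p $ 1 = - p$1" "heis_inv p $ 2 = - p$2" "heis_inv p $ 3 = - p$3"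
  by (auto simp: heis_inv_def)

text \<open>Derivatives are plain functions of base point and direction, so that they can be
  evaluated along directions varying with the point. Linearity of \<open>H\<close> in its first
  direction is not demanded: it follows from linearity of \<open>D y\<close> on the open set.
  \<open>jet2_imp_C2_on\<close> returns to operator-valued derivatives.\<close>

definition jet2 ::
  "'a::euclidean_space set \<Rightarrow> ('a \<Rightarrow> real) \<Rightarrow> ('a \<Rightarrow> 'a \<Rightarrow> real) \<Rightarrow> ('a \<Rightarrow> 'a \<Rightarrow> 'a \<Rightarrow> real) \<Rightarrow> bool"
where
  "jet2 U \<phi> D H \<longleftrightarrow> open U \<and>
     (\<forall>x\<in>U. (\<phi> has_derivative D x) (at x)) \<and>
     (\<forall>x\<in>U. \<forall>v. ((\<lambda>y. D y v) has_derivative H x v) (at x)) \<and>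
     (\<forall>v w. continuous_on U (\<lambda>x. H x v w))"

lemma jet2_continuous: "jet2 U \<phi> D H \<Longrightarrow> continuous_on U \<phi>"
  unfolding jet2_def
  by (intro continuous_at_imp_continuous_on ballI) (blast intro: has_derivative_continuous)

lemma jet2_linear1: "jet2 U \<phi> D H \<Longrightarrow> x \<in> U \<Longrightarrow> linear (D x)"
  unfolding jet2_def using has_derivative_linear by blast

lemma jet2_linear_right: "jet2 U \<phi> D H \<Longrightarrow> x \<in> U \<Longrightarrow> linear (H x v)"
  unfolding jet2_def using has_derivative_linear by blast

lemma jet2_linear_left:
  assumes j: "jet2 U \<phi> D H" and x: "x \<in> U"
  shows "linear (\<lambda>v. H x v w)"
proof -
  have U: "open U" and d: "\<And>v. ((\<lambda>y. D y v) has_derivative H x v) (at x)"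
    using j x by (auto simp: jet2_def)
  have lin: "\<And>y. y \<in> U \<Longrightarrow> linear (D y)"
    using j by (rule jet2_linear1)
  have add: "H x (v1 + v2) = (\<lambda>w. H x v1 w + H x v2 w)" for v1 v2
  proof (rule has_derivative_unique[OF d])
    have "((\<lambda>y. D y v1 + D y v2) has_derivative (\<lambda>w. H x v1 w + H x v2 w)) (at x)"
      by (intro has_derivative_add d)
    then show "((\<lambda>y. D y (v1 + v2)) has_derivative (\<lambda>w. H x v1 w + H x v2 w)) (at x)"
      by (rule has_derivative_transform_within_open[OF _ U x]) (simp add: lin linear_add)
  qed
  have scale: "H x (r *\<^sub>R v) = (\<lambda>w. r * H x v w)" for r v
  proof (rule has_derivative_unique[OF d])
    have "((\<lambda>y. r * D y v) has_derivative (\<lambda>w. r * H x v w)) (at x)"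
      by (intro has_derivative_mult_right d)
    then show "((\<lambda>y. D y (r *\<^sub>R v)) has_derivative (\<lambda>w. r * H x v w)) (at x)"
      by (rule has_derivative_transform_within_open[OF _ U x]) (simp add: lin linear_scale)
  qed
  show ?thesis
    by (rule linearI) (auto simp: add scale)
qed

lemma linear_euclidean_expand:
  fixes f :: "'a::euclidean_space \<Rightarrow> real"
  assumes "linear f"
  shows "f x = (\<Sum>b\<in>Basis. (x \<bullet> b) * f b)"
proof -
  have "f x = f (\<Sum>b\<in>Basis. (x \<bullet> b) *\<^sub>R b)" by (simp add: euclidean_representation)
  then show ?thesis using assms by (simp add: linear_sum linear_scale)
qed

lemma jet2_continuous_D:
  assumes j: "jet2 U \<phi> D H" and V: "continuous_on U V"
  shows "continuous_on U (\<lambda>x. D x (V x))"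
proof -
  have "continuous_on U (\<lambda>x. \<Sum>b\<in>Basis. (V x \<bullet> b) * D x b)"
  proof (intro continuous_intros V)
    fix b
    show "continuous_on U (\<lambda>x. D x b)"
      using j unfolding jet2_def
      by (intro continuous_at_imp_continuous_on ballI) (blast intro: has_derivative_continuous)
  qed
  then show ?thesis
    by (rule continuous_on_eq) (simp only: linear_euclidean_expand[OF jet2_linear1[OF j], symmetric])
qed

lemma jet2_continuous_H:
  assumes j: "jet2 U \<phi> D H" and V: "continuous_on U V" and W: "continuous_on U W"
  shows "continuous_on U (\<lambda>x. H x (V x) (W x))"
proof -
  have c: "continuous_on U (\<lambda>x. H x b c)" for b c
    using j by (auto simp: jet2_def)
  have "continuous_on U (\<lambda>x. \<Sum>b\<in>Basis. (V x \<bullet> b) * (\<Sum>c\<in>Basis. (W x \<bullet> c) * H x b c))"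
    by (intro continuous_intros V W c)
  then show ?thesis
  proof (rule continuous_on_eq)
    fix x assume x: "x \<in> U"
    have "H x (V x) (W x) = (\<Sum>b\<in>Basis. (V x \<bullet> b) * H x b (W x))"
      by (rule linear_euclidean_expand[OF jet2_linear_left[OF j x]])
    also have "\<dots> = (\<Sum>b\<in>Basis. (V x \<bullet> b) * (\<Sum>c\<in>Basis. (W x \<bullet> c) * H x b c))"
      by (intro sum.cong refl arg_cong2[where f="(*)"]
          linear_euclidean_expand[OF jet2_linear_right[OF j x]])
    finally show "(\<Sum>b\<in>Basis. (V x \<bullet> b) * (\<Sum>c\<in>Basis. (W x \<bullet> c) * H x b c)) = H x (V x) (W x)"
      by simp
  qed
qed

lemma jet2_imp_C2_on:
  fixes \<phi> :: "'a::euclidean_space \<Rightarrow> real"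
  assumes j: "jet2 U \<phi> D H"
  shows "C2_on U \<phi>"
proof -
  define \<phi>' where "\<phi>' x = (\<Sum>b\<in>Basis. D x b *\<^sub>R blinfun_inner_right b)" for x
  define S :: "'a \<Rightarrow> real \<Rightarrow>\<^sub>L ('a \<Rightarrow>\<^sub>L real)" where
    "S b = blinfun_scaleR_left (blinfun_inner_right b)" for b
  define \<phi>'' where
    "\<phi>'' x = (\<Sum>b\<in>Basis. S b o\<^sub>L (\<Sum>c\<in>Basis. H x b c *\<^sub>R blinfun_inner_right c))" for x
  have a1: "blinfun_apply (\<phi>' x) = D x" if "x \<in> U" for x
  proof
    fix v
    show "blinfun_apply (\<phi>' x) v = D x v"
      unfolding \<phi>'_def
      by (simp add: blinfun.sum_left blinfun.scaleR_left inner_commute mult.commute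
          linear_euclidean_expand[OF jet2_linear1[OF j that], of v])
  qed
  have a2: "blinfun_apply (\<phi>'' x) w = (\<Sum>b\<in>Basis. H x b w *\<^sub>R blinfun_inner_right b)" if "x \<in> U" for x w
    unfolding \<phi>''_def S_def
    by (simp add: blinfun.sum_left blinfun.scaleR_left blinfun_apply_blinfun_compose inner_commute mult.commute
          linear_euclidean_expand[OF jet2_linear_right[OF j that], of _ w])
  show ?thesis
    unfolding C2_on_def
  proof (intro exI[of _ \<phi>'] exI[of _ \<phi>''] conjI ballI)
    fix x assume x: "x \<in> U"
    show "(\<phi> has_derivative blinfun_apply (\<phi>' x)) (at x)"
      using j x by (simp add: a1 jet2_def)
    have "(\<phi>' has_derivative (\<lambda>w. \<Sum>b\<in>Basis. H x b w *\<^sub>R blinfun_inner_right b)) (at x)"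
      unfolding \<phi>'_def using j x
      by (auto intro!: has_derivative_sum has_derivative_scaleR_left simp: jet2_def)
    then show "(\<phi>' has_derivative blinfun_apply (\<phi>'' x)) (at x)"
      by (simp add: a2[OF x, abs_def])
  next
    show "continuous_on U \<phi>''"
      unfolding \<phi>''_def using j by (auto intro!: continuous_intros simp: jet2_def)
  qed
qed

section \<open>Calculus of jets along two horizontal fields\<close>

locale horizontal_pair =
  fixes a b :: "real ^ 2"
begin

text \<open>The Hessian evaluated twice on \<open>hvec a\<close> is exactly the second derivative
  along the field: differentiating \<open>hvec a\<close> along itself adds a vertical term with
  factor \<open>a$1 * a$2 - a$2 * a$1 = 0\<close>.\<close>

definition lap :: "(heis \<times> real \<Rightarrow> heis \<times> real \<Rightarrow> heis \<times> real \<Rightarrow> real) \<Rightarrow> heis \<times> real \<Rightarrow> real" where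
  "lap H z = H z (hvec a (fst z), 0) (hvec a (fst z), 0) + H z (hvec b (fst z), 0) (hvec b (fst z), 0)"

text \<open>The carre du champ of the second-order operator, that is, the cross term of its product
  and chain rules.\<close>

definition gam :: "real ^ 2 \<Rightarrow> real ^ 2 \<Rightarrow> real" where
  "gam v w = (v \<bullet> a) * (w \<bullet> a) + (v \<bullet> b) * (w \<bullet> b)"

abbreviation jet_coords where
  "jet_coords U D H T G L \<equiv>
     \<forall>z\<in>U. T z = D z (0, 1) \<and> (\<forall>e. G z \<bullet> e = D z (hvec e (fst z), 0)) \<and> L z = lap H z"

text \<open>\<open>cjet U \<phi> T G L\<close>: on the open set \<open>U\<close> the function \<open>\<phi>\<close> is \<open>C\<^sup>2\<close> with time derivative \<open>T\<close>,
  horizontal gradient \<open>G\<close>, and \<open>L = Y\<^sub>a\<^sup>2 \<phi> + Y\<^sub>b\<^sup>2 \<phi>\<close> for the left-invariant fields \<open>Y\<^sub>e = e\<^sub>1 X\<^sub>1 + e\<^sub>2 X\<^sub>2\<close>.\<close>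

definition cjet ::
  "(heis \<times> real) set \<Rightarrow> (heis \<times> real \<Rightarrow> real) \<Rightarrow> (heis \<times> real \<Rightarrow> real) \<Rightarrow> (heis \<times> real \<Rightarrow> real ^ 2)
     \<Rightarrow> (heis \<times> real \<Rightarrow> real) \<Rightarrow> bool"
where
  "cjet U \<phi> T G L \<longleftrightarrow> (\<exists>D H. jet2 U \<phi> D H \<and> jet_coords U D H T G L)"

lemma cjetI:
  assumes "jet2 U \<phi> D H" "\<And>z. z \<in> U \<Longrightarrow> T z = D z (0, 1)"
    "\<And>z e. z \<in> U \<Longrightarrow> G z \<bullet> e = D z (hvec e (fst z), 0)" "\<And>z. z \<in> U \<Longrightarrow> L z = lap H z"
  shows "cjet U \<phi> T G L"
  using assms unfolding cjet_def by blast

lemma cjet_open: "cjet U \<phi> T G L \<Longrightarrow> open U"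
  by (auto simp: cjet_def jet2_def)

lemma cjet_cong:
  assumes "cjet U \<phi> T G L" "\<And>z. z \<in> U \<Longrightarrow> T' z = T z" "\<And>z. z \<in> U \<Longrightarrow> G' z = G z" "\<And>z. z \<in> U \<Longrightarrow> L' z = L z"
  shows "cjet U \<phi> T' G' L'"
  using assms unfolding cjet_def by auto

lemma cjet_subset: "cjet U \<phi> T G L \<Longrightarrow> open V \<Longrightarrow> V \<subseteq> U \<Longrightarrow> cjet V \<phi> T G L"
  unfolding cjet_def jet2_def by (blast intro: continuous_on_subset)

lemma jet2_const: "open U \<Longrightarrow> jet2 U (\<lambda>_. c) (\<lambda>_ _. 0) (\<lambda>_ _ _. 0)"
  by (auto simp: jet2_def)

lemma cjet_const: "open U \<Longrightarrow> cjet U (\<lambda>_. c) (\<lambda>_. 0) (\<lambda>_. 0) (\<lambda>_. 0)"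
  by (rule cjetI[OF jet2_const]) (auto simp: lap_def)

lemma cjet_linear:
  assumes "bounded_linear f" "open U"
  shows "cjet U f (\<lambda>_. f (0, 1))
    (\<lambda>z. vector [f (hvec (axis 1 1) (fst z), 0), f (hvec (axis 2 1) (fst z), 0)]) (\<lambda>_. 0)"
  unfolding cjet_def
proof (intro exI conjI ballI)
  show "jet2 U f (\<lambda>_. f) (\<lambda>_ _ _. 0)"
    using assms by (auto simp: jet2_def bounded_linear_imp_has_derivative)
  interpret bounded_linear f by fact
  fix z
  show "f (0,1) = f (0,1)" "0 = lap (\<lambda>_ _ _. 0) z" by (simp_all add: lap_def)
  show "\<forall>e. vector [f (hvec (axis 1 1) (fst z), 0), f (hvec (axis 2 1) (fst z), 0)] \<bullet> e =
           f (hvec e (fst z), 0)"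
  proof
    fix e :: "real ^ 2"
    have "(hvec e (fst z), 0::real) = e$1 *\<^sub>R (hvec (axis 1 1) (fst z), 0) + e$2 *\<^sub>R (hvec (axis 2 1) (fst z), 0)"
      by (simp add: vec_eq_iff forall_3 axis_def field_simps)
    then have "f (hvec e (fst z), 0) = e$1 * f (hvec (axis 1 1) (fst z), 0) + e$2 * f (hvec (axis 2 1) (fst z), 0)"
      by (simp only: add scaleR real_scaleR_def)
    then show "vector [f (hvec (axis 1 1) (fst z), 0), f (hvec (axis 2 1) (fst z), 0)] \<bullet> e =
           f (hvec e (fst z), 0)"
      by (simp add: inner_vec_def sum_2 mult.commute)
  qed
qed

lemma cjet_add:
  assumes "cjet U \<phi> T G L" "cjet U \<phi>' T' G' L'"
  shows "cjet U (\<lambda>z. \<phi> z + \<phi>' z) (\<lambda>z. T z + T' z) (\<lambda>z. G z + G' z) (\<lambda>z. L z + L' z)"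
proof -
  obtain D H where 1: "jet2 U \<phi> D H" "jet_coords U D H T G L"
    using assms(1) unfolding cjet_def by blast
  obtain D' H' where 2: "jet2 U \<phi>' D' H'" "jet_coords U D' H' T' G' L'"
    using assms(2) unfolding cjet_def by blast
  have "jet2 U (\<lambda>z. \<phi> z + \<phi>' z) (\<lambda>z v. D z v + D' z v) (\<lambda>z v w. H z v w + H' z v w)"
    using 1(1) 2(1) by (auto simp: jet2_def intro!: has_derivative_add continuous_on_add)
  then show ?thesis
    by (rule cjetI) (use 1(2) 2(2) in \<open>auto simp: inner_add_left lap_def\<close>)
qed

lemma cjet_mult:
  assumes "cjet U \<phi> T G L" "cjet U \<phi>' T' G' L'"
  shows "cjet U (\<lambda>z. \<phi> z * \<phi>' z) (\<lambda>z. \<phi> z * T' z + \<phi>' z * T z) (\<lambda>z. \<phi> z *\<^sub>R G' z + \<phi>' z *\<^sub>R G z)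
     (\<lambda>z. \<phi> z * L' z + \<phi>' z * L z + 2 * gam (G z) (G' z))"
proof -
  obtain D H where 1: "jet2 U \<phi> D H" "jet_coords U D H T G L"
    using assms(1) unfolding cjet_def by blast
  obtain D' H' where 2: "jet2 U \<phi>' D' H'" "jet_coords U D' H' T' G' L'"
    using assms(2) unfolding cjet_def by blast
  have c: "continuous_on U \<phi>" "continuous_on U \<phi>'"
    using jet2_continuous[OF 1(1)] jet2_continuous[OF 2(1)] .
  have "jet2 U (\<lambda>z. \<phi> z * \<phi>' z) (\<lambda>z v. \<phi> z * D' z v + D z v * \<phi>' z)
     (\<lambda>z v w. \<phi> z * H' z v w + D z w * D' z v + (D z v * D' z w + H z v w * \<phi>' z))"
    unfolding jet2_def
  proof (intro conjI ballI allI)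
    show "open U" using 1(1) by (simp add: jet2_def)
    fix x assume x: "x \<in> U"
    have d: "(\<phi> has_derivative D x) (at x)" "(\<phi>' has_derivative D' x) (at x)"
       "\<And>v. ((\<lambda>y. D y v) has_derivative H x v) (at x)" "\<And>v. ((\<lambda>y. D' y v) has_derivative H' x v) (at x)"
      using 1(1) 2(1) x by (auto simp: jet2_def)
    show "((\<lambda>z. \<phi> z * \<phi>' z) has_derivative (\<lambda>v. \<phi> x * D' x v + D x v * \<phi>' x)) (at x)"
      by (intro has_derivative_mult d)
    show "((\<lambda>y. \<phi> y * D' y v + D y v * \<phi>' y) has_derivative
        (\<lambda>w. \<phi> x * H' x v w + D x w * D' x v + (D x v * D' x w + H x v w * \<phi>' x))) (at x)" for v
      by (intro has_derivative_add has_derivative_mult d)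
  next
    fix v w
    show "continuous_on U (\<lambda>z. \<phi> z * H' z v w + D z w * D' z v + (D z v * D' z w + H z v w * \<phi>' z))"
      by (intro continuous_intros c jet2_continuous_D[OF 1(1)] jet2_continuous_D[OF 2(1)]
        jet2_continuous_H[OF 1(1)] jet2_continuous_H[OF 2(1)])
  qed
  then show ?thesis
    by (rule cjetI) (use 1(2) 2(2) in \<open>auto simp: inner_add_left lap_def gam_def algebra_simps\<close>)
qed

lemma cjet_compose:
  assumes "cjet U \<phi> T G L"
    and h: "\<And>z. z \<in> U \<Longrightarrow> (h has_real_derivative h' (\<phi> z)) (at (\<phi> z))"
      "\<And>z. z \<in> U \<Longrightarrow> (h' has_real_derivative h'' (\<phi> z)) (at (\<phi> z))"
      "continuous_on (\<phi> ` U) h''"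
  shows "cjet U (\<lambda>z. h (\<phi> z)) (\<lambda>z. h' (\<phi> z) * T z) (\<lambda>z. h' (\<phi> z) *\<^sub>R G z)
     (\<lambda>z. h' (\<phi> z) * L z + h'' (\<phi> z) * gam (G z) (G z))"
proof -
  obtain D H where 1: "jet2 U \<phi> D H" "jet_coords U D H T G L"
    using assms(1) unfolding cjet_def by blast
  have c: "continuous_on U \<phi>"
    using 1(1) by (rule jet2_continuous)
  have c': "continuous_on U (\<lambda>z. h' (\<phi> z))"
    by (rule continuous_on_compose2[OF _ c, of "\<phi> ` U"])
      (auto intro!: continuous_at_imp_continuous_on DERIV_isCont h)
  have c'': "continuous_on U (\<lambda>z. h'' (\<phi> z))"
    using continuous_on_compose2[OF h(3) c] by simp
  have "jet2 U (\<lambda>z. h (\<phi> z)) (\<lambda>z v. h' (\<phi> z) * D z v)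
     (\<lambda>z v w. h' (\<phi> z) * H z v w + (h'' (\<phi> z) * D z w) * D z v)"
    unfolding jet2_def
  proof (intro conjI ballI allI)
    show "open U" using 1(1) by (simp add: jet2_def)
    fix x assume x: "x \<in> U"
    have d: "(\<phi> has_derivative D x) (at x)"
       "\<And>v. ((\<lambda>y. D y v) has_derivative H x v) (at x)"
      using 1(1) x by (auto simp: jet2_def)
    show "((\<lambda>z. h (\<phi> z)) has_derivative (\<lambda>v. h' (\<phi> x) * D x v)) (at x)"
      using has_derivative_compose[OF d(1) h(1)[OF x, unfolded has_field_derivative_def]] by simp
    have d': "((\<lambda>z. h' (\<phi> z)) has_derivative (\<lambda>v. h'' (\<phi> x) * D x v)) (at x)"
      using has_derivative_compose[OF d(1) h(2)[OF x, unfolded has_field_derivative_def]] by simp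
    show "((\<lambda>y. h' (\<phi> y) * D y v) has_derivative
        (\<lambda>w. h' (\<phi> x) * H x v w + (h'' (\<phi> x) * D x w) * D x v)) (at x)" for v
      by (intro has_derivative_mult d d')
  next
    fix v w
    show "continuous_on U (\<lambda>z. h' (\<phi> z) * H z v w + (h'' (\<phi> z) * D z w) * D z v)"
      by (intro continuous_intros c' c'' jet2_continuous_D[OF 1(1)] jet2_continuous_H[OF 1(1)])
  qed
  then show ?thesis
    by (rule cjetI) (use 1(2) in \<open>auto simp: lap_def gam_def algebra_simps\<close>)
qed

section \<open>Invariance under left translation\<close>

definition ltrans :: "heis \<Rightarrow> real \<Rightarrow> heis \<times> real \<Rightarrow> heis \<times> real" where
  "ltrans g s z = (g \<cdot>\<^sub>H fst z, snd z + s)"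

definition ltrans_lin :: "heis \<Rightarrow> heis \<times> real \<Rightarrow> heis \<times> real" where
  "ltrans_lin g h = (vector [fst h $ 1, fst h $ 2, fst h $ 3 + (g$1 * fst h $ 2 - fst h $ 1 * g$2) / 2], snd h)"

lemma linear_ltrans_lin: "linear (ltrans_lin g)"
  by (rule linearI) (simp_all add: ltrans_lin_def vec_eq_iff forall_3 algebra_simps add_divide_distrib diff_divide_distrib)

lemma ltrans_eq: "ltrans g s z = ltrans_lin g z + (g, s)"
  by (simp add: ltrans_def ltrans_lin_def plus_prod_def vec_eq_iff forall_3 algebra_simps add_divide_distrib diff_divide_distrib)

lemma ltrans_has_derivative: "(ltrans g s has_derivative ltrans_lin g) (at z)"
proof -
  have "((\<lambda>z. ltrans_lin g z + (g, s)) has_derivative (\<lambda>h. ltrans_lin g h + 0)) (at z)"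
    by (intro has_derivative_add has_derivative_const linear_imp_has_derivative linear_ltrans_lin)
  then show ?thesis by (simp add: ltrans_eq[abs_def])
qed

lemma continuous_on_ltrans: "continuous_on S (ltrans g s)"
  by (intro continuous_at_imp_continuous_on ballI has_derivative_continuous[OF ltrans_has_derivative])

text \<open>Left-invariance of the fields: the differential of a translation carries the field at
  \<open>z\<close> to the field at the image of \<open>z\<close>. Hence time derivative, horizontal
  gradient and \<open>lap\<close> are merely transported in \<open>cjet_ltrans\<close>.\<close>

lemma ltrans_hvec: "ltrans_lin g (hvec e (fst z), 0) = (hvec e (fst (ltrans g s z)), 0)"
  by (simp add: ltrans_def ltrans_lin_def plus_prod_def vec_eq_iff forall_3 algebra_simps add_divide_distrib diff_divide_distrib)

lemma cjet_ltrans: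
  assumes "cjet U \<phi> T G L"
  shows "cjet (ltrans g s -` U) (\<phi> \<circ> ltrans g s) (T \<circ> ltrans g s) (G \<circ> ltrans g s) (L \<circ> ltrans g s)"
proof -
  obtain D H where 1: "jet2 U \<phi> D H" "jet_coords U D H T G L"
    using assms(1) unfolding cjet_def by blast
  have "jet2 (ltrans g s -` U) (\<phi> \<circ> ltrans g s) (\<lambda>z v. D (ltrans g s z) (ltrans_lin g v))
     (\<lambda>z v w. H (ltrans g s z) (ltrans_lin g v) (ltrans_lin g w))"
    unfolding jet2_def
  proof (intro conjI ballI allI)
    show "open (ltrans g s -` U)"
      using 1(1) continuous_on_ltrans by (auto simp: jet2_def intro: open_vimage)
    fix x assume "x \<in> ltrans g s -` U"
    then have x: "ltrans g s x \<in> U" by simp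
    have d: "(\<phi> has_derivative D (ltrans g s x)) (at (ltrans g s x))"
       "\<And>v. ((\<lambda>y. D y v) has_derivative H (ltrans g s x) v) (at (ltrans g s x))"
      using 1(1) x by (auto simp: jet2_def)
    show "(\<phi> \<circ> ltrans g s has_derivative (\<lambda>v. D (ltrans g s x) (ltrans_lin g v))) (at x)"
      using has_derivative_compose[OF ltrans_has_derivative d(1)] by (simp add: o_def)
    show "((\<lambda>z. D (ltrans g s z) (ltrans_lin g v)) has_derivative
        (\<lambda>w. H (ltrans g s x) (ltrans_lin g v) (ltrans_lin g w))) (at x)" for v
      using has_derivative_compose[OF ltrans_has_derivative d(2)] .
  next
    fix v w
    have "continuous_on U (\<lambda>x. H x (ltrans_lin g v) (ltrans_lin g w))"
      using 1(1) unfolding jet2_def by blast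
    then show "continuous_on (ltrans g s -` U) (\<lambda>z. H (ltrans g s z) (ltrans_lin g v) (ltrans_lin g w))"
      by (rule continuous_on_compose2) (auto intro: continuous_on_ltrans)
  qed
  moreover have "ltrans_lin g (0, 1) = (0, 1)"
    by (simp add: ltrans_lin_def vec_eq_iff forall_3)
  ultimately show ?thesis
    by (intro cjetI[of _ _ "\<lambda>z v. D (ltrans g s z) (ltrans_lin g v)" "\<lambda>z v w. H (ltrans g s z) (ltrans_lin g v) (ltrans_lin g w)"])
      (use 1(2) in \<open>simp_all add: lap_def ltrans_hvec[where s=s]\<close>)
qed

lemma continuous_hvec: "continuous_on S (\<lambda>z. (hvec e (fst z), 0::real))"
proof -
  have "hvec e p = e$1 *\<^sub>R axis 1 1 + e$2 *\<^sub>R axis 2 1 + ((p$1 * e$2 - p$2 * e$1) / 2) *\<^sub>R axis 3 1" for p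
    by (simp add: vec_eq_iff forall_3 axis_def)
  then have "hvec e = (\<lambda>p. e$1 *\<^sub>R axis 1 1 + e$2 *\<^sub>R axis 2 1 + ((p$1 * e$2 - p$2 * e$1) / 2) *\<^sub>R axis 3 1)"
    by blast
  then show ?thesis by (simp only:) (intro continuous_intros; simp)
qed

lemma cjet_continuous:
  assumes "cjet U \<phi> T G L"
  shows "continuous_on U \<phi>" "continuous_on U T" "continuous_on U (\<lambda>z. G z)" "continuous_on U L"
proof -
  obtain D H where 1: "jet2 U \<phi> D H" "jet_coords U D H T G L"
    using assms(1) unfolding cjet_def by blast
  show "continuous_on U \<phi>"
    using 1(1) by (rule jet2_continuous)
  show "continuous_on U T"
    using jet2_continuous_D[OF 1(1) continuous_on_const[of _ "(0,1)"]] 1(2)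
    by (auto intro: continuous_on_eq)
  show "continuous_on U L"
  proof (rule continuous_on_eq)
    show "continuous_on U (lap H)"
      unfolding lap_def[abs_def]
      by (intro continuous_intros jet2_continuous_H[OF 1(1)] continuous_hvec)
  qed (use 1(2) in auto)
  show "continuous_on U G"
  proof (rule continuous_on_eq)
    show "continuous_on U (\<lambda>z. D z (hvec (axis 1 1) (fst z), 0) *\<^sub>R axis 1 1 + D z (hvec (axis 2 1) (fst z), 0) *\<^sub>R axis 2 (1::real) :: real ^ 2)"
      by (intro continuous_intros jet2_continuous_D[OF 1(1)] continuous_hvec)
    fix z assume "z \<in> U"
    then have "G z \<bullet> axis 1 1 = D z (hvec (axis 1 1) (fst z), 0)" "G z \<bullet> axis 2 1 = D z (hvec (axis 2 1) (fst z), 0)"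
      using 1(2) by blast+
    then show "D z (hvec (axis 1 1) (fst z), 0) *\<^sub>R axis 1 1 + D z (hvec (axis 2 1) (fst z), 0) *\<^sub>R axis 2 1 = G z"
      by (simp add: vec_eq_iff forall_2 inner_axis) (simp add: axis_def)
  qed
qed

lemma cjet_touch_gradient:
  assumes "cjet U \<phi> T G L" "cjet V \<psi> T' G' L'" "z \<in> U" "z \<in> V"
    and "\<forall>\<^sub>F y in nhds z. \<phi> y - \<psi> y \<le> \<phi> z - \<psi> z"
  shows "G z = G' z"
proof -
  obtain D H where 1: "jet2 U \<phi> D H" "jet_coords U D H T G L"
    using assms(1) unfolding cjet_def by blast
  obtain D' H' where 2: "jet2 V \<psi> D' H'" "jet_coords V D' H' T' G' L'"
    using assms(2) unfolding cjet_def by blast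
  have d: "((\<lambda>z. \<phi> z - \<psi> z) has_derivative (\<lambda>v. D z v - D' z v)) (at z)"
    using 1(1) 2(1) assms(3,4) unfolding jet2_def by (intro has_derivative_diff) blast+
  obtain S where S: "open S" "z \<in> S" "\<forall>y\<in>S. \<phi> y - \<psi> y \<le> \<phi> z - \<psi> z"
    using assms(5) by (auto simp: eventually_nhds)
  have "(\<lambda>v. D z v - D' z v) = (\<lambda>v. 0)"
    by (rule differential_zero_maxmin[OF S(2) S(1) d]) (use S in auto)
  then have "D z v = D' z v" for v using fun_cong[of _ _ v] by fastforce
  then have "G z \<bullet> e = G' z \<bullet> e" for e using 1(2) 2(2) assms(3,4) by simp
  then show ?thesis using vector_eq_rdot by blast
qed

end

section \<open>Viscosity subsolutions and comparison with smooth functions\<close>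

lemma deriv_along:
  fixes g :: "heis \<times> real \<Rightarrow> real"
  assumes "(g has_derivative E) (at (p, t))"
  shows "deriv (\<lambda>s. g (p + s *\<^sub>R v, t)) 0 = E (v, 0)"
proof -
  interpret E: bounded_linear E by (rule has_derivative_bounded_linear[OF assms])
  have "((\<lambda>s::real. (p + s *\<^sub>R v, t)) has_derivative (\<lambda>s. (s *\<^sub>R v, 0))) (at 0)"
    by (auto intro!: derivative_eq_intros)
  then have "((\<lambda>s. g (p + s *\<^sub>R v, t)) has_derivative (\<lambda>s. E (s *\<^sub>R v, 0))) (at 0)"
    using has_derivative_compose[of "\<lambda>s::real. (p + s *\<^sub>R v, t)" _ 0 UNIV g E] assms by simp
  moreover have "E (s *\<^sub>R v, 0) = E (v, 0) * s" for s
    using E.scaleR[of s "(v, 0)"] by simp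
  ultimately have "((\<lambda>s. g (p + s *\<^sub>R v, t)) has_real_derivative E (v, 0)) (at 0)"
    by (simp add: has_field_derivative_def)
  then show ?thesis by (rule DERIV_imp_deriv)
qed

lemma X1_eq:
  assumes "((g :: heis \<times> real \<Rightarrow> real) has_derivative E) (at (p, t))"
  shows "X1 (\<lambda>q. g (q, t)) p = E (hvec (axis 1 1) p, 0)"
proof -
  interpret E: bounded_linear E by (rule has_derivative_bounded_linear[OF assms])
  have "(hvec (axis 1 1) p, 0::real) = (axis 1 1, 0) - (p$2/2) *\<^sub>R (axis 3 1, 0)"
    by (simp add: vec_eq_iff forall_3) (simp add: axis_def)
  then have "E (hvec (axis 1 1) p, 0) = E (axis 1 1, 0) - (p$2/2) * E (axis 3 1, 0)"
    by (simp only: E.diff E.scaleR real_scaleR_def)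
  then show ?thesis by (simp add: X1_def partial_def deriv_along[OF assms])
qed

lemma X2_eq:
  assumes "((g :: heis \<times> real \<Rightarrow> real) has_derivative E) (at (p, t))"
  shows "X2 (\<lambda>q. g (q, t)) p = E (hvec (axis 2 1) p, 0)"
proof -
  interpret E: bounded_linear E by (rule has_derivative_bounded_linear[OF assms])
  have "(hvec (axis 2 1) p, 0::real) = (axis 2 1, 0) + (p$1/2) *\<^sub>R (axis 3 1, 0)"
    by (simp add: vec_eq_iff forall_3) (simp add: axis_def)
  then have "E (hvec (axis 2 1) p, 0) = E (axis 2 1, 0) + (p$1/2) * E (axis 3 1, 0)"
    by (simp only: E.add E.scaleR real_scaleR_def)
  then show ?thesis by (simp add: X2_def partial_def deriv_along[OF assms])
qed

lemma partial_cong: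
  assumes "\<forall>\<^sub>F q in nhds p. u q = v q"
  shows "partial i u p = partial i v p"
  unfolding partial_def
proof (rule deriv_cong_ev[OF _ refl])
  have "((\<lambda>s::real. p + s *\<^sub>R axis i 1) \<longlongrightarrow> p + 0 *\<^sub>R axis i 1) (nhds 0)"
    by (intro tendsto_intros filterlim_ident)
  then have "filterlim (\<lambda>s::real. p + s *\<^sub>R axis i 1) (nhds p) (nhds 0)"
    by simp
  then show "\<forall>\<^sub>F s in nhds 0. u (p + s *\<^sub>R axis i 1) = v (p + s *\<^sub>R axis i 1)"
    using assms by (rule eventually_compose_filterlim[rotated])
qed

lemma X1_cong: "\<forall>\<^sub>F q in nhds p. u q = v q \<Longrightarrow> X1 u p = X1 v p"
  and X2_cong: "\<forall>\<^sub>F q in nhds p. u q = v q \<Longrightarrow> X2 u p = X2 v p"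
  by (simp_all add: X1_def X2_def partial_cong)

text \<open>The direction moves with the base point and contributes a vertical derivative beside the
  Hessian term. For mixed derivatives this is the source of the commutator of the two
  fields.\<close>

lemma jet2_hvec_derivative:
  fixes \<phi> :: "heis \<times> real \<Rightarrow> real"
  assumes j: "jet2 U \<phi> D H" and z: "z \<in> U"
  shows "((\<lambda>y. D y (hvec e (fst y), 0)) has_derivative
     (\<lambda>h. H z (hvec e (fst z), 0) h + (fst h $ 1 * e$2 - fst h $ 2 * e$1) / 2 * D z (axis 3 1, 0))) (at z)"
proof -
  define w where "w = (axis 3 (1::real) :: heis, 0::real)"
  define v where "v = (vector [e$1, e$2, 0] :: heis, 0::real)"
  have ev: "(hvec e p, 0) = v + ((p$1 * e$2 - p$2 * e$1) / 2) *\<^sub>R w" for p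
    by (simp add: v_def w_def vec_eq_iff forall_3) (simp add: axis_def)
  have U: "open U" and d: "\<And>v. ((\<lambda>y. D y v) has_derivative H z v) (at z)"
    using j z unfolding jet2_def by auto
  have l: "D y (v + r *\<^sub>R w) = D y v + r * D y w" if "y \<in> U" for y r
    using jet2_linear1[OF j that] by (simp add: linear_add linear_scale)
  have lH: "H z (v + r *\<^sub>R w) h = H z v h + r * H z w h" for r h
    using linear_add[OF jet2_linear_left[OF j z], of v "r *\<^sub>R w" h] linear_scale[OF jet2_linear_left[OF j z], of r w h]
    by simp
  have nth: "((\<lambda>y::heis \<times> real. fst y $ i) has_derivative (\<lambda>h. fst h $ i)) (at z)" for i
    by (intro bounded_linear_imp_has_derivative bounded_linear_compose[OF bounded_linear_vec_nth bounded_linear_fst])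
  have al: "((\<lambda>y::heis \<times> real. (fst y $ 1 * e$2 - fst y $ 2 * e$1) / 2) has_derivative
      (\<lambda>h. (fst h $ 1 * e$2 - fst h $ 2 * e$1) / 2)) (at z)"
    unfolding divide_inverse
    by (intro has_derivative_mult_left has_derivative_diff nth)
  have "((\<lambda>y. D y v + ((fst y $ 1 * e$2 - fst y $ 2 * e$1) / 2) * D y w) has_derivative
     (\<lambda>h. H z v h + (((fst z $ 1 * e$2 - fst z $ 2 * e$1) / 2) * H z w h +
        ((fst h $ 1 * e$2 - fst h $ 2 * e$1) / 2) * D z w))) (at z)"
    by (intro has_derivative_add has_derivative_mult al d)
  then have "((\<lambda>y. D y (v + ((fst y $ 1 * e$2 - fst y $ 2 * e$1) / 2) *\<^sub>R w)) has_derivative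
     (\<lambda>h. H z v h + (((fst z $ 1 * e$2 - fst z $ 2 * e$1) / 2) * H z w h +
        ((fst h $ 1 * e$2 - fst h $ 2 * e$1) / 2) * D z w))) (at z)"
    by (rule has_derivative_transform_within_open[OF _ U z]) (simp only: l)
  then show ?thesis
    unfolding ev w_def[symmetric] lH by (simp add: algebra_simps)
qed

section \<open>The equation in terms of jets\<close>

context horizontal_pair
begin

text \<open>The vertical derivatives picked up by \<open>X1 (X2 u)\<close> and
  \<open>X2 (X1 u)\<close> have coefficients 1/2 and -1/2 and cancel in the symmetrized Hessian.
  What remains is bilinear in the frame, and the decomposition of \<open>A\<close> turns the trace
  into \<open>lap\<close>.\<close>

lemma pde_lhs_cjet:
  assumes A: "\<And>i j. A $ i $ j = a $ i * a $ j + b $ i * b $ j"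
    and cj: "cjet U \<phi> T G L" and z: "(p, t) \<in> U"
  shows "pde_lhs A f \<phi> p t = T (p, t) - L (p, t) + f p (G (p, t))"
proof -
  obtain D H where 1: "jet2 U \<phi> D H" "jet_coords U D H T G L"
    using cj unfolding cjet_def by blast
  define h1 where "h1 = (hvec (axis 1 1) p, 0::real)"
  define h2 where "h2 = (hvec (axis 2 1) p, 0::real)"
  have U: "open U" and d: "\<And>z. z \<in> U \<Longrightarrow> (\<phi> has_derivative D z) (at z)"
    using 1(1) unfolding jet2_def by auto
  have nb: "\<forall>\<^sub>F q in nhds p. (q, t) \<in> U"
  proof -
    have "filterlim (\<lambda>q. (q, t)) (nhds (p, t)) (nhds p)"
      by (intro tendsto_intros filterlim_ident)
    then show ?thesis
      using eventually_nhds_in_open[OF U z] by (rule eventually_compose_filterlim[rotated])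
  qed
  have e1: "X1 (\<lambda>q. \<phi> (q, t)) q = D (q, t) (hvec (axis 1 1) q, 0)" if "(q, t) \<in> U" for q
    by (rule X1_eq[OF d[OF that]])
  have e2: "X2 (\<lambda>q. \<phi> (q, t)) q = D (q, t) (hvec (axis 2 1) q, 0)" if "(q, t) \<in> U" for q
    by (rule X2_eq[OF d[OF that]])
  have n1: "\<forall>\<^sub>F q in nhds p. X1 (\<lambda>q. \<phi> (q, t)) q = D (q, t) (hvec (axis 1 1) q, 0)"
    using nb by (rule eventually_mono) (rule e1)
  have n2: "\<forall>\<^sub>F q in nhds p. X2 (\<lambda>q. \<phi> (q, t)) q = D (q, t) (hvec (axis 2 1) q, 0)"
    using nb by (rule eventually_mono) (rule e2)
  note dd = jet2_hvec_derivative[OF 1(1) z]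
  have x11: "X1 (X1 (\<lambda>q. \<phi> (q, t))) p = H (p, t) h1 h1"
    using X1_eq[OF dd[of "axis 1 1"]] X1_cong[OF n1] by (simp add: h1_def axis_def)
  have x12: "X1 (X2 (\<lambda>q. \<phi> (q, t))) p = H (p, t) h2 h1 + D (p, t) (axis 3 1, 0) / 2"
    using X1_eq[OF dd[of "axis 2 1"]] X1_cong[OF n2] by (simp add: h1_def h2_def axis_def)
  have x21: "X2 (X1 (\<lambda>q. \<phi> (q, t))) p = H (p, t) h1 h2 - D (p, t) (axis 3 1, 0) / 2"
    using X2_eq[OF dd[of "axis 1 1"]] X2_cong[OF n1] by (simp add: h1_def h2_def axis_def)
  have x22: "X2 (X2 (\<lambda>q. \<phi> (q, t))) p = H (p, t) h2 h2"
    using X2_eq[OF dd[of "axis 2 1"]] X2_cong[OF n2] by (simp add: h2_def axis_def)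
  have tm: "deriv (\<lambda>s. \<phi> (p, s)) t = T (p, t)"
  proof -
    have "((\<lambda>s::real. (p, s)) has_derivative (\<lambda>s. (0, s))) (at t)"
      by (auto intro!: derivative_eq_intros)
    then have "((\<lambda>s. \<phi> (p, s)) has_derivative (\<lambda>s. D (p, t) (0, s))) (at t)"
      using has_derivative_compose[of "\<lambda>s. (p, s)" "\<lambda>s. (0, s)" t UNIV \<phi> "D (p, t)"] d[OF z] by simp
    moreover have "(\<lambda>s. D (p, t) (0, s)) = (*) (T (p, t))"
    proof
      fix s
      show "D (p, t) (0, s) = T (p, t) * s"
        using linear_scale[OF jet2_linear1[OF 1(1) z], of s "(0, 1)"] 1(2) z by simp
    qed
    ultimately show ?thesis
      by (intro DERIV_imp_deriv) (simp only: has_field_derivative_def)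
  qed
  have gr: "hgrad (\<lambda>q. \<phi> (q, t)) p = G (p, t)"
  proof -
    have "G (p, t) \<bullet> axis 1 1 = D (p, t) h1" "G (p, t) \<bullet> axis 2 1 = D (p, t) h2"
      using 1(2) z unfolding h1_def h2_def by auto
    then show ?thesis
      using e1[OF z] e2[OF z] by (simp add: hgrad_def vec_eq_iff forall_2 inner_axis h1_def h2_def)
  qed
  have bl: "H (p, t) (hvec e p, 0) (hvec e p, 0) =
     e$1 * e$1 * H (p, t) h1 h1 + e$1 * e$2 * (H (p, t) h1 h2 + H (p, t) h2 h1) + e$2 * e$2 * H (p, t) h2 h2" for e
  proof -
    have he: "(hvec e p, 0) = e$1 *\<^sub>R h1 + e$2 *\<^sub>R h2"
      by (simp add: h1_def h2_def vec_eq_iff forall_3) (simp add: axis_def field_simps)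
    note l = jet2_linear_left[OF 1(1) z] and r = jet2_linear_right[OF 1(1) z]
    show ?thesis
      unfolding he linear_add[OF l] linear_scale[OF l] linear_add[OF r] linear_scale[OF r]
      by (simp add: algebra_simps)
  qed
  have "trace (A ** hhess_sym (\<lambda>q. \<phi> (q, t)) p) = L (p, t)"
    using 1(2) z
    by (simp add: trace_def matrix_matrix_mult_def sum_2 hhess_sym_def Let_def A x11 x12 x21 x22 lap_def bl)
      (simp add: algebra_simps)
  then show ?thesis by (simp add: pde_lhs_def tm gr)
qed

text \<open>Leaving \<open>F\<close> and \<open>\<Omega>\<close> free lets one notion cover the
  given equation, its reflection satisfied by \<open>- v\<close>, the equations with constant
  right-hand side, and the extremal inequality for the difference. Continuity is carried
  separately.\<close>

definition vsub :: "(heis \<Rightarrow> real ^ 2 \<Rightarrow> real) \<Rightarrow> (heis \<times> real) set \<Rightarrow> (heis \<times> real \<Rightarrow> real) \<Rightarrow> bool" where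
  "vsub F \<Omega> u \<longleftrightarrow> (\<forall>z\<in>\<Omega>. \<forall>\<phi> U T G L. z \<in> U \<longrightarrow> cjet U \<phi> T G L \<longrightarrow>
     (\<forall>\<^sub>F y in nhds z. u y - \<phi> y \<le> u z - \<phi> z) \<longrightarrow> T z - L z + F (fst z) (G z) \<le> 0)"

lemma vsubD:
  assumes "vsub F \<Omega> u" "z \<in> \<Omega>" "cjet U \<phi> T G L" "z \<in> U" "\<forall>\<^sub>F y in nhds z. u y - \<phi> y \<le> u z - \<phi> z"
  shows "T z - L z + F (fst z) (G z) \<le> 0"
  using assms unfolding vsub_def by blast

lemma cjet_C2_near:
  assumes "cjet U \<phi> T G L" "z \<in> U"
  shows "C2_near z \<phi>"
  using assms jet2_imp_C2_on unfolding cjet_def C2_near_def jet2_def by metis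

lemma cjet_uminus:
  assumes "cjet U \<phi> T G L"
  shows "cjet U (\<lambda>z. - \<phi> z) (\<lambda>z. - T z) (\<lambda>z. - G z) (\<lambda>z. - L z)"
proof -
  have "cjet U (\<lambda>z. -1 * \<phi> z) (\<lambda>z. -1 * T z + \<phi> z * 0) (\<lambda>z. -1 *\<^sub>R G z + \<phi> z *\<^sub>R 0) (\<lambda>z. -1 * L z + \<phi> z * 0 + 2 * gam 0 (G z))"
    by (rule cjet_mult[OF cjet_const assms]) (rule cjet_open[OF assms])
  then show ?thesis by (simp add: gam_def)
qed

lemma vsub_viscosity_subsolution:
  assumes A: "\<And>i j. A $ i $ j = a $ i * a $ j + b $ i * b $ j"
    and u: "viscosity_subsolution A f u"
  shows "vsub f (UNIV \<times> {0<..}) u"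
  unfolding vsub_def
proof (intro ballI allI impI)
  fix z \<phi> U T G L
  assume z: "z \<in> UNIV \<times> {0<..}" "z \<in> U" and cj: "cjet U \<phi> T G L"
    and m: "\<forall>\<^sub>F y in nhds z. u y - \<phi> y \<le> u z - \<phi> z"
  obtain p t where pt: "z = (p, t)" by fastforce
  have "pde_lhs A f \<phi> p t \<le> 0"
    using u cjet_C2_near[OF cj z(2)] m z(1) unfolding viscosity_subsolution_def local_max_at_def pt by auto
  then show "T z - L z + f (fst z) (G z) \<le> 0"
    using pde_lhs_cjet[OF A cj] z(2) pt by simp
qed

lemma vsub_viscosity_supersolution:
  assumes A: "\<And>i j. A $ i $ j = a $ i * a $ j + b $ i * b $ j"
    and u: "viscosity_supersolution A f u"
  shows "vsub (\<lambda>p w. - f p (- w)) (UNIV \<times> {0<..}) (\<lambda>z. - u z)"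
  unfolding vsub_def
proof (intro ballI allI impI)
  fix z \<phi> U T G L
  assume z: "z \<in> UNIV \<times> {0<..}" "z \<in> U" and cj: "cjet U \<phi> T G L"
    and m: "\<forall>\<^sub>F y in nhds z. - u y - \<phi> y \<le> - u z - \<phi> z"
  obtain p t where pt: "z = (p, t)" by fastforce
  note cj' = cjet_uminus[OF cj]
  have "\<forall>\<^sub>F y in nhds z. u z - - \<phi> z \<le> u y - - \<phi> y"
    using m by (rule eventually_mono) simp
  then have "pde_lhs A f (\<lambda>z. - \<phi> z) p t \<ge> 0"
    using u cjet_C2_near[OF cj' z(2)] z(1) unfolding viscosity_supersolution_def local_min_at_def pt by auto
  then show "T z - L z + - f (fst z) (- G z) \<le> 0"
    using pde_lhs_cjet[OF A cj'] z(2) pt by simp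
qed

lemma cjet_snd: "open U \<Longrightarrow> cjet U snd (\<lambda>_. 1) (\<lambda>_. 0) (\<lambda>_. 0)"
  by (rule cjet_cong[OF cjet_linear[OF bounded_linear_snd]]) (auto simp: vec_eq_iff forall_2)

lemma cjet_nth:
  assumes "open U"
  shows "cjet U (\<lambda>z. fst z $ 1) (\<lambda>_. 0) (\<lambda>_. axis 1 1) (\<lambda>_. 0)"
    "cjet U (\<lambda>z. fst z $ 2) (\<lambda>_. 0) (\<lambda>_. axis 2 1) (\<lambda>_. 0)"
    "cjet U (\<lambda>z. fst z $ 3) (\<lambda>_. 0) (\<lambda>z. vector [- (fst z $ 2) / 2, fst z $ 1 / 2]) (\<lambda>_. 0)"
  by (rule cjet_cong[OF cjet_linear[OF bounded_linear_compose[OF bounded_linear_vec_nth bounded_linear_fst] assms]];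
     simp add: vec_eq_iff forall_2 axis_def)+

text \<open>A test function must touch in a full space-time neighbourhood, so a maximum at the final
  time says nothing. The window is therefore twice as long as the interval of the conclusion, and a
  high power of time penalizes its second half.\<close>

lemma vsub_comparison:
  assumes vs: "vsub F \<Omega> u" and \<Omega>: "ball p r \<times> {s<..<s+2*k} \<subseteq> \<Omega>" and k: "0 < k"
    and cont: "continuous_on (cball p r \<times> {s..s+2*k}) u"
    and cj: "cjet V \<Psi> T G L" and V: "cball p r \<times> {s..s+2*k} \<subseteq> V"
    and super: "\<And>q t. dist p q < r \<Longrightarrow> s < t \<Longrightarrow> t < s+2*k \<Longrightarrow> T (q, t) - L (q, t) + F q (G (q, t)) \<ge> 0"
    and bottom: "\<And>q. dist p q \<le> r \<Longrightarrow> u (q, s) \<le> \<Psi> (q, s)"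
    and lateral: "\<And>q t. dist p q = r \<Longrightarrow> s \<le> t \<Longrightarrow> t \<le> s+2*k \<Longrightarrow> u (q, t) \<le> \<Psi> (q, t)"
    and q: "dist p q \<le> r" and t: "s \<le> t" "t \<le> s + k"
  shows "u (q, t) \<le> \<Psi> (q, t)"
proof (rule ccontr)
  assume "\<not> u (q, t) \<le> \<Psi> (q, t)"
  define d where "d = u (q, t) - \<Psi> (q, t)"
  have d: "d > 0" using \<open>\<not> _\<close> by (simp add: d_def)
  define K where "K = cball p r \<times> {s..s+2*k}"
  have K: "compact K" by (simp add: K_def compact_Times)
  have qK: "(q, t) \<in> K" using q t k by (auto simp: K_def)
  have c\<Psi>: "continuous_on K \<Psi>"
    using cjet_continuous(1)[OF cj] V continuous_on_subset unfolding K_def by blast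
  have cu: "continuous_on K u" using cont by (simp add: K_def)
  obtain B where B: "\<And>z. z \<in> K \<Longrightarrow> u z - \<Psi> z \<le> B"
  proof -
    have "compact ((\<lambda>z. u z - \<Psi> z) ` K)"
      by (intro compact_continuous_image continuous_intros cu c\<Psi> K)
    then have "bdd_above ((\<lambda>z. u z - \<Psi> z) ` K)" by (intro bounded_imp_bdd_above compact_imp_bounded)
    then show thesis using that by (auto simp: bdd_above_def)
  qed
  \<comment> \<open>With this \<open>n\<close> the penalty exceeds the largest excess
    \<open>B\<close> at time \<open>s+2*k\<close>, while it stays below \<open>d/2\<close> up to
    time \<open>s+k\<close>.\<close>
  obtain n :: nat where n: "B / (d/2) < 2 ^ n" using real_arch_pow[of 2 "B / (d/2)"] by auto
  \<comment> \<open>The offset 2 lets the power be differentiated twice with exponents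
    \<open>n+2\<close>, \<open>n+1\<close>, \<open>n\<close>, without truncated subtraction.\<close>
  define m where "m = n + 2"
  have m: "d/2 * 2 ^ m > B"
  proof -
    have "B < d/2 * 2 ^ n" using n d by (simp add: field_simps)
    also have "\<dots> \<le> d/2 * 2 ^ m" using d by (intro mult_left_mono) (auto simp: m_def)
    finally show ?thesis .
  qed
  define P where "P z = d/2 * ((snd z - s) / k) ^ m" for z :: "heis \<times> real"
  have cP: "continuous_on K P" unfolding P_def using k by (intro continuous_intros) auto
  have "\<exists>z\<in>K. \<forall>y\<in>K. u y - \<Psi> y - P y \<le> u z - \<Psi> z - P z"
    using qK by (intro continuous_attains_sup[OF K] continuous_intros cu c\<Psi> cP) auto
  then obtain z where z: "z \<in> K" and zmax: "\<And>y. y \<in> K \<Longrightarrow> u y - \<Psi> y - P y \<le> u z - \<Psi> z - P z"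
    by blast
  have "P (q, t) \<le> d/2 * 1"
    unfolding P_def using d t k by (intro mult_left_mono power_le_one) (auto simp: divide_simps)
  then have pos: "u z - \<Psi> z - P z > 0"
    using zmax[OF qK] d by (simp add: d_def)
  have P0: "P z \<ge> 0" if "z \<in> K" for z
    unfolding P_def using d k that by (auto simp: K_def intro!: mult_nonneg_nonneg zero_le_power)
  obtain x \<tau> where zx: "z = (x, \<tau>)" by fastforce
  have xr: "dist p x \<le> r" "s \<le> \<tau>" "\<tau> \<le> s + 2*k" using z by (auto simp: zx K_def)
  have "dist p x \<noteq> r"
    using lateral[of x \<tau>] xr pos P0[OF z] by (auto simp: zx)
  moreover have "\<tau> \<noteq> s"
    using bottom[of x] xr pos P0[OF z] by (auto simp: zx)
  moreover have "\<tau> \<noteq> s + 2*k"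
  proof
    assume "\<tau> = s + 2*k"
    then have "P z = d/2 * 2 ^ m" using k by (simp add: P_def zx)
    then show False using m B[OF z] pos by simp
  qed
  ultimately have int: "dist p x < r" "s < \<tau>" "\<tau> < s + 2*k" using xr by auto
  define O' where "O' = ball p r \<times> {s<..<s+2*k}"
  have O': "open O'" "z \<in> O'" "O' \<subseteq> K" using int by (auto simp: O'_def K_def zx open_Times)
  define c where "c = d/2 / k ^ m"
  have c: "c > 0" using d k by (simp add: c_def)
  have P_eq: "P = (\<lambda>z. c * (snd z - s) ^ (n + 2))"
    by (auto simp: P_def c_def m_def power_divide)
  have cjP: "cjet V P (\<lambda>z. c * (real (n + 2) * (snd z - s) ^ (n + 1)) * 1)
     (\<lambda>z. (c * (real (n + 2) * (snd z - s) ^ (n + 1))) *\<^sub>R 0)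
     (\<lambda>z. c * (real (n + 2) * (snd z - s) ^ (n + 1)) * 0 +
        c * (real (n + 2) * (real (n + 1) * (snd z - s) ^ n)) * gam 0 0)"
    unfolding P_eq
  proof (rule cjet_compose[OF cjet_snd[OF cjet_open[OF cj]]])
    fix z :: "heis \<times> real"
    show "((\<lambda>t. c * (t - s) ^ (n + 2)) has_real_derivative c * (real (n + 2) * (snd z - s) ^ (n + 1))) (at (snd z))"
      by (rule derivative_eq_intros refl | simp)+
    show "((\<lambda>t. c * (real (n + 2) * (t - s) ^ (n + 1))) has_real_derivative
       c * (real (n + 2) * (real (n + 1) * (snd z - s) ^ n))) (at (snd z))"
      by (rule derivative_eq_intros refl | simp)+
  qed (intro continuous_intros)
  note cj2 = cjet_add[OF cj cjP]
  have "\<forall>\<^sub>F y in nhds z. u y - (\<Psi> y + P y) \<le> u z - (\<Psi> z + P z)"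
    using eventually_nhds_in_open[OF O'(1,2)]
    by (rule eventually_mono) (use zmax O'(3) in \<open>auto simp: algebra_simps subset_iff\<close>)
  then have "T z + c * (real (n + 2) * (snd z - s) ^ (n + 1)) - L z + F (fst z) (G z) \<le> 0"
    using vsubD[OF vs _ cj2, of z] z O'(2) \<Omega> V by (auto simp: gam_def O'_def K_def)
  moreover have "c * (real (n + 2) * (snd z - s) ^ (n + 1)) > 0"
    using c int by (simp add: zx)
  ultimately show False using super[OF int] by (simp add: zx)
qed

end

section \<open>Approximate solutions of the linear equation by random walks\<close>

text \<open>Functions of \<open>x\<close> and \<open>y = x \<cdot>\<^sub>H s\<close>. Differentiating \<open>x \<mapsto> F x (x \<cdot>\<^sub>H s)\<close> stays in the class,
  with a derivative that does not depend on \<open>s\<close>; this gives bounds uniform in \<open>s\<close>.\<close>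

inductive poly_gauss :: "(heis \<Rightarrow> heis \<Rightarrow> real) \<Rightarrow> bool" where
  const: "poly_gauss (\<lambda>x y. c)"
| coord: "poly_gauss (\<lambda>x y. x $ i)"
| gauss: "poly_gauss (\<lambda>x y. y$1 ^ i * y$2 ^ j * y$3 ^ k * exp (- (y \<bullet> y)))"
| add: "poly_gauss F \<Longrightarrow> poly_gauss G \<Longrightarrow> poly_gauss (\<lambda>x y. F x y + G x y)"
| mult: "poly_gauss F \<Longrightarrow> poly_gauss G \<Longrightarrow> poly_gauss (\<lambda>x y. F x y * G x y)"

lemma poly_gauss_sub: "poly_gauss F \<Longrightarrow> poly_gauss G \<Longrightarrow> poly_gauss (\<lambda>x y. F x y - G x y)"
  using poly_gauss.add[OF _ poly_gauss.mult[OF poly_gauss.const[of "-1"]], of F G] by simp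

lemma power_exp_neg_square_bounded: "\<exists>C. \<forall>t::real. \<bar>t ^ n * exp (- t\<^sup>2)\<bar> \<le> C"
proof (intro exI allI)
  fix t :: real
  have "\<bar>t\<bar> ^ n / fact n \<le> exp \<bar>t\<bar>"
  proof -
    have "(\<Sum>k\<in>{n}. \<bar>t\<bar> ^ k /\<^sub>R fact k) \<le> (\<Sum>k. \<bar>t\<bar> ^ k /\<^sub>R fact k)"
      by (rule sum_le_suminf[OF summable_exp_generic]) auto
    then show ?thesis by (simp add: exp_def divide_inverse mult.commute)
  qed
  then have "\<bar>t\<bar> ^ n \<le> fact n * exp \<bar>t\<bar>" by (simp add: field_simps)
  moreover have "\<bar>t\<bar> \<le> t\<^sup>2 + 1"
  proof -
    have "0 \<le> (\<bar>t\<bar> - 1/2)\<^sup>2" by simp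
    then show ?thesis by (simp add: power2_eq_square algebra_simps)
  qed
  then have "exp \<bar>t\<bar> \<le> exp (t\<^sup>2 + 1)" by simp
  ultimately have "\<bar>t\<bar> ^ n \<le> fact n * exp (t\<^sup>2 + 1)"
    by (meson fact_ge_zero mult_left_mono order_trans)
  then have "\<bar>t\<bar> ^ n * exp (- t\<^sup>2) \<le> fact n * exp (t\<^sup>2 + 1) * exp (- t\<^sup>2)"
    by (intro mult_right_mono) auto
  also have "\<dots> = fact n * exp 1" by (simp add: mult.assoc flip: exp_add)
  finally show "\<bar>t ^ n * exp (- t\<^sup>2)\<bar> \<le> fact n * exp 1" by (simp add: abs_mult power_abs)
qed

lemma poly_gauss_bounded:
  assumes "poly_gauss F"
  shows "\<exists>C. \<forall>x y. norm x \<le> R \<longrightarrow> \<bar>F x y\<bar> \<le> C"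
  using assms
proof induction
  case (const c)
  then show ?case by blast
next
  case (coord i)
  then show ?case
    by (intro exI[of _ R]) (meson component_le_norm_cart order_trans)
next
  case (gauss i j k)
  obtain A B C where A: "\<And>t::real. \<bar>t ^ i * exp (- t\<^sup>2)\<bar> \<le> A" and B: "\<And>t::real. \<bar>t ^ j * exp (- t\<^sup>2)\<bar> \<le> B"
    and C: "\<And>t::real. \<bar>t ^ k * exp (- t\<^sup>2)\<bar> \<le> C"
    using power_exp_neg_square_bounded by metis
  have "\<bar>y$1 ^ i * y$2 ^ j * y$3 ^ k * exp (- (y \<bullet> y))\<bar> \<le> A * B * C" for y :: heis
  proof -
    have "y$1 ^ i * y$2 ^ j * y$3 ^ k * exp (- (y \<bullet> y)) =
      (y$1 ^ i * exp (- (y$1)\<^sup>2)) * (y$2 ^ j * exp (- (y$2)\<^sup>2)) * (y$3 ^ k * exp (- (y$3)\<^sup>2))"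
      by (simp add: inner_vec_def sum_3 power2_eq_square exp_add exp_diff exp_minus field_simps)
    also have "\<bar>\<dots>\<bar> = \<bar>y$1 ^ i * exp (- (y$1)\<^sup>2)\<bar> * \<bar>y$2 ^ j * exp (- (y$2)\<^sup>2)\<bar> * \<bar>y$3 ^ k * exp (- (y$3)\<^sup>2)\<bar>"
      by (simp only: abs_mult)
    also have "\<dots> \<le> A * B * C"
      using A[of "y$1"] B[of "y$2"] C[of "y$3"] by (intro mult_mono mult_nonneg_nonneg) auto
    finally show ?thesis .
  qed
  then show ?case by blast
next
  case (add F G)
  then obtain A B where "\<forall>x y. norm x \<le> R \<longrightarrow> \<bar>F x y\<bar> \<le> A" "\<forall>x y. norm x \<le> R \<longrightarrow> \<bar>G x y\<bar> \<le> B" by blast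
  then show ?case by (intro exI[of _ "A + B"]) (meson abs_triangle_ineq add_mono order_trans)
next
  case (mult F G)
  then obtain A B where AB: "\<forall>x y. norm x \<le> R \<longrightarrow> \<bar>F x y\<bar> \<le> A" "\<forall>x y. norm x \<le> R \<longrightarrow> \<bar>G x y\<bar> \<le> B" by blast
  show ?case
  proof (intro exI allI impI)
    fix x y :: heis assume "norm x \<le> R"
    then have "\<bar>F x y\<bar> \<le> A" "\<bar>G x y\<bar> \<le> B" using AB by auto
    then show "\<bar>F x y * G x y\<bar> \<le> A * B"
      unfolding abs_mult by (intro mult_mono) auto
  qed
qed

abbreviation frame_diff ::
  "(heis \<Rightarrow> heis \<Rightarrow> real) \<Rightarrow> (heis \<Rightarrow> heis \<Rightarrow> real) \<Rightarrow> (heis \<Rightarrow> heis \<Rightarrow> real) \<Rightarrow> heis \<Rightarrow> heis \<Rightarrow> heis \<Rightarrow> real"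
where
  "frame_diff F1 F2 F3 s x \<equiv> (\<lambda>h. h$1 * F1 x (x \<cdot>\<^sub>H s) + h$2 * F2 x (x \<cdot>\<^sub>H s) + h$3 * F3 x (x \<cdot>\<^sub>H s))"

lemma poly_gauss_derivative:
  assumes "poly_gauss F"
  shows "\<exists>F1 F2 F3. poly_gauss F1 \<and> poly_gauss F2 \<and> poly_gauss F3 \<and>
    (\<forall>s x. ((\<lambda>x. F x (x \<cdot>\<^sub>H s)) has_derivative (frame_diff F1 F2 F3 s x)) (at x))"
  using assms
proof induction
  case (const c)
  show ?case
    by (intro exI[of _ "\<lambda>_ _. 0"] conjI poly_gauss.const allI) simp
next
  case (coord i)
  have d: "((\<lambda>x::heis. x $ i) has_derivative (\<lambda>h. h $ i)) (at x)" for x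
    by (intro bounded_linear_imp_has_derivative bounded_linear_vec_nth)
  show ?case
  proof (intro exI conjI allI)
    show "poly_gauss (\<lambda>_ _. if i = 1 then 1 else 0)" "poly_gauss (\<lambda>_ _. if i = 2 then 1 else 0)"
      "poly_gauss (\<lambda>_ _. if i = 3 then 1 else 0)" by (rule poly_gauss.const)+
    fix x
    show "((\<lambda>x::heis. x $ i) has_derivative (\<lambda>h. h$1 * (if i = 1 then 1 else 0) + h$2 * (if i = 2 then 1 else 0)
       + h$3 * (if i = 3 then 1 else 0))) (at x)"
      using d[of x] exhaust_3[of i] by auto
  qed
next
  case (gauss i j k)
  define g where "g i j k = (\<lambda>(x::heis) (y::heis). y$1 ^ i * y$2 ^ j * y$3 ^ k * exp (- (y \<bullet> y)))" for i j k :: nat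
  have pg: "poly_gauss (\<lambda>x y. c * g i j k x y)" for c i j k
    unfolding g_def by (intro poly_gauss.mult poly_gauss.const poly_gauss.gauss)
  \<comment> \<open>For \<open>i = 0\<close> the truncated exponent \<open>i-1\<close> is harmless,
    because the factor \<open>real i\<close> vanishes.\<close>
  define F1 where "F1 x y = real i * g (i-1) j k x y - 2 * g (i+1) j k x y" for x y
  define F2 where "F2 x y = real j * g i (j-1) k x y - 2 * g i (j+1) k x y" for x y
  define F3 where "F3 x y = real k * g i j (k-1) x y - 2 * g i j (k+1) x y" for x y
  \<comment> \<open>The derivative of \<open>x \<cdot>\<^sub>H s\<close> contains \<open>s$1\<close>
    and \<open>s$2\<close>, which equal \<open>y$1 - x$1\<close> and \<open>y$2 - x$2\<close>. A
    bare coordinate of \<open>y\<close> is not in the class, so its product with \<open>F3\<close>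
    is absorbed into the Gaussian monomials.\<close>
  define F13 where "F13 x y = real k * g (i+1) j (k-1) x y - 2 * g (i+1) j (k+1) x y" for x y
  define F23 where "F23 x y = real k * g i (j+1) (k-1) x y - 2 * g i (j+1) (k+1) x y" for x y
  have pgs: "poly_gauss F1" "poly_gauss F2" "poly_gauss F3" "poly_gauss F13" "poly_gauss F23"
    unfolding F1_def[abs_def] F2_def[abs_def] F3_def[abs_def] F13_def[abs_def] F23_def[abs_def]
    by (intro poly_gauss_sub pg)+
  have m: "F13 x y = y$1 * F3 x y" "F23 x y = y$2 * F3 x y" for x y
    by (simp_all add: F13_def F23_def F3_def g_def algebra_simps)
  have nth: "((\<lambda>x::heis. x $ i) has_derivative (\<lambda>h. h $ i)) (at x)" for x i
    by (intro bounded_linear_imp_has_derivative bounded_linear_vec_nth)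
  have dg: "((\<lambda>y. g i j k x y) has_derivative (\<lambda>h. h$1 * F1 x y + h$2 * F2 x y + h$3 * F3 x y)) (at y)" for x y
    unfolding g_def F1_def F2_def F3_def
    by (rule derivative_eq_intros nth refl)+
      (simp add: fun_eq_iff inner_vec_def sum_3 algebra_simps)
  have dm: "((\<lambda>x. x \<cdot>\<^sub>H s) has_derivative (\<lambda>h. vector [h$1, h$2, h$3 + (h$1 * s$2 - s$1 * h$2) / 2])) (at x)" for x s
  proof -
    have l: "linear (\<lambda>h::heis. vector [h$1, h$2, h$3 + (h$1 * s$2 - s$1 * h$2) / 2] :: heis)"
      by (rule linearI) (simp_all add: vec_eq_iff forall_3 algebra_simps add_divide_distrib diff_divide_distrib)
    have "((\<lambda>x. vector [x$1, x$2, x$3 + (x$1 * s$2 - s$1 * x$2) / 2] + s) has_derivative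
       (\<lambda>h. vector [h$1, h$2, h$3 + (h$1 * s$2 - s$1 * h$2) / 2] + 0)) (at x)"
      by (intro has_derivative_add has_derivative_const linear_imp_has_derivative l)
    moreover have "x \<cdot>\<^sub>H s = vector [x$1, x$2, x$3 + (x$1 * s$2 - s$1 * x$2) / 2] + s" for x
      by (simp add: vec_eq_iff forall_3)
    ultimately show ?thesis by simp
  qed
  show ?case
  proof (intro exI conjI allI)
    show "poly_gauss (\<lambda>x y. F1 x y + (1/2) * (F23 x y - x$2 * F3 x y))"
      "poly_gauss (\<lambda>x y. F2 x y - (1/2) * (F13 x y - x$1 * F3 x y))" "poly_gauss F3"
      by (intro poly_gauss.intros poly_gauss_sub pgs)+
    fix s x :: heis
    have "((\<lambda>x. g i j k x0 (x \<cdot>\<^sub>H s)) has_derivative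
      (\<lambda>h. h$1 * F1 x0 (x \<cdot>\<^sub>H s) + h$2 * F2 x0 (x \<cdot>\<^sub>H s) + (h$3 + (h$1 * s$2 - s$1 * h$2) / 2) * F3 x0 (x \<cdot>\<^sub>H s))) (at x)" for x0
      using has_derivative_compose[OF dm dg] by simp
    then have "((\<lambda>x. g i j k x (x \<cdot>\<^sub>H s)) has_derivative
      (\<lambda>h. h$1 * F1 x (x \<cdot>\<^sub>H s) + h$2 * F2 x (x \<cdot>\<^sub>H s) + (h$3 + (h$1 * s$2 - s$1 * h$2) / 2) * F3 x (x \<cdot>\<^sub>H s))) (at x)"
      unfolding g_def F1_def F2_def F3_def .
    then show "((\<lambda>x. (x \<cdot>\<^sub>H s)$1 ^ i * (x \<cdot>\<^sub>H s)$2 ^ j * (x \<cdot>\<^sub>H s)$3 ^ k * exp (- ((x \<cdot>\<^sub>H s) \<bullet> (x \<cdot>\<^sub>H s)))) has_derivative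
      (\<lambda>h. h$1 * (F1 x (x \<cdot>\<^sub>H s) + (1/2) * (F23 x (x \<cdot>\<^sub>H s) - x$2 * F3 x (x \<cdot>\<^sub>H s))) +
         h$2 * (F2 x (x \<cdot>\<^sub>H s) - (1/2) * (F13 x (x \<cdot>\<^sub>H s) - x$1 * F3 x (x \<cdot>\<^sub>H s))) + h$3 * F3 x (x \<cdot>\<^sub>H s))) (at x)"
      unfolding g_def m by (simp add: algebra_simps add_divide_distrib diff_divide_distrib)
  qed
next
  case (add F G)
  then obtain F1 F2 F3 G1 G2 G3 where pg: "poly_gauss F1" "poly_gauss F2" "poly_gauss F3"
      "poly_gauss G1" "poly_gauss G2" "poly_gauss G3"
    and d: "\<And>s x. ((\<lambda>x. F x (x \<cdot>\<^sub>H s)) has_derivative (frame_diff F1 F2 F3 s x)) (at x)"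
      "\<And>s x. ((\<lambda>x. G x (x \<cdot>\<^sub>H s)) has_derivative (frame_diff G1 G2 G3 s x)) (at x)"
    by blast
  show ?case
  proof (intro exI conjI allI)
    show "poly_gauss (\<lambda>x y. F1 x y + G1 x y)" "poly_gauss (\<lambda>x y. F2 x y + G2 x y)"
      "poly_gauss (\<lambda>x y. F3 x y + G3 x y)" by (intro poly_gauss.add pg)+
    fix s x :: heis
    show "((\<lambda>x. F x (x \<cdot>\<^sub>H s) + G x (x \<cdot>\<^sub>H s)) has_derivative
       (\<lambda>h. h$1 * (F1 x (x \<cdot>\<^sub>H s) + G1 x (x \<cdot>\<^sub>H s)) + h$2 * (F2 x (x \<cdot>\<^sub>H s) + G2 x (x \<cdot>\<^sub>H s))
          + h$3 * (F3 x (x \<cdot>\<^sub>H s) + G3 x (x \<cdot>\<^sub>H s)))) (at x)"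
      using has_derivative_add[OF d(1)[of s x] d(2)[of s x]] by (simp add: algebra_simps)
  qed
next
  case (mult F G)
  then obtain F1 F2 F3 G1 G2 G3 where pg: "poly_gauss F1" "poly_gauss F2" "poly_gauss F3"
      "poly_gauss G1" "poly_gauss G2" "poly_gauss G3"
    and d: "\<And>s x. ((\<lambda>x. F x (x \<cdot>\<^sub>H s)) has_derivative (frame_diff F1 F2 F3 s x)) (at x)"
      "\<And>s x. ((\<lambda>x. G x (x \<cdot>\<^sub>H s)) has_derivative (frame_diff G1 G2 G3 s x)) (at x)"
    by blast
  show ?case
  proof (intro exI conjI allI)
    show "poly_gauss (\<lambda>x y. F x y * G1 x y + F1 x y * G x y)" "poly_gauss (\<lambda>x y. F x y * G2 x y + F2 x y * G x y)"
      "poly_gauss (\<lambda>x y. F x y * G3 x y + F3 x y * G x y)" by (intro poly_gauss.add poly_gauss.mult pg mult.hyps)+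
    fix s x :: heis
    show "((\<lambda>x. F x (x \<cdot>\<^sub>H s) * G x (x \<cdot>\<^sub>H s)) has_derivative
       (\<lambda>h. h$1 * (F x (x \<cdot>\<^sub>H s) * G1 x (x \<cdot>\<^sub>H s) + F1 x (x \<cdot>\<^sub>H s) * G x (x \<cdot>\<^sub>H s)) +
         h$2 * (F x (x \<cdot>\<^sub>H s) * G2 x (x \<cdot>\<^sub>H s) + F2 x (x \<cdot>\<^sub>H s) * G x (x \<cdot>\<^sub>H s)) +
         h$3 * (F x (x \<cdot>\<^sub>H s) * G3 x (x \<cdot>\<^sub>H s) + F3 x (x \<cdot>\<^sub>H s) * G x (x \<cdot>\<^sub>H s)))) (at x)"
      using has_derivative_mult[OF d(1)[of s x] d(2)[of s x]] by (simp add: algebra_simps)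
  qed
qed

lemma poly_gauss_direction:
  assumes "poly_gauss F"
  shows "\<exists>F'. poly_gauss F' \<and> (\<forall>s x E. ((\<lambda>x. F x (x \<cdot>\<^sub>H s)) has_derivative E) (at x) \<longrightarrow> E (hvec e x) = F' x (x \<cdot>\<^sub>H s))"
proof -
  obtain F1 F2 F3 where pg: "poly_gauss F1" "poly_gauss F2" "poly_gauss F3"
    and d: "\<And>s x. ((\<lambda>x. F x (x \<cdot>\<^sub>H s)) has_derivative (frame_diff F1 F2 F3 s x)) (at x)"
    using poly_gauss_derivative[OF assms] by blast
  show ?thesis
  proof (intro exI conjI allI impI)
    show "poly_gauss (\<lambda>x y. e$1 * F1 x y + e$2 * F2 x y + (1/2) * (x$1 * e$2 - x$2 * e$1) * F3 x y)"
      by (intro poly_gauss.intros poly_gauss_sub pg)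
    fix s x E assume "((\<lambda>x. F x (x \<cdot>\<^sub>H s)) has_derivative E) (at x)"
    then have "E = (frame_diff F1 F2 F3 s x)"
      by (rule has_derivative_unique[OF _ d])
    then show "E (hvec e x) = e$1 * F1 x (x \<cdot>\<^sub>H s) + e$2 * F2 x (x \<cdot>\<^sub>H s) + (1/2) * (x$1 * e$2 - x$2 * e$1) * F3 x (x \<cdot>\<^sub>H s)"
      by simp
  qed
qed

lemma poly_gauss_jet2:
  assumes "poly_gauss F"
  shows "\<exists>D H. jet2 UNIV (\<lambda>z::heis \<times> real. F (fst z) (fst z \<cdot>\<^sub>H s)) D H \<and> (\<forall>z. D z (0, 1) = 0)"
proof -
  obtain F1 F2 F3 where pg: "poly_gauss F1" "poly_gauss F2" "poly_gauss F3"
    and d: "\<And>s x. ((\<lambda>x. F x (x \<cdot>\<^sub>H s)) has_derivative (frame_diff F1 F2 F3 s x)) (at x)"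
    using poly_gauss_derivative[OF assms] by blast
  have fin: "\<exists>E. (\<forall>z. ((\<lambda>z::heis \<times> real. P (fst z) (fst z \<cdot>\<^sub>H s)) has_derivative E z) (at z)) \<and>
     (\<forall>w. continuous_on UNIV (\<lambda>z. E z w))" if P: "poly_gauss P" for P
  proof -
    obtain P1 P2 P3 where pg: "poly_gauss P1" "poly_gauss P2" "poly_gauss P3"
      and d: "\<And>s x. ((\<lambda>x. P x (x \<cdot>\<^sub>H s)) has_derivative (frame_diff P1 P2 P3 s x)) (at x)"
      using poly_gauss_derivative[OF P] by blast
    have c: "continuous_on UNIV (\<lambda>z::heis \<times> real. Q (fst z) (fst z \<cdot>\<^sub>H s))" if Q: "poly_gauss Q" for Q
    proof -
      have "continuous_on UNIV (\<lambda>x. Q x (x \<cdot>\<^sub>H s))"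
        using poly_gauss_derivative[OF Q]
        by (intro continuous_at_imp_continuous_on ballI) (blast intro: has_derivative_continuous)
      then show ?thesis by (rule continuous_on_compose2) (auto intro: continuous_intros)
    qed
    show ?thesis
    proof (intro exI conjI allI)
      fix z :: "heis \<times> real"
      show "((\<lambda>z::heis \<times> real. P (fst z) (fst z \<cdot>\<^sub>H s)) has_derivative
        (\<lambda>h. fst h$1 * P1 (fst z) (fst z \<cdot>\<^sub>H s) + fst h$2 * P2 (fst z) (fst z \<cdot>\<^sub>H s) + fst h$3 * P3 (fst z) (fst z \<cdot>\<^sub>H s))) (at z)"
        by (rule has_derivative_compose[OF has_derivative_fst[OF has_derivative_ident] d])
    next
      fix w :: "heis \<times> real"
      show "continuous_on UNIV (\<lambda>z::heis \<times> real. fst w$1 * P1 (fst z) (fst z \<cdot>\<^sub>H s) + fst w$2 * P2 (fst z) (fst z \<cdot>\<^sub>H s) + fst w$3 * P3 (fst z) (fst z \<cdot>\<^sub>H s))"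
        by (intro continuous_intros c pg)
    qed
  qed
  obtain E1 E2 E3 where E: "\<And>z. ((\<lambda>z::heis \<times> real. F1 (fst z) (fst z \<cdot>\<^sub>H s)) has_derivative E1 z) (at z)"
     "\<And>z. ((\<lambda>z::heis \<times> real. F2 (fst z) (fst z \<cdot>\<^sub>H s)) has_derivative E2 z) (at z)"
     "\<And>z. ((\<lambda>z::heis \<times> real. F3 (fst z) (fst z \<cdot>\<^sub>H s)) has_derivative E3 z) (at z)"
     "\<And>w. continuous_on UNIV (\<lambda>z. E1 z w)" "\<And>w. continuous_on UNIV (\<lambda>z. E2 z w)" "\<And>w. continuous_on UNIV (\<lambda>z. E3 z w)"
    using fin[OF pg(1)] fin[OF pg(2)] fin[OF pg(3)] by blast
  have "jet2 UNIV (\<lambda>z::heis \<times> real. F (fst z) (fst z \<cdot>\<^sub>H s))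
     (\<lambda>z h. fst h$1 * F1 (fst z) (fst z \<cdot>\<^sub>H s) + fst h$2 * F2 (fst z) (fst z \<cdot>\<^sub>H s) + fst h$3 * F3 (fst z) (fst z \<cdot>\<^sub>H s))
     (\<lambda>z v w. fst v$1 * E1 z w + fst v$2 * E2 z w + fst v$3 * E3 z w)" (is "jet2 _ _ ?D ?H")
    unfolding jet2_def
  proof (intro conjI ballI allI)
    fix z :: "heis \<times> real"
    show "((\<lambda>z::heis \<times> real. F (fst z) (fst z \<cdot>\<^sub>H s)) has_derivative
      (\<lambda>h. fst h$1 * F1 (fst z) (fst z \<cdot>\<^sub>H s) + fst h$2 * F2 (fst z) (fst z \<cdot>\<^sub>H s) + fst h$3 * F3 (fst z) (fst z \<cdot>\<^sub>H s))) (at z)"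
      by (rule has_derivative_compose[OF has_derivative_fst[OF has_derivative_ident] d])
    fix v :: "heis \<times> real"
    show "((\<lambda>z. fst v$1 * F1 (fst z) (fst z \<cdot>\<^sub>H s) + fst v$2 * F2 (fst z) (fst z \<cdot>\<^sub>H s) + fst v$3 * F3 (fst z) (fst z \<cdot>\<^sub>H s))
      has_derivative (\<lambda>w. fst v$1 * E1 z w + fst v$2 * E2 z w + fst v$3 * E3 z w)) (at z)"
      by (intro has_derivative_add has_derivative_mult_right E)
  next
    fix v w :: "heis \<times> real"
    show "continuous_on UNIV (\<lambda>z. fst v$1 * E1 z w + fst v$2 * E2 z w + fst v$3 * E3 z w)"
      by (intro continuous_intros E)
  qed simp
  then have "jet2 UNIV (\<lambda>z::heis \<times> real. F (fst z) (fst z \<cdot>\<^sub>H s)) ?D ?H \<and> (\<forall>z. ?D z (0, 1) = 0)"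
    by simp
  then show ?thesis by (intro exI)
qed

section \<open>Expansion along integral curves and the random walk\<close>

definition hpt :: "real ^ 2 \<Rightarrow> heis" where
  "hpt e = vector [e$1, e$2, 0]"

lemma heis_mult_hpt: "x \<cdot>\<^sub>H hpt (r *\<^sub>R e) = x + r *\<^sub>R hvec e x"
  by (simp add: vec_eq_iff forall_3 hpt_def algebra_simps add_divide_distrib diff_divide_distrib)

lemma heis_mult_assoc: "(x \<cdot>\<^sub>H y) \<cdot>\<^sub>H z = x \<cdot>\<^sub>H (y \<cdot>\<^sub>H z)"
  by (simp add: vec_eq_iff forall_3 field_simps)

lemma norm_hvec_le: "norm x \<le> R \<Longrightarrow> norm (hvec e x) \<le> (1 + R) * (\<bar>e$1\<bar> + \<bar>e$2\<bar>)"
proof -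
  assume R: "norm x \<le> R"
  have x: "\<bar>x$i\<bar> \<le> R" for i using R by (meson component_le_norm_cart order_trans)
  have "norm (hvec e x) \<le> \<bar>e$1\<bar> + \<bar>e$2\<bar> + \<bar>(x$1 * e$2 - x$2 * e$1) / 2\<bar>"
    using norm_le_l1_cart[of "hvec e x"] by (simp add: sum_3)
  also have "\<bar>(x$1 * e$2 - x$2 * e$1) / 2\<bar> \<le> \<bar>x$1\<bar> * \<bar>e$2\<bar> + \<bar>x$2\<bar> * \<bar>e$1\<bar>"
  proof -
    have "\<bar>x$1 * e$2 - x$2 * e$1\<bar> \<le> \<bar>x$1\<bar> * \<bar>e$2\<bar> + \<bar>x$2\<bar> * \<bar>e$1\<bar>"
      by (metis abs_mult abs_triangle_ineq4)
    then show ?thesis using abs_ge_zero[of "x$1 * e$2 - x$2 * e$1"] by (simp add: abs_divide del: abs_ge_zero)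
  qed
  also have "\<dots> \<le> R * \<bar>e$2\<bar> + R * \<bar>e$1\<bar>"
    by (intro add_mono mult_right_mono x) auto
  finally show ?thesis by (simp add: algebra_simps)
qed

abbreviation shift :: "(heis \<Rightarrow> heis \<Rightarrow> real) \<Rightarrow> real ^ 2 \<Rightarrow> heis \<Rightarrow> heis \<Rightarrow> real \<Rightarrow> real" where
  "shift F e s x r \<equiv> F (x + r *\<^sub>R hvec e x) ((x + r *\<^sub>R hvec e x) \<cdot>\<^sub>H s)"

text \<open>A symmetric difference along an integral curve of the field kills the odd Taylor terms
  and leaves the second derivative with a fourth-order error. The last clause identifies
  \<open>F2\<close> with the Hessian of any jet of the same function.\<close>

lemma poly_gauss_taylor:
  assumes F: "poly_gauss F"
  shows "\<exists>F2 C. poly_gauss F2 \<and>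
    (\<forall>s x r. norm x \<le> R \<longrightarrow> \<bar>r\<bar> \<le> 2 \<longrightarrow>
       \<bar>shift F e s x r + shift F e s x (- r)
          - 2 * F x (x \<cdot>\<^sub>H s) - r\<^sup>2 * F2 x (x \<cdot>\<^sub>H s)\<bar> \<le> C * r ^ 4) \<and>
    (\<forall>s D H z. jet2 UNIV (\<lambda>z::heis \<times> real. F (fst z) (fst z \<cdot>\<^sub>H s)) D H \<longrightarrow>
       H z (hvec e (fst z), 0) (hvec e (fst z), 0) = F2 (fst z) (fst z \<cdot>\<^sub>H s))"
proof -
  define good where "good F F' \<longleftrightarrow> poly_gauss F' \<and>
    (\<forall>s x E. ((\<lambda>x. F x (x \<cdot>\<^sub>H s)) has_derivative E) (at x) \<longrightarrow> E (hvec e x) = F' x (x \<cdot>\<^sub>H s))" for F F'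
  \<comment> \<open>A choice function makes differentiation along the field an operation on the
    class that can be iterated four times.\<close>
  define dir where "dir F = (SOME F'. good F F')" for F
  have "good F (dir F)" if F: "poly_gauss F" for F
  proof -
    have "\<exists>F'. good F F'" using poly_gauss_direction[OF F, of e] unfolding good_def .
    then show ?thesis unfolding dir_def by (rule someI_ex)
  qed
  then have dir: "poly_gauss F \<Longrightarrow> poly_gauss (dir F)"
      "poly_gauss F \<Longrightarrow> ((\<lambda>x. F x (x \<cdot>\<^sub>H s)) has_derivative E) (at x) \<Longrightarrow> E (hvec e x) = dir F x (x \<cdot>\<^sub>H s)" for F s E x
    unfolding good_def by blast+
  have path: "((\<lambda>r. shift P e s x r) has_real_derivative
     shift (dir P) e s x r) (at r)" if P: "poly_gauss P" for P x s r
  proof -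
    let ?y = "x + r *\<^sub>R hvec e x"
    obtain E where E: "((\<lambda>x. P x (x \<cdot>\<^sub>H s)) has_derivative E) (at ?y)"
      using poly_gauss_derivative[OF P] by blast
    interpret E: bounded_linear E by (rule has_derivative_bounded_linear[OF E])
    have "((\<lambda>r. x + r *\<^sub>R hvec e x) has_derivative (\<lambda>h. h *\<^sub>R hvec e x)) (at r)"
      by (auto intro!: derivative_eq_intros)
    from has_derivative_compose[OF this E]
    have "((\<lambda>r. shift P e s x r) has_derivative (\<lambda>h. h * E (hvec e x))) (at r)"
      by (simp add: E.scaleR)
    moreover have "E (hvec e x) = dir P ?y (?y \<cdot>\<^sub>H s)"
    proof -
      \<comment> \<open>The field is constant along the straight line with direction
        \<open>hvec e x\<close>, so this line is its integral curve and repeated differentiation in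
        \<open>r\<close> iterates \<open>dir\<close>.\<close>
      have "hvec e x = hvec e ?y" by (simp add: vec_eq_iff forall_3 algebra_simps)
      then show ?thesis using dir(2)[OF P E] by simp
    qed
    ultimately show ?thesis
      unfolding has_field_derivative_def by (metis (no_types, lifting) ext mult.commute)
  qed
  have pgm: "poly_gauss ((dir ^^ m) F)" for m
    by (induction m) (auto simp: F dir)
  \<comment> \<open>A bound for the points \<open>x + t *\<^sub>R hvec e x\<close> with
    \<open>\<bar>t\<bar> \<le> 2\<close>, where the fourth derivative is evaluated.\<close>
  define R' where "R' = R + 2 * ((1 + R) * (\<bar>e$1\<bar> + \<bar>e$2\<bar>))"
  obtain C where C: "\<And>x y. norm x \<le> R' \<Longrightarrow> \<bar>(dir ^^ 4) F x y\<bar> \<le> C"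
    using poly_gauss_bounded[OF pgm] by blast
  have taylor: "\<bar>shift F e s x r -
      (F x (x \<cdot>\<^sub>H s) + dir F x (x \<cdot>\<^sub>H s) * r + dir (dir F) x (x \<cdot>\<^sub>H s) * r\<^sup>2 / 2 + dir (dir (dir F)) x (x \<cdot>\<^sub>H s) * r ^ 3 / 6)\<bar>
      \<le> C * r ^ 4 / 24" if x: "norm x \<le> R" and r: "\<bar>r\<bar> \<le> 2" for x r s
  proof -
    define df where "df m = shift ((dir ^^ m) F) e s x" for m
    have "\<forall>m t. DERIV (df m) t :> df (Suc m) t"
      unfolding df_def using path[OF pgm] by simp
    then obtain t where t: "\<bar>t\<bar> \<le> \<bar>r\<bar>" "df 0 r = (\<Sum>m<4. df m 0 / fact m * r ^ m) + df 4 t / fact 4 * r ^ 4"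
      using Maclaurin_all_le[of df "df 0" r 4] by auto
    have "norm (x + t *\<^sub>R hvec e x) \<le> norm x + \<bar>t\<bar> * norm (hvec e x)"
      by (metis norm_scaleR norm_triangle_ineq)
    also have "\<dots> \<le> R + 2 * ((1 + R) * (\<bar>e$1\<bar> + \<bar>e$2\<bar>))"
      using x t(1) r norm_hvec_le[OF x, of e] by (intro add_mono mult_mono) auto
    finally have "\<bar>df 4 t\<bar> \<le> C" using C by (simp add: df_def R'_def)
    then have "\<bar>df 4 t / 24 * r ^ 4\<bar> \<le> C / 24 * r ^ 4"
      unfolding abs_mult by (intro mult_mono) auto
    moreover have "df 0 r = (df 0 0 + df 1 0 * r + df 2 0 * r\<^sup>2 / 2 + df 3 0 * r ^ 3 / 6) + df 4 t / 24 * r ^ 4"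
      unfolding t(2) by (simp add: numeral_eq_Suc)
    ultimately show ?thesis
      by (simp add: df_def numeral_eq_Suc)
  qed
  show ?thesis
  proof (intro exI[of _ "dir (dir F)"] exI[of _ "C / 12"] conjI allI impI)
    show "poly_gauss (dir (dir F))" by (intro dir F)
  next
    fix s x :: heis and r :: real assume x: "norm x \<le> R" and r: "\<bar>r\<bar> \<le> 2"
    show "\<bar>shift F e s x r + shift F e s x (- r)
          - 2 * F x (x \<cdot>\<^sub>H s) - r\<^sup>2 * dir (dir F) x (x \<cdot>\<^sub>H s)\<bar> \<le> C / 12 * r ^ 4"
    proof -
      have "\<bar>p + q - 2 * f - w\<bar> \<le> 2 * c" if "\<bar>p - (f + l + w / 2 + m)\<bar> \<le> c" "\<bar>q - (f - l + w / 2 - m)\<bar> \<le> c"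
        for p q f l m w c :: real using that unfolding abs_le_iff add_divide_distrib by (elim conjE) (intro conjI; linarith)
      note comb = this
      have T1: "\<bar>shift F e s x r -
        (F x (x \<cdot>\<^sub>H s) + dir F x (x \<cdot>\<^sub>H s) * r + r\<^sup>2 * dir (dir F) x (x \<cdot>\<^sub>H s) / 2 + dir (dir (dir F)) x (x \<cdot>\<^sub>H s) * r ^ 3 / 6)\<bar>
        \<le> C * r ^ 4 / 24" using taylor[OF x r, of s] by (simp add: mult.commute)
      have T2: "\<bar>shift F e s x (- r) -
        (F x (x \<cdot>\<^sub>H s) - dir F x (x \<cdot>\<^sub>H s) * r + r\<^sup>2 * dir (dir F) x (x \<cdot>\<^sub>H s) / 2 - dir (dir (dir F)) x (x \<cdot>\<^sub>H s) * r ^ 3 / 6)\<bar>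
        \<le> C * r ^ 4 / 24" using taylor[OF x, of "- r" s] r by (simp add: mult.commute)
      show ?thesis using comb[OF T1 T2] by simp
    qed
  next
    fix s D H and z :: "heis \<times> real"
    assume j: "jet2 UNIV (\<lambda>z::heis \<times> real. F (fst z) (fst z \<cdot>\<^sub>H s)) D H"
    have lift: "((\<lambda>x. f (x, snd z)) has_derivative (\<lambda>h. E (h, 0))) (at (fst z))"
      if "(f has_derivative E) (at z)" for f :: "heis \<times> real \<Rightarrow> real" and E z
    proof -
      have "((\<lambda>x. (x, snd z)) has_derivative (\<lambda>h. (h, 0))) (at (fst z))"
        by (intro has_derivative_Pair has_derivative_ident has_derivative_const)
      from has_derivative_compose[OF this, of f E] that show ?thesis by simp
    qed
    have D1: "D z (hvec e (fst z), 0) = dir F (fst z) (fst z \<cdot>\<^sub>H s)" for z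
    proof (rule dir(2)[OF F])
      have "((\<lambda>z::heis \<times> real. F (fst z) (fst z \<cdot>\<^sub>H s)) has_derivative D z) (at z)"
        using j unfolding jet2_def by blast
      from lift[OF this] show "((\<lambda>x. F x (x \<cdot>\<^sub>H s)) has_derivative (\<lambda>h. D z (h, 0))) (at (fst z))"
        by simp
    qed
    have "((\<lambda>y::heis \<times> real. dir F (fst y) (fst y \<cdot>\<^sub>H s)) has_derivative
       (\<lambda>h. H z (hvec e (fst z), 0) h + (fst h $ 1 * e$2 - fst h $ 2 * e$1) / 2 * D z (axis 3 1, 0))) (at z)"
      using jet2_hvec_derivative[OF j, of z e] by (simp add: D1)
    from dir(2)[OF dir(1)[OF F] lift[OF this, simplified]]
    show "H z (hvec e (fst z), 0) (hvec e (fst z), 0) = dir (dir F) (fst z) (fst z \<cdot>\<^sub>H s)"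
      by simp
  qed
qed

context horizontal_pair
begin

text \<open>One step of the symmetric random walk \<open>x \<mapsto> x \<cdot>\<^sub>H (\<plusminus>2\<surd>k a)\<close>, \<open>x \<cdot>\<^sub>H (\<plusminus>2\<surd>k b)\<close>; the
  generator is \<open>Y\<^sub>a\<^sup>2 + Y\<^sub>b\<^sup>2\<close> up to \<open>O(k\<^sup>2)\<close>.\<close>

definition walk :: "real \<Rightarrow> (heis \<Rightarrow> real) \<Rightarrow> heis \<Rightarrow> real" where
  "walk k g x = (g (x \<cdot>\<^sub>H hpt ((2 * sqrt k) *\<^sub>R a)) + g (x \<cdot>\<^sub>H hpt ((- 2 * sqrt k) *\<^sub>R a)) +
     g (x \<cdot>\<^sub>H hpt ((2 * sqrt k) *\<^sub>R b)) + g (x \<cdot>\<^sub>H hpt ((- 2 * sqrt k) *\<^sub>R b))) / 4"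

text \<open>The generator stays in the class, so the lemma can be applied again to
  \<open>FL\<close>; the error constant is uniform in the right translation
  \<open>s\<close>.\<close>

lemma poly_gauss_heat:
  assumes F: "poly_gauss F"
  shows "\<exists>FL C. poly_gauss FL \<and>
    (\<forall>s. \<exists>E. cjet UNIV (\<lambda>z. F (fst z) (fst z \<cdot>\<^sub>H s)) (\<lambda>_. 0) E (\<lambda>z. FL (fst z) (fst z \<cdot>\<^sub>H s))) \<and>
    (\<forall>s x k. norm x \<le> R \<longrightarrow> 0 \<le> k \<longrightarrow> k \<le> 1 \<longrightarrow>
       \<bar>walk k (\<lambda>x. F x (x \<cdot>\<^sub>H s)) x - F x (x \<cdot>\<^sub>H s) - k * FL x (x \<cdot>\<^sub>H s)\<bar> \<le> C * k\<^sup>2)"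
proof -
  obtain Fa Ca where a: "poly_gauss Fa"
    "\<And>s x r. norm x \<le> R \<Longrightarrow> \<bar>r\<bar> \<le> 2 \<Longrightarrow>
       \<bar>shift F a s x r + shift F a s x (- r)
          - 2 * F x (x \<cdot>\<^sub>H s) - r\<^sup>2 * Fa x (x \<cdot>\<^sub>H s)\<bar> \<le> Ca * r ^ 4"
    "\<And>s D H z. jet2 UNIV (\<lambda>z::heis \<times> real. F (fst z) (fst z \<cdot>\<^sub>H s)) D H \<Longrightarrow>
       H z (hvec a (fst z), 0) (hvec a (fst z), 0) = Fa (fst z) (fst z \<cdot>\<^sub>H s)"
    using poly_gauss_taylor[OF F, of R a] by blast
  obtain Fb Cb where b: "poly_gauss Fb"
    "\<And>s x r. norm x \<le> R \<Longrightarrow> \<bar>r\<bar> \<le> 2 \<Longrightarrow>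
       \<bar>shift F b s x r + shift F b s x (- r)
          - 2 * F x (x \<cdot>\<^sub>H s) - r\<^sup>2 * Fb x (x \<cdot>\<^sub>H s)\<bar> \<le> Cb * r ^ 4"
    "\<And>s D H z. jet2 UNIV (\<lambda>z::heis \<times> real. F (fst z) (fst z \<cdot>\<^sub>H s)) D H \<Longrightarrow>
       H z (hvec b (fst z), 0) (hvec b (fst z), 0) = Fb (fst z) (fst z \<cdot>\<^sub>H s)"
    using poly_gauss_taylor[OF F, of R b] by blast
  show ?thesis
  proof (intro exI[of _ "\<lambda>x y. Fa x y + Fb x y"] exI[of _ "4 * (Ca + Cb)"] conjI allI impI)
    show "poly_gauss (\<lambda>x y. Fa x y + Fb x y)" by (intro poly_gauss.add a b)
  next
    fix s
    obtain D H where j: "jet2 UNIV (\<lambda>z::heis \<times> real. F (fst z) (fst z \<cdot>\<^sub>H s)) D H" "\<forall>z. D z (0, 1) = 0"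
      using poly_gauss_jet2[OF F] by blast
    have "cjet UNIV (\<lambda>z. F (fst z) (fst z \<cdot>\<^sub>H s)) (\<lambda>_. 0)
       (\<lambda>z. vector [D z (hvec (axis 1 1) (fst z), 0), D z (hvec (axis 2 1) (fst z), 0)])
       (\<lambda>z. Fa (fst z) (fst z \<cdot>\<^sub>H s) + Fb (fst z) (fst z \<cdot>\<^sub>H s))"
    proof (rule cjetI[OF j(1)])
      fix z :: "heis \<times> real" and e :: "real ^ 2"
      show "0 = D z (0, 1)" using j(2) by (simp del: split_paired_All)
      show "Fa (fst z) (fst z \<cdot>\<^sub>H s) + Fb (fst z) (fst z \<cdot>\<^sub>H s) = lap H z"
        using a(3)[OF j(1)] b(3)[OF j(1)] by (simp add: lap_def)
      have "(hvec e (fst z), 0::real) = e$1 *\<^sub>R (hvec (axis 1 1) (fst z), 0) + e$2 *\<^sub>R (hvec (axis 2 1) (fst z), 0)"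
        by (simp add: vec_eq_iff forall_3 axis_def field_simps)
      then have "D z (hvec e (fst z), 0) = e$1 * D z (hvec (axis 1 1) (fst z), 0) + e$2 * D z (hvec (axis 2 1) (fst z), 0)"
        using jet2_linear1[OF j(1), of z] by (simp add: linear_add linear_scale del: scaleR_Pair)
      then show "vector [D z (hvec (axis 1 1) (fst z), 0), D z (hvec (axis 2 1) (fst z), 0)] \<bullet> e =
           D z (hvec e (fst z), 0)"
        by (simp add: inner_vec_def sum_2 mult.commute)
    qed
    then show "\<exists>E. cjet UNIV (\<lambda>z. F (fst z) (fst z \<cdot>\<^sub>H s)) (\<lambda>_. 0) E (\<lambda>z. Fa (fst z) (fst z \<cdot>\<^sub>H s) + Fb (fst z) (fst z \<cdot>\<^sub>H s))"
      by blast
  next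
    fix s x :: heis and k :: real
    assume x: "norm x \<le> R" and k: "0 \<le> k" "k \<le> 1"
    \<comment> \<open>Four points with weight 1/4 at parameter \<open>r\<close> reproduce the
      generator with coefficient \<open>r\<^sup>2 / 4\<close>, which has to be \<open>k\<close>; the
      error is a multiple of \<open>r ^ 4 = 16 * k\<^sup>2\<close>.\<close>
    define r where "r = 2 * sqrt k"
    have r: "\<bar>r\<bar> \<le> 2" "r\<^sup>2 = 4 * k" "r ^ 4 = 16 * k\<^sup>2"
    proof -
      show "\<bar>r\<bar> \<le> 2" using k by (simp add: r_def)
      show r2: "r\<^sup>2 = 4 * k" using k by (simp add: r_def power_mult_distrib)
      have "r ^ 4 = (r\<^sup>2)\<^sup>2" by simp
      then show "r ^ 4 = 16 * k\<^sup>2" unfolding r2 by (simp add: power_mult_distrib)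
    qed
    have w: "walk k (\<lambda>x. F x (x \<cdot>\<^sub>H s)) x =
      (shift F a s x r + shift F a s x (- r) +
       shift F b s x r + shift F b s x (- r)) / 4"
      unfolding walk_def heis_mult_hpt r_def by simp
    show "\<bar>walk k (\<lambda>x. F x (x \<cdot>\<^sub>H s)) x - F x (x \<cdot>\<^sub>H s) - k * (Fa x (x \<cdot>\<^sub>H s) + Fb x (x \<cdot>\<^sub>H s))\<bar>
       \<le> 4 * (Ca + Cb) * k\<^sup>2"
    proof -
      have "\<bar>(p + q + p' + q') / 4 - f - (w + w') / 4\<bar> \<le> (c + c') / 4"
        if "\<bar>p + q - 2 * f - w\<bar> \<le> c" "\<bar>p' + q' - 2 * f - w'\<bar> \<le> c'"
        for p q p' q' f w w' c c' :: real using that unfolding abs_le_iff add_divide_distrib by (elim conjE) (intro conjI; linarith)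
      from this[OF a(2)[OF x r(1), of s] b(2)[OF x r(1), of s]] show ?thesis
        unfolding w r(2,3) by (simp add: algebra_simps add_divide_distrib)
    qed
  qed
qed

text \<open>\<open>G1\<close> and \<open>G2\<close> are the operator applied once and twice to
  \<open>g\<close>, so four derivatives are involved. All requirements are convex in
  \<open>g\<close>: averaging keeps the constant \<open>C\<close>.\<close>

definition smooth4 :: "real \<Rightarrow> real \<Rightarrow> (heis \<Rightarrow> real) \<Rightarrow> bool" where
  "smooth4 C R g \<longleftrightarrow> (\<exists>G1 G2 E E'.
     cjet UNIV (\<lambda>z. g (fst z)) (\<lambda>_. 0) E (\<lambda>z. G1 (fst z)) \<and>
     cjet UNIV (\<lambda>z. G1 (fst z)) (\<lambda>_. 0) E' (\<lambda>z. G2 (fst z)) \<and>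
     (\<forall>x. norm x \<le> R \<longrightarrow> \<bar>G1 x\<bar> \<le> C \<and> \<bar>G2 x\<bar> \<le> C \<and>
        (\<forall>k. 0 \<le> k \<longrightarrow> k \<le> 1 \<longrightarrow> \<bar>walk k g x - g x - k * G1 x\<bar> \<le> C * k\<^sup>2)))"

lemma poly_gauss_smooth4:
  assumes "poly_gauss F"
  shows "\<exists>C. \<forall>s. smooth4 C R (\<lambda>x. F x (x \<cdot>\<^sub>H s))"
proof -
  obtain F1 C where F1: "poly_gauss F1"
    "\<And>s. \<exists>E. cjet UNIV (\<lambda>z. F (fst z) (fst z \<cdot>\<^sub>H s)) (\<lambda>_. 0) E (\<lambda>z. F1 (fst z) (fst z \<cdot>\<^sub>H s))"
    "\<And>s x k. norm x \<le> R \<Longrightarrow> 0 \<le> k \<Longrightarrow> k \<le> 1 \<Longrightarrow>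
       \<bar>walk k (\<lambda>x. F x (x \<cdot>\<^sub>H s)) x - F x (x \<cdot>\<^sub>H s) - k * F1 x (x \<cdot>\<^sub>H s)\<bar> \<le> C * k\<^sup>2"
    using poly_gauss_heat[OF assms, of R] by blast
  obtain F2 C' where F2: "poly_gauss F2"
    "\<And>s. \<exists>E. cjet UNIV (\<lambda>z. F1 (fst z) (fst z \<cdot>\<^sub>H s)) (\<lambda>_. 0) E (\<lambda>z. F2 (fst z) (fst z \<cdot>\<^sub>H s))"
    using poly_gauss_heat[OF F1(1), of R] by blast
  obtain C1 where C1: "\<And>x y. norm x \<le> R \<Longrightarrow> \<bar>F1 x y\<bar> \<le> C1" using poly_gauss_bounded[OF F1(1)] by blast
  obtain C2 where C2: "\<And>x y. norm x \<le> R \<Longrightarrow> \<bar>F2 x y\<bar> \<le> C2" using poly_gauss_bounded[OF F2(1)] by blast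
  define M where "M = max C (max C1 C2)"
  have M: "C \<le> M" "C1 \<le> M" "C2 \<le> M" by (auto simp: M_def)
  have "smooth4 M R (\<lambda>x. F x (x \<cdot>\<^sub>H s))" for s
  proof -
    obtain E E' where E: "cjet UNIV (\<lambda>z. F (fst z) (fst z \<cdot>\<^sub>H s)) (\<lambda>_. 0) E (\<lambda>z. F1 (fst z) (fst z \<cdot>\<^sub>H s))"
      "cjet UNIV (\<lambda>z. F1 (fst z) (fst z \<cdot>\<^sub>H s)) (\<lambda>_. 0) E' (\<lambda>z. F2 (fst z) (fst z \<cdot>\<^sub>H s))"
      using F1(2)[of s] F2(2)[of s] by blast
    show ?thesis
      unfolding smooth4_def
    proof (intro exI conjI allI impI)
      show "cjet UNIV (\<lambda>z. F (fst z) (fst z \<cdot>\<^sub>H s)) (\<lambda>_. 0) E (\<lambda>z. (\<lambda>x. F1 x (x \<cdot>\<^sub>H s)) (fst z))"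
        using E(1) by simp
      show "cjet UNIV (\<lambda>z. (\<lambda>x. F1 x (x \<cdot>\<^sub>H s)) (fst z)) (\<lambda>_. 0) E' (\<lambda>z. (\<lambda>x. F2 x (x \<cdot>\<^sub>H s)) (fst z))"
        using E(2) by simp
      fix x :: heis assume x: "norm x \<le> R"
      show "\<bar>F1 x (x \<cdot>\<^sub>H s)\<bar> \<le> M" using C1[OF x] M by (meson order_trans)
      show "\<bar>F2 x (x \<cdot>\<^sub>H s)\<bar> \<le> M" using C2[OF x] M by (meson order_trans)
      fix k :: real assume k: "0 \<le> k" "k \<le> 1"
      show "\<bar>walk k (\<lambda>x. F x (x \<cdot>\<^sub>H s)) x - F x (x \<cdot>\<^sub>H s) - k * F1 x (x \<cdot>\<^sub>H s)\<bar> \<le> M * k\<^sup>2"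
        using F1(3)[OF x k, of s] mult_right_mono[OF M(1), of "k\<^sup>2"] by simp
    qed
  qed
  then show ?thesis by blast
qed

lemma cjet_scale:
  assumes "cjet U \<phi> T G L"
  shows "cjet U (\<lambda>z. c * \<phi> z) (\<lambda>z. c * T z) (\<lambda>z. c *\<^sub>R G z) (\<lambda>z. c * L z)"
  by (rule cjet_cong[OF cjet_mult[OF cjet_const[OF cjet_open[OF assms]] assms]]) (auto simp: gam_def)

lemma smooth4_average:
  assumes "smooth4 C R g" "smooth4 C R h"
  shows "smooth4 C R (\<lambda>x. (g x + h x) / 2)"
proof -
  obtain G1 G2 E E' where g: "cjet UNIV (\<lambda>z. g (fst z)) (\<lambda>_. 0) E (\<lambda>z. G1 (fst z))"
     "cjet UNIV (\<lambda>z. G1 (fst z)) (\<lambda>_. 0) E' (\<lambda>z. G2 (fst z))"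
     "\<And>x. norm x \<le> R \<Longrightarrow> \<bar>G1 x\<bar> \<le> C" "\<And>x. norm x \<le> R \<Longrightarrow> \<bar>G2 x\<bar> \<le> C"
     "\<And>x k. norm x \<le> R \<Longrightarrow> 0 \<le> k \<Longrightarrow> k \<le> 1 \<Longrightarrow> \<bar>walk k g x - g x - k * G1 x\<bar> \<le> C * k\<^sup>2"
    using assms(1) unfolding smooth4_def by blast
  obtain H1 H2 I I' where h: "cjet UNIV (\<lambda>z. h (fst z)) (\<lambda>_. 0) I (\<lambda>z. H1 (fst z))"
     "cjet UNIV (\<lambda>z. H1 (fst z)) (\<lambda>_. 0) I' (\<lambda>z. H2 (fst z))"
     "\<And>x. norm x \<le> R \<Longrightarrow> \<bar>H1 x\<bar> \<le> C" "\<And>x. norm x \<le> R \<Longrightarrow> \<bar>H2 x\<bar> \<le> C"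
     "\<And>x k. norm x \<le> R \<Longrightarrow> 0 \<le> k \<Longrightarrow> k \<le> 1 \<Longrightarrow> \<bar>walk k h x - h x - k * H1 x\<bar> \<le> C * k\<^sup>2"
    using assms(2) unfolding smooth4_def by blast
  show ?thesis
    unfolding smooth4_def
  proof (intro exI conjI allI impI)
    show "cjet UNIV (\<lambda>z. (g (fst z) + h (fst z)) / 2) (\<lambda>_. 0) (\<lambda>z. (1/2) *\<^sub>R (E z + I z)) (\<lambda>z. (\<lambda>x. (G1 x + H1 x) / 2) (fst z))"
      using cjet_scale[OF cjet_add[OF g(1) h(1)], of "1/2"] by simp
    show "cjet UNIV (\<lambda>z. (\<lambda>x. (G1 x + H1 x) / 2) (fst z)) (\<lambda>_. 0) (\<lambda>z. (1/2) *\<^sub>R (E' z + I' z)) (\<lambda>z. (\<lambda>x. (G2 x + H2 x) / 2) (fst z))"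
      using cjet_scale[OF cjet_add[OF g(2) h(2)], of "1/2"] by simp
    fix x :: heis assume x: "norm x \<le> R"
    show "\<bar>(G1 x + H1 x) / 2\<bar> \<le> C"
      using g(3)[OF x] h(3)[OF x] unfolding abs_le_iff add_divide_distrib by (elim conjE) (intro conjI; linarith)
    show "\<bar>(G2 x + H2 x) / 2\<bar> \<le> C"
      using g(4)[OF x] h(4)[OF x] unfolding abs_le_iff add_divide_distrib by (elim conjE) (intro conjI; linarith)
    fix k :: real assume k: "0 \<le> k" "k \<le> 1"
    have "walk k (\<lambda>x. (g x + h x) / 2) x = (walk k g x + walk k h x) / 2"
      by (simp add: walk_def add_divide_distrib)
    moreover have "k * ((G1 x + H1 x) / 2) = (k * G1 x + k * H1 x) / 2" by (simp add: algebra_simps)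
    ultimately show "\<bar>walk k (\<lambda>x. (g x + h x) / 2) x - (g x + h x) / 2 - k * ((G1 x + H1 x) / 2)\<bar> \<le> C * k\<^sup>2"
      using g(5)[OF x k] h(5)[OF x k] unfolding abs_le_iff add_divide_distrib by (elim conjE) (intro conjI; linarith)
  qed
qed

lemma walk_average:
  "walk k g x = ((g (x \<cdot>\<^sub>H hpt ((2 * sqrt k) *\<^sub>R a)) + g (x \<cdot>\<^sub>H hpt ((- 2 * sqrt k) *\<^sub>R a))) / 2 +
     (g (x \<cdot>\<^sub>H hpt ((2 * sqrt k) *\<^sub>R b)) + g (x \<cdot>\<^sub>H hpt ((- 2 * sqrt k) *\<^sub>R b))) / 2) / 2"
  by (simp add: walk_def add_divide_distrib)

text \<open>All right translates share one \<open>C\<close>. This is the form of the derivative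
  bound that survives arbitrarily many steps of the walk.\<close>

definition stable :: "real \<Rightarrow> real \<Rightarrow> real \<Rightarrow> (heis \<Rightarrow> real) \<Rightarrow> bool" where
  "stable M C R g \<longleftrightarrow> (\<forall>x. \<bar>g x\<bar> \<le> M) \<and> (\<forall>s. smooth4 C R (\<lambda>x. g (x \<cdot>\<^sub>H s)))"

text \<open>A step of the walk averages right translates; by associativity each of them is again a
  translate of the kind quantified over in \<open>stable\<close>, so neither constant
  deteriorates.\<close>

lemma stable_walk:
  assumes "stable M C R g"
  shows "stable M C R (walk k g)"
  unfolding stable_def
proof (intro conjI allI)
  fix x
  have M: "\<bar>g y\<bar> \<le> M" for y using assms by (simp add: stable_def)
  have "\<bar>(p + q + r + s) / 4\<bar> \<le> M" if "\<bar>p\<bar> \<le> M" "\<bar>q\<bar> \<le> M" "\<bar>r\<bar> \<le> M" "\<bar>s\<bar> \<le> M" for p q r s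
    using that unfolding abs_le_iff add_divide_distrib by (elim conjE) (intro conjI; linarith)
  from this[OF M M M M] show "\<bar>walk k g x\<bar> \<le> M" unfolding walk_def .
  have "smooth4 C R (\<lambda>x. g (x \<cdot>\<^sub>H s))" for s using assms by (simp add: stable_def)
  then show "smooth4 C R (\<lambda>x. walk k g (x \<cdot>\<^sub>H s))" for s
    unfolding walk_average heis_mult_assoc by (intro smooth4_average)
qed

lemma stable_smooth4:
  assumes "stable M C R g"
  shows "smooth4 C R g"
proof -
  have "smooth4 C R (\<lambda>x. g (x \<cdot>\<^sub>H 0))" using assms by (simp add: stable_def)
  moreover have "x \<cdot>\<^sub>H 0 = x" for x by (simp add: vec_eq_iff forall_3)
  ultimately show ?thesis by simp
qed

end

section \<open>Approximation of continuous data within the class\<close>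

lemma real_polynomial_poly_gauss:
  fixes P :: "heis \<times> real \<Rightarrow> real"
  assumes "real_polynomial_function P"
  shows "poly_gauss (\<lambda>x y. P (exp (- (y \<bullet> y)) *\<^sub>R y, exp (- (y \<bullet> y))))"
  using assms
proof induction
  case (linear f)
  interpret f: bounded_linear f by fact
  have e: "f (exp (- (y \<bullet> y)) *\<^sub>R y, exp (- (y \<bullet> y))) =
     f (axis 1 1, 0) * (y$1 ^ 1 * y$2 ^ 0 * y$3 ^ 0 * exp (- (y \<bullet> y))) +
     f (axis 2 1, 0) * (y$1 ^ 0 * y$2 ^ 1 * y$3 ^ 0 * exp (- (y \<bullet> y))) +
     f (axis 3 1, 0) * (y$1 ^ 0 * y$2 ^ 0 * y$3 ^ 1 * exp (- (y \<bullet> y))) +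
     f (0, 1) * (y$1 ^ 0 * y$2 ^ 0 * y$3 ^ 0 * exp (- (y \<bullet> y)))" for y
  proof -
    have "(exp (- (y \<bullet> y)) *\<^sub>R y, exp (- (y \<bullet> y))) =
       (y$1 * exp (- (y \<bullet> y))) *\<^sub>R (axis 1 1, 0) + (y$2 * exp (- (y \<bullet> y))) *\<^sub>R (axis 2 1, 0) +
       (y$3 * exp (- (y \<bullet> y))) *\<^sub>R (axis 3 1, 0) + exp (- (y \<bullet> y)) *\<^sub>R (0, 1::real)"
      by (simp add: vec_eq_iff forall_3) (simp add: axis_def)
    then have "f (exp (- (y \<bullet> y)) *\<^sub>R y, exp (- (y \<bullet> y))) =
       (y$1 * exp (- (y \<bullet> y))) * f (axis 1 1, 0) + (y$2 * exp (- (y \<bullet> y))) * f (axis 2 1, 0) +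
       (y$3 * exp (- (y \<bullet> y))) * f (axis 3 1, 0) + exp (- (y \<bullet> y)) * f (0, 1::real)"
      by (simp only: f.add f.scaleR real_scaleR_def)
    then show ?thesis by simp
  qed
  show ?case unfolding e by (intro poly_gauss.intros)
qed (auto intro: poly_gauss.intros)

text \<open>The injective map \<open>\<Psi>\<close> sends the whole space into a ball, and
  polynomials in its coordinates lie in the class. The data are moved to the image of
  \<open>K\<close>, extended by Tietze and approximated by a polynomial on the ball. The bound has
  to be global because the walk leaves \<open>K\<close>.\<close>

lemma poly_gauss_approximation:
  fixes u :: "heis \<Rightarrow> real"
  assumes K: "compact K" and u: "continuous_on K u" and M: "0 \<le> M" "\<And>x. x \<in> K \<Longrightarrow> \<bar>u x\<bar> \<le> M" and \<delta>: "0 < \<delta>"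
  shows "\<exists>g. poly_gauss (\<lambda>x y. g y) \<and> (\<forall>y. \<bar>g y\<bar> \<le> M + \<delta>) \<and> (\<forall>y\<in>K. \<bar>g y - u y\<bar> \<le> \<delta>)"
proof -
  define \<Psi> where "\<Psi> y = (exp (- (y \<bullet> y)) *\<^sub>R y, exp (- (y \<bullet> y)))" for y :: heis
  define inv where "inv w = (1 / snd w) *\<^sub>R fst w" for w :: "heis \<times> real"
  have inv: "inv (\<Psi> y) = y" for y by (simp add: inv_def \<Psi>_def)
  have c\<Psi>: "continuous_on S \<Psi>" for S unfolding \<Psi>_def by (intro continuous_intros)
  have ci: "continuous_on (\<Psi> ` K) (\<lambda>w. u (inv w))"
  proof (rule continuous_on_compose2[OF u])
    show "continuous_on (\<Psi> ` K) inv" unfolding inv_def by (intro continuous_intros) (auto simp: \<Psi>_def)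
    show "inv ` \<Psi> ` K \<subseteq> K" by (auto simp: inv)
  qed
  have cl: "closed (\<Psi> ` K)" by (intro compact_imp_closed compact_continuous_image c\<Psi> K)
  obtain f where f: "continuous_on UNIV f" "\<And>w. w \<in> \<Psi> ` K \<Longrightarrow> f w = u (inv w)" "\<And>w. \<bar>f w\<bar> \<le> M"
  proof (rule Tietze[OF ci, of UNIV M])
    show "norm (u (inv w)) \<le> M" if "w \<in> \<Psi> ` K" for w using that M(2) by (auto simp: inv)
    fix g :: "heis \<times> real \<Rightarrow> real"
    assume "continuous_on UNIV g" "\<And>w. w \<in> \<Psi> ` K \<Longrightarrow> g w = u (inv w)" "\<And>w. w \<in> UNIV \<Longrightarrow> norm (g w) \<le> M"
    then show thesis by (intro that[of g]) auto
  qed (use M(1) cl in auto)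
  \<comment> \<open>\<open>C\<close> bounds \<open>t * exp (- t\<^sup>2)\<close>, hence the first
    component of \<open>\<Psi>\<close>; the second is at most 1, which gives the radius
    \<open>C + 1\<close>.\<close>
  obtain C where C: "\<And>t::real. \<bar>t ^ 1 * exp (- t\<^sup>2)\<bar> \<le> C" using power_exp_neg_square_bounded by blast
  have S: "\<Psi> y \<in> cball 0 (C + 1)" for y
  proof -
    have "norm (\<Psi> y) \<le> norm (exp (- (y \<bullet> y)) *\<^sub>R y) + norm (exp (- (y \<bullet> y)))"
      unfolding \<Psi>_def by (rule norm_Pair_le)
    also have "norm (exp (- (y \<bullet> y)) *\<^sub>R y) \<le> C"
      using C[of "norm y"] by (simp add: abs_mult mult.commute power2_norm_eq_inner)
    finally show ?thesis by (simp add: order_trans add_left_mono)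
  qed
  obtain P where P: "real_polynomial_function P" "\<And>w. w \<in> cball 0 (C + 1) \<Longrightarrow> \<bar>f w - P w\<bar> < \<delta>"
    using Stone_Weierstrass_real_polynomial_function[OF compact_cball continuous_on_subset[OF f(1)] \<delta>] by blast
  show ?thesis
  proof (intro exI[of _ "\<lambda>y. P (\<Psi> y)"] conjI allI ballI)
    show "poly_gauss (\<lambda>x y. P (\<Psi> y))"
      unfolding \<Psi>_def by (rule real_polynomial_poly_gauss[OF P(1)])
    fix y
    show "\<bar>P (\<Psi> y)\<bar> \<le> M + \<delta>" using P(2)[OF S[of y]] f(3)[of "\<Psi> y"] by linarith
    assume "y \<in> K"
    then have "f (\<Psi> y) = u y" using f(2) inv by auto
    then show "\<bar>P (\<Psi> y) - u y\<bar> \<le> \<delta>" using P(2)[OF S[of y]] by linarith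
  qed
qed

section \<open>Lateral barrier and one time step\<close>

context horizontal_pair
begin

lemma gam_bilinear:
  "gam (v + v') w = gam v w + gam v' w" "gam v (w + w') = gam v w + gam v w'"
  "gam (r *\<^sub>R v) w = r * gam v w" "gam v (r *\<^sub>R w) = r * gam v w"
  "gam 0 w = 0" "gam v 0 = 0"
  by (simp_all add: gam_def inner_add_left algebra_simps)

lemma cjet_time: "open U \<Longrightarrow> cjet U (\<lambda>z. c * (snd z - s) + d) (\<lambda>_. c) (\<lambda>_. 0) (\<lambda>_. 0)"
  using cjet_add[OF cjet_scale[OF cjet_add[OF cjet_snd cjet_const[of _ "-s"]]] cjet_const[of _ d], of U c]
  by simp

lemma cjet_square:
  assumes "cjet U \<phi> T G L"
  shows "cjet U (\<lambda>z. (\<phi> z)\<^sup>2) (\<lambda>z. 2 * \<phi> z * T z) (\<lambda>z. (2 * \<phi> z) *\<^sub>R G z) (\<lambda>z. 2 * \<phi> z * L z + 2 * gam (G z) (G z))"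
  unfolding power2_eq_square
  by (rule cjet_cong[OF cjet_mult[OF assms assms]]) (auto simp flip: scaleR_add_left)

text \<open>The operator annihilates the coordinates, so on the squared distance it gives twice the
  sum of their \<open>gam\<close> terms. Cauchy-Schwarz bounds \<open>gam (G z) (G z)\<close> by the
  same sum times the squared distance, and compactness of the ball bounds the sum.\<close>

lemma cjet_dist_square:
  fixes p :: heis
  shows "\<exists>\<Lambda>>0. \<exists>G L. cjet UNIV (\<lambda>z. (dist p (fst z))\<^sup>2) (\<lambda>_. 0) G L \<and>
     (\<forall>z. dist p (fst z) \<le> r \<longrightarrow> L z \<le> \<Lambda> \<and> gam (G z) (G z) \<le> 2 * \<Lambda> * (dist p (fst z))\<^sup>2)"
proof -
  define g :: "3 \<Rightarrow> heis \<times> real \<Rightarrow> real ^ 2" where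
    "g i = (if i = 1 then (\<lambda>_. axis 1 1) else if i = 2 then (\<lambda>_. axis 2 1) else
       (\<lambda>z. vector [- (fst z $ 2) / 2, fst z $ 1 / 2]))" for i
  have nth: "cjet UNIV (\<lambda>z. fst z $ i - p $ i) (\<lambda>_. 0) (g i) (\<lambda>_. 0)" for i
    using cjet_add[OF cjet_nth(1)[OF open_UNIV] cjet_const[OF open_UNIV, of "- p$1"]]
       cjet_add[OF cjet_nth(2)[OF open_UNIV] cjet_const[OF open_UNIV, of "- p$2"]]
       cjet_add[OF cjet_nth(3)[OF open_UNIV] cjet_const[OF open_UNIV, of "- p$3"]]
       exhaust_3[of i] by (auto simp: g_def)
  define x where "x i z = fst z $ i - p $ i" for i and z :: "heis \<times> real"
  have d: "(dist p (fst z))\<^sup>2 = (x 1 z)\<^sup>2 + (x 2 z)\<^sup>2 + (x 3 z)\<^sup>2" for z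
    unfolding dist_norm power2_norm_eq_inner inner_vec_def
    by (simp add: sum_3 x_def power2_eq_square algebra_simps)
  define G where "G z = (2 * x 1 z) *\<^sub>R g 1 z + (2 * x 2 z) *\<^sub>R g 2 z + (2 * x 3 z) *\<^sub>R g 3 z" for z
  define L where "L z = 2 * gam (g 1 z) (g 1 z) + 2 * gam (g 2 z) (g 2 z) + 2 * gam (g 3 z) (g 3 z)" for z
  have cj: "cjet UNIV (\<lambda>z. (dist p (fst z))\<^sup>2) (\<lambda>_. 0) G L"
    unfolding d using cjet_add[OF cjet_add[OF cjet_square[OF nth[of 1]] cjet_square[OF nth[of 2]]] cjet_square[OF nth[of 3]]]
    by (simp add: x_def G_def[abs_def] L_def[abs_def])
  have cs: "gam (G z) (G z) \<le> 2 * L z * (dist p (fst z))\<^sup>2" for z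
  proof -
    have *: "(2 * x1 * c1 + 2 * x2 * c2 + 2 * x3 * c3)\<^sup>2 \<le> 4 * (x1\<^sup>2 + x2\<^sup>2 + x3\<^sup>2) * (c1\<^sup>2 + c2\<^sup>2 + c3\<^sup>2)" for x1 x2 x3 c1 c2 c3 :: real
    proof -
      have "4 * (x1\<^sup>2 + x2\<^sup>2 + x3\<^sup>2) * (c1\<^sup>2 + c2\<^sup>2 + c3\<^sup>2) - (2 * x1 * c1 + 2 * x2 * c2 + 2 * x3 * c3)\<^sup>2
         = 4 * ((x1 * c2 - x2 * c1)\<^sup>2 + (x1 * c3 - x3 * c1)\<^sup>2 + (x2 * c3 - x3 * c2)\<^sup>2)"
        by (simp add: power2_eq_square algebra_simps)
      also have "\<dots> \<ge> 0" by (intro mult_nonneg_nonneg add_nonneg_nonneg) auto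
      finally show ?thesis by simp
    qed
    have "gam (G z) (G z) = (2 * x 1 z * (g 1 z \<bullet> a) + 2 * x 2 z * (g 2 z \<bullet> a) + 2 * x 3 z * (g 3 z \<bullet> a))\<^sup>2 +
       (2 * x 1 z * (g 1 z \<bullet> b) + 2 * x 2 z * (g 2 z \<bullet> b) + 2 * x 3 z * (g 3 z \<bullet> b))\<^sup>2"
      by (simp add: gam_def G_def inner_add_left power2_eq_square)
    also have "\<dots> \<le> 4 * (dist p (fst z))\<^sup>2 * ((g 1 z \<bullet> a)\<^sup>2 + (g 2 z \<bullet> a)\<^sup>2 + (g 3 z \<bullet> a)\<^sup>2) +
       4 * (dist p (fst z))\<^sup>2 * ((g 1 z \<bullet> b)\<^sup>2 + (g 2 z \<bullet> b)\<^sup>2 + (g 3 z \<bullet> b)\<^sup>2)"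
      unfolding d by (intro add_mono *)
    also have "\<dots> = 2 * L z * (dist p (fst z))\<^sup>2"
      by (simp add: L_def gam_def power2_eq_square algebra_simps)
    finally show ?thesis .
  qed
  have "compact (cball p r \<times> {0..0::real})" by (intro compact_Times compact_cball compact_Icc)
  then have "compact (L ` (cball p r \<times> {0..0}))"
    by (rule compact_continuous_image[OF continuous_on_subset[OF cjet_continuous(4)[OF cj]], rotated]) simp
  then have "bdd_above (L ` (cball p r \<times> {0..0}))" by (intro bounded_imp_bdd_above compact_imp_bounded)
  then obtain \<Lambda>0 where \<Lambda>0: "\<And>q. dist p q \<le> r \<Longrightarrow> L (q, 0) \<le> \<Lambda>0" by (force simp: bdd_above_def)
  have L0: "L z = L (fst z, 0)" for z by (simp add: L_def g_def)
  show ?thesis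
  proof (intro exI[of _ "max \<Lambda>0 1"] exI[of _ G] exI[of _ L] conjI allI impI cj)
    fix z :: "heis \<times> real" assume z: "dist p (fst z) \<le> r"
    show L: "L z \<le> max \<Lambda>0 1" using \<Lambda>0[OF z] L0[of z] by simp
    have "gam (G z) (G z) \<le> 2 * L z * (dist p (fst z))\<^sup>2" by (rule cs)
    also have "\<dots> \<le> 2 * max \<Lambda>0 1 * (dist p (fst z))\<^sup>2" by (intro mult_right_mono mult_left_mono L) auto
    finally show "gam (G z) (G z) \<le> 2 * max \<Lambda>0 1 * (dist p (fst z))\<^sup>2" .
  qed simp
qed

abbreviation barrier :: "heis \<Rightarrow> real \<Rightarrow> real \<Rightarrow> real \<Rightarrow> heis \<times> real \<Rightarrow> real" where
  "barrier p \<Lambda> M s \<equiv> \<lambda>z. M * ((dist p (fst z)) ^ 4 + 6 * \<Lambda> * (snd z - s) * (dist p (fst z))\<^sup>2 + 3 * \<Lambda>\<^sup>2 * (snd z - s)\<^sup>2)"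

text \<open>The coefficients make this a supersolution; at the centre it is \<open>O((t - s)\<^sup>2)\<close>, hence
  negligible against a gain linear in \<open>t - s\<close>.\<close>

lemma lateral_barrier:
  fixes p :: heis
  shows "\<exists>\<Lambda>>0. \<forall>M\<ge>0. \<forall>s. \<exists>T G L.
     cjet UNIV (barrier p \<Lambda> M s) T G L \<and>
     (\<forall>z. dist p (fst z) \<le> r \<longrightarrow> s \<le> snd z \<longrightarrow> 0 \<le> T z - L z)"
proof -
  obtain \<Lambda> G L where \<Lambda>: "\<Lambda> > 0" and cj: "cjet UNIV (\<lambda>z. (dist p (fst z))\<^sup>2) (\<lambda>_. 0) G L"
     and bd: "\<And>z. dist p (fst z) \<le> r \<Longrightarrow> L z \<le> \<Lambda>" "\<And>z. dist p (fst z) \<le> r \<Longrightarrow> gam (G z) (G z) \<le> 2 * \<Lambda> * (dist p (fst z))\<^sup>2"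
    using cjet_dist_square[of p r] by blast
  show ?thesis
  proof (intro exI[of _ \<Lambda>] conjI \<Lambda> allI impI)
    fix M s :: real assume M: "M \<ge> 0"
    define n where "n z = (dist p (fst z))\<^sup>2" for z :: "heis \<times> real"
    note tm = cjet_time[OF open_UNIV, of 1 s 0, simplified]
    note tj = cjet_scale[OF tm, of "6 * \<Lambda>"]
    note cjn = cj[folded n_def]
    note full = cjet_scale[OF cjet_add[OF cjet_add[OF cjet_square[OF cjn] cjet_mult[OF tj cjn]] cjet_scale[OF cjet_square[OF tm], of "3 * \<Lambda>\<^sup>2"]], of M]
    have e: "(barrier p \<Lambda> M s) =
       (\<lambda>z. M * ((n z)\<^sup>2 + 6 * \<Lambda> * (snd z - s) * n z + 3 * \<Lambda>\<^sup>2 * (snd z - s)\<^sup>2))"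
      by (simp add: n_def)
    show "\<exists>T G L.
     cjet UNIV (barrier p \<Lambda> M s) T G L \<and>
     (\<forall>z. dist p (fst z) \<le> r \<longrightarrow> s \<le> snd z \<longrightarrow> 0 \<le> T z - L z)"
      unfolding e
    proof (intro exI conjI allI impI, rule full)
      fix z :: "heis \<times> real" assume z: "dist p (fst z) \<le> r" and s: "s \<le> snd z"
      have n0: "n z \<ge> 0" by (simp add: n_def)
      have 1: "n z * L z \<le> n z * \<Lambda>" using bd(1)[OF z] n0 by (rule mult_left_mono)
      have 2: "gam (G z) (G z) \<le> 2 * \<Lambda> * n z" using bd(2)[OF z] by (simp add: n_def)
      have 3: "(6 * \<Lambda> * (snd z - s)) * L z \<le> (6 * \<Lambda> * (snd z - s)) * \<Lambda>" using bd(1)[OF z] \<Lambda> s by (intro mult_left_mono) auto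
      \<comment> \<open>The quartic term costs at most \<open>6 * \<Lambda> * n z\<close>, made of
        \<open>2 * \<Lambda> * n z\<close> and a \<open>gam\<close> part of
        \<open>4 * \<Lambda> * n z\<close>; the mixed term costs at most
        \<open>6 * \<Lambda>\<^sup>2 * (snd z - s)\<close>. The time derivatives of the mixed and
        the quadratic term pay for exactly these.\<close>
      have "0 \<le> 6 * \<Lambda> * n z + 6 * \<Lambda>\<^sup>2 * (snd z - s) - (2 * n z * L z + 2 * gam (G z) (G z) + 6 * \<Lambda> * (snd z - s) * L z)"
        using 1 2 3 by (simp add: power2_eq_square algebra_simps)
      then have "0 \<le> M * (6 * \<Lambda> * n z + 6 * \<Lambda>\<^sup>2 * (snd z - s) - (2 * n z * L z + 2 * gam (G z) (G z) + 6 * \<Lambda> * (snd z - s) * L z))"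
        using M by (rule mult_nonneg_nonneg[rotated])
      then show "0 \<le> M * (2 * n z * 0 + (6 * \<Lambda> * (snd z - s) * 0 + n z * (6 * \<Lambda> * 1)) + 3 * \<Lambda>\<^sup>2 * (2 * (snd z - s) * 1)) -
          M * (2 * n z * L z + 2 * gam (G z) (G z) + (6 * \<Lambda> * (snd z - s) * L z + n z * (6 * \<Lambda> * 0) + 2 * gam ((6 * \<Lambda>) *\<^sub>R 0) (G z)) +
            3 * \<Lambda>\<^sup>2 * (2 * (snd z - s) * 0 + 2 * gam 0 0))"
        by (simp add: gam_bilinear algebra_simps)
    qed
  qed
qed

text \<open>Over one step the heat flow of \<open>g\<close> is replaced by
  \<open>g + (t - s) * G1\<close>. Its residual \<open>(t - s) * G2\<close> is at most
  \<open>2 * k * C\<close> and is paid for by the extra term \<open>2 * C * k * (t - s)\<close>. At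
  time \<open>s + k\<close> this term costs \<open>2 * C * k\<^sup>2\<close>, and passing from
  \<open>g + k * G1\<close> to the walk costs \<open>C * k\<^sup>2\<close>. The sign
  \<open>\<sigma>\<close> serves both functions of the sum.\<close>

lemma heat_step:
  assumes vs: "vsub (\<lambda>_ _. \<gamma>) \<Omega> w" and \<Omega>: "ball p r \<times> {s<..<s+2*k} \<subseteq> \<Omega>"
    and cont: "continuous_on (cball p r \<times> {s..s+2*k}) w"
    and k: "0 < k" "k \<le> 1" and g: "smooth4 C R g" and R: "norm p + r \<le> R" and r: "0 < r"
    and \<sigma>: "\<bar>\<sigma>\<bar> = 1" and M: "\<And>x. \<bar>g x\<bar> \<le> M"
    and cj: "cjet V \<Phi> T G L" and V: "cball p r \<times> {s..s+2*k} \<subseteq> V"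
    and super: "\<And>q t. dist p q < r \<Longrightarrow> s < t \<Longrightarrow> t < s+2*k \<Longrightarrow> 0 \<le> T (q, t) - L (q, t) + \<gamma>"
    and bottom: "\<And>q. dist p q \<le> r \<Longrightarrow> w (q, s) \<le> \<Phi> (q, s) + \<sigma> * g q"
    and lateral: "\<And>q t. dist p q = r \<Longrightarrow> s \<le> t \<Longrightarrow> t \<le> s+2*k \<Longrightarrow> w (q, t) + (M + 2 * k * C) \<le> \<Phi> (q, t)"
    and q: "dist p q \<le> r"
  shows "w (q, s + k) \<le> \<Phi> (q, s + k) + \<sigma> * walk k g q + 3 * C * k\<^sup>2"
proof -
  obtain G1 G2 E E' where g1: "cjet UNIV (\<lambda>z. g (fst z)) (\<lambda>_. 0) E (\<lambda>z. G1 (fst z))"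
     and g2: "cjet UNIV (\<lambda>z. G1 (fst z)) (\<lambda>_. 0) E' (\<lambda>z. G2 (fst z))"
     and b1: "\<And>x. norm x \<le> R \<Longrightarrow> \<bar>G1 x\<bar> \<le> C" and b2: "\<And>x. norm x \<le> R \<Longrightarrow> \<bar>G2 x\<bar> \<le> C"
     and b3: "\<And>x k. norm x \<le> R \<Longrightarrow> 0 \<le> k \<Longrightarrow> k \<le> 1 \<Longrightarrow> \<bar>walk k g x - g x - k * G1 x\<bar> \<le> C * k\<^sup>2"
    using g unfolding smooth4_def by blast
  have oV: "open V" by (rule cjet_open[OF cj])
  have nR: "norm x \<le> R" if "dist p x \<le> r" for x
    using that R norm_triangle_sub[of x p] by (simp add: dist_norm norm_minus_commute)
  have C0: "C \<ge> 0" using b1[OF nR[of p]] r by simp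
  have \<sigma>m: "\<bar>\<sigma> * x\<bar> = \<bar>x\<bar>" for x using \<sigma> by (simp add: abs_mult)
  note tm = cjet_time[OF oV, of 1 s 0, simplified]
  note U = cjet_add[OF cjet_subset[OF g1 oV] cjet_mult[OF tm cjet_subset[OF g2 oV]], simplified]
  note full = cjet_add[OF cjet_add[OF cj cjet_scale[OF U, of \<sigma>]] cjet_time[OF oV, of "2 * C * k" s 0]]
  have "w (q, s + k) \<le> \<Phi> (q, s + k) + \<sigma> * (g (fst (q, s+k)) + (snd (q, s+k) - s) * G1 (fst (q, s+k))) + (2 * C * k * (snd (q, s+k) - s) + 0)"
  proof (rule vsub_comparison[OF vs \<Omega> k(1) cont full V])
    fix q t assume qt: "dist p q < r" "s < t" "t < s + 2*k"
    have "\<bar>\<sigma> * ((t - s) * G2 q)\<bar> \<le> 2 * k * C"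
      unfolding \<sigma>m unfolding abs_mult using qt b2[OF nR[of q]] by (intro mult_mono) auto
    then have "\<sigma> * ((t - s) * G2 q) \<le> 2 * k * C" by linarith
    then show "0 \<le> T (q, t) + \<sigma> * G1 (fst (q, t)) + 2 * C * k -
       (L (q, t) + \<sigma> * (G1 (fst (q, t)) + ((snd (q, t) - s) * G2 (fst (q, t)) + 2 * gam 0 (E' (q, t)))) + 0) + \<gamma>"
      using super[OF qt] by (simp add: gam_bilinear algebra_simps)
  next
    fix q assume "dist p q \<le> r"
    from bottom[OF this] show "w (q, s) \<le> \<Phi> (q, s) + \<sigma> * (g (fst (q, s)) + (snd (q, s) - s) * G1 (fst (q, s))) + (2 * C * k * (snd (q, s) - s) + 0)"
      by simp
  next
    fix q t assume qt: "dist p q = r" "s \<le> t" "t \<le> s + 2*k"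
    have "\<bar>(t - s) * G1 q\<bar> \<le> 2 * k * C"
      unfolding abs_mult using qt b1[OF nR[of q]] by (intro mult_mono) auto
    then have "\<bar>g q + (t - s) * G1 q\<bar> \<le> M + 2 * k * C" using M[of q] by linarith
    then have "- (M + 2 * k * C) \<le> \<sigma> * (g q + (t - s) * G1 q)" using \<sigma>m[of "g q + (t - s) * G1 q"] by linarith
    moreover have "0 \<le> 2 * C * k * (t - s)" using C0 k qt by simp
    ultimately show "w (q, t) \<le> \<Phi> (q, t) + \<sigma> * (g (fst (q, t)) + (snd (q, t) - s) * G1 (fst (q, t))) + (2 * C * k * (snd (q, t) - s) + 0)"
      using lateral[OF qt] by simp
  qed (use q k in auto)
  moreover have "\<bar>\<sigma> * (walk k g q - g q - k * G1 q)\<bar> \<le> C * k\<^sup>2"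
    unfolding \<sigma>m using b3[OF nR[OF q], of k] k by simp
  then have "\<sigma> * (g q + k * G1 q) \<le> \<sigma> * walk k g q + C * k\<^sup>2" by (simp add: algebra_simps abs_le_iff)
  ultimately show ?thesis by (simp add: power2_eq_square algebra_simps)
qed

end

section \<open>Sums of subsolutions of linear equations\<close>

context horizontal_pair
begin

text \<open>The evolved data \<open>gg j\<close> are added to the majorant of \<open>u\<close> and
  subtracted from that of \<open>v\<close>, so they cancel in the sum. At \<open>z1\<close> this
  leaves \<open>f\<close> plus small errors minus \<open>c * h\<close>, against the touching
  \<open>f z1 = u z1 + v z1\<close>.\<close>

lemma vsub_linear_sum:
  assumes \<Omega>: "open \<Omega>" "z1 \<in> \<Omega>" and cu: "continuous_on \<Omega> u" and cv: "continuous_on \<Omega> v"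
    and vu: "vsub (\<lambda>_ _. \<alpha>) \<Omega> u" and vv: "vsub (\<lambda>_ _. \<beta>) \<Omega> v"
    and cj: "cjet \<Omega> \<phi> T G L"
    and max: "\<And>z. z \<in> \<Omega> \<Longrightarrow> u z + v z - \<phi> z \<le> u z1 + v z1 - \<phi> z1"
  shows "T z1 - L z1 + \<alpha> + \<beta> \<le> 0"
proof (rule ccontr)
  assume "\<not> T z1 - L z1 + \<alpha> + \<beta> \<le> 0"
  \<comment> \<open>Half of the assumed violation: by continuity the strict inequality with surplus
    \<open>c\<close> persists on a cylinder around \<open>z1\<close>.\<close>
  define c where "c = (T z1 - L z1 + \<alpha> + \<beta>) / 2"
  have c: "c > 0" using \<open>\<not> _\<close> by (simp add: c_def)
  obtain p t1 where z1: "z1 = (p, t1)" by fastforce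
  define f where "f z = \<phi> z + (u z1 + v z1 - \<phi> z1)" for z
  have cjf: "cjet \<Omega> f T G L"
    unfolding f_def using cjet_add[OF cj cjet_const[OF \<Omega>(1)]] by simp
  have uvf: "u z + v z \<le> f z" if "z \<in> \<Omega>" for z using max[OF that] by (simp add: f_def)
  have cf: "continuous_on \<Omega> f" by (rule cjet_continuous[OF cjf])
  have "continuous_on \<Omega> (\<lambda>z. T z - L z + \<alpha> + \<beta>)"
    by (intro continuous_intros cjet_continuous[OF cj])
  then have "open (\<Omega> \<inter> (\<lambda>z. T z - L z + \<alpha> + \<beta>) -` {c<..})"
    by (rule continuous_open_preimage[OF _ \<Omega>(1)]) auto
  moreover have "z1 \<in> \<Omega> \<inter> (\<lambda>z. T z - L z + \<alpha> + \<beta>) -` {c<..}"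
    using \<Omega>(2) c by (simp add: c_def)
  ultimately obtain A B where AB: "open A" "open B" "p \<in> A" "t1 \<in> B"
      "A \<times> B \<subseteq> \<Omega> \<inter> (\<lambda>z. T z - L z + \<alpha> + \<beta>) -` {c<..}"
    unfolding z1 by (rule open_prod_elim) auto
  obtain r where r: "r > 0" "cball p r \<subseteq> A" using AB open_contains_cball by blast
  obtain h0 where h0: "h0 > 0" "cball t1 h0 \<subseteq> B" using AB open_contains_cball by blast
  define K where "K = cball p r \<times> {t1 - h0..t1 + h0}"
  have "{t1 - h0..t1 + h0} = cball t1 h0" by (simp add: cball_eq_atLeastAtMost)
  then have K\<Omega>: "K \<subseteq> \<Omega>" and Kc: "\<And>z. z \<in> K \<Longrightarrow> T z - L z + \<alpha> + \<beta> > c"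
    using AB(5) r(2) h0(2) unfolding K_def by blast+
  have K: "compact K" unfolding K_def by (intro compact_Times compact_cball compact_Icc)
  have bdd: "\<exists>M. \<forall>z\<in>K. \<bar>w z\<bar> \<le> M" if "continuous_on \<Omega> w" for w :: "heis \<times> real \<Rightarrow> real"
  proof -
    have "compact (w ` K)" by (intro compact_continuous_image K continuous_on_subset[OF that K\<Omega>])
    then have "bounded (w ` K)" by (rule compact_imp_bounded)
    then show ?thesis by (auto simp: bounded_iff)
  qed
  obtain Mu Mv Mf where "\<forall>z\<in>K. \<bar>u z\<bar> \<le> Mu" "\<forall>z\<in>K. \<bar>v z\<bar> \<le> Mv" "\<forall>z\<in>K. \<bar>f z\<bar> \<le> Mf"
    using bdd[OF cu] bdd[OF cv] bdd[OF cf] by blast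
  then obtain M where M: "M \<ge> 0" "\<And>z. z \<in> K \<Longrightarrow> \<bar>u z\<bar> \<le> M" "\<And>z. z \<in> K \<Longrightarrow> \<bar>v z\<bar> \<le> M" "\<And>z. z \<in> K \<Longrightarrow> \<bar>f z\<bar> \<le> M"
    by (intro that[of "max 0 (max Mu (max Mv Mf))"]) (auto simp: le_max_iff_disj)
  obtain \<Lambda> where \<Lambda>: "\<Lambda> > 0" and bar: "\<And>M s. M \<ge> 0 \<Longrightarrow> \<exists>T G L.
     cjet UNIV (barrier p \<Lambda> M s) T G L \<and>
     (\<forall>z. dist p (fst z) \<le> r \<longrightarrow> s \<le> snd z \<longrightarrow> 0 \<le> T z - L z)"
    using lateral_barrier[of p r] by blast
  \<comment> \<open>On the lateral boundary the barrier has to dominate bounded quantities only: at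
    most \<open>u\<close> or \<open>v\<close>, the data, \<open>f\<close>, the drift and the small
    errors, together below \<open>6 * M + 10\<close>.\<close>
  define Mb where "Mb = (6 * M + 10) / r ^ 4"
  have Mb: "Mb > 0" "Mb * r ^ 4 = 6 * M + 10" using M(1) r(1) by (auto simp: Mb_def intro!: divide_pos_pos)
  \<comment> \<open>The caps keep the cylinder inside \<open>K\<close>, make twice the barrier at
    the centre at most \<open>c * h / 4\<close>, and keep the linear drifts bounded by 1.\<close>
  define h where "h = min (min 1 (h0 / 2)) (min (c / (24 * \<Lambda>\<^sup>2 * Mb)) (1 / (2 * (\<bar>\<alpha>\<bar> + c + 1))))"
  have h: "h > 0" "h \<le> 1" "2 * h \<le> h0" "h \<le> c / (24 * \<Lambda>\<^sup>2 * Mb)" "h \<le> 1 / (2 * (\<bar>\<alpha>\<bar> + c + 1))"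
    using h0(1) c \<Lambda> Mb(1) by (auto simp: h_def min_le_iff_disj intro!: divide_pos_pos mult_pos_pos)
  have h4: "2 * (Mb * (3 * \<Lambda>\<^sup>2 * h\<^sup>2)) \<le> c * h / 4"
  proof -
    have "h * (24 * \<Lambda>\<^sup>2 * Mb) \<le> c" using h(4) \<Lambda> Mb(1) by (simp add: pos_le_divide_eq)
    then have "h * (h * (24 * \<Lambda>\<^sup>2 * Mb)) \<le> h * c" using h(1) by (intro mult_left_mono) auto
    then show ?thesis by (simp add: power2_eq_square algebra_simps)
  qed
  have h5: "(\<bar>\<alpha>\<bar> + c) * (2 * h) \<le> 1"
  proof -
    have "h * (2 * (\<bar>\<alpha>\<bar> + c + 1)) \<le> 1" using h(5) c by (simp add: pos_le_divide_eq)
    then show ?thesis using h(1) by (simp add: algebra_simps)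
  qed
  define s0 where "s0 = t1 - h"
  define BB where "BB z = barrier p \<Lambda> Mb s0 z" for z
  obtain TB GB LB where cjB: "cjet UNIV BB TB GB LB"
    and BBsup: "\<And>z. dist p (fst z) \<le> r \<Longrightarrow> s0 \<le> snd z \<Longrightarrow> 0 \<le> TB z - LB z"
    using bar[of Mb s0] Mb(1) unfolding BB_def[abs_def] by auto
  have BB0: "BB z \<ge> 0" if "s0 \<le> snd z" for z
    unfolding BB_def using Mb(1) \<Lambda> that by (intro mult_nonneg_nonneg add_nonneg_nonneg) auto
  have BBr: "BB (q, t) \<ge> 6 * M + 10" if "dist p q = r" "s0 \<le> t" for q t
  proof -
    have "Mb * r ^ 4 \<le> BB (q, t)"
      unfolding BB_def fst_conv snd_conv that(1) using Mb(1) \<Lambda> that(2)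
      by (intro mult_left_mono) (auto intro!: add_increasing2 mult_nonneg_nonneg)
    then show ?thesis using Mb(2) by simp
  qed
  define \<delta> where "\<delta> = min 1 (c * h / 16)"
  have \<delta>: "\<delta> > 0" "\<delta> \<le> 1" "\<delta> \<le> c * h / 16" using c h(1) by (auto simp: \<delta>_def)
  have inK: "(q, t) \<in> K" if "dist p q \<le> r" "s0 \<le> t" "t \<le> t1 + h" for q t
    using that h by (auto simp: K_def s0_def)
  have cu0: "continuous_on (cball p r) (\<lambda>q. u (q, s0))"
    by (rule continuous_on_compose2[OF cu]) (use inK K\<Omega> h(1) in \<open>auto simp: s0_def intro!: continuous_intros\<close>)
  obtain g where g: "poly_gauss (\<lambda>x y. g y)" "\<And>y. \<bar>g y\<bar> \<le> M + \<delta>" "\<And>y. dist p y \<le> r \<Longrightarrow> \<bar>g y - u (y, s0)\<bar> \<le> \<delta>"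
    using poly_gauss_approximation[OF compact_cball cu0 M(1) _ \<delta>(1)] inK M(2) h(1) by (auto simp: s0_def)
  define R where "R = norm p + r"
  obtain C where C: "\<And>s. smooth4 C R (\<lambda>x. g (x \<cdot>\<^sub>H s))" using poly_gauss_smooth4[OF g(1), of R] by blast
  have st: "stable (M + 1) C R g"
    unfolding stable_def using C g(2) \<delta>(2) by (meson add_left_mono order_trans)
  have C0: "C \<ge> 0"
  proof -
    obtain G1 G2 where "\<forall>x. norm x \<le> R \<longrightarrow> \<bar>G1 x\<bar> \<le> C \<and> \<bar>G2 x\<bar> \<le> C \<and>
        (\<forall>k. 0 \<le> k \<longrightarrow> k \<le> 1 \<longrightarrow> \<bar>walk k g x - g x - k * G1 x\<bar> \<le> C * k\<^sup>2)"
      using stable_smooth4[OF st] unfolding smooth4_def by blast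
    from spec[OF this, of p] have "\<bar>G1 p\<bar> \<le> C" using r(1) by (simp add: R_def)
    then show ?thesis by linarith
  qed
  \<comment> \<open>A bound for the step, available only now because \<open>C\<close> depends on
    \<open>g\<close>. It makes the accumulated error \<open>3 * C * k * h\<close> of all steps small
    against \<open>c * h\<close>.\<close>
  define m where "m = min 1 (min (1 / (2 * C + 1)) (c / (48 * C + 1)))"
  have m: "m > 0" using C0 c by (auto simp: m_def intro!: divide_pos_pos)
  obtain N :: nat where N: "N > 0" "h / N \<le> m"
  proof -
    obtain N :: nat where "h / m < real N" using reals_Archimedean2 by blast
    then have hN: "h < real N * m" using m by (simp add: pos_divide_less_eq)
    then have "N > 0" using h(1) by (cases N) auto
    moreover have "h / N \<le> m" using hN \<open>N > 0\<close> by (simp add: pos_divide_le_eq mult.commute)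
    ultimately show thesis by (rule that)
  qed
  define k where "k = h / N"
  have k: "k > 0" "k \<le> 1" "2 * C * k \<le> 1" "6 * C * k \<le> c / 8" "real N * k = h"
  proof -
    show "k > 0" "real N * k = h" using N(1) h(1) by (auto simp: k_def)
    show "k \<le> 1" using N(2) by (simp add: k_def m_def)
    have "k \<le> 1 / (2 * C + 1)" using N(2) by (simp add: k_def m_def)
    then show "2 * C * k \<le> 1" using C0 \<open>k > 0\<close> by (simp add: pos_le_divide_eq algebra_simps)
    have "k \<le> c / (48 * C + 1)" using N(2) by (simp add: k_def m_def)
    then show "6 * C * k \<le> c / 8" using C0 \<open>k > 0\<close> by (simp add: pos_le_divide_eq algebra_simps)
  qed
  define gg where "gg j = (walk k ^^ j) g" for j
  have gst: "stable (M + 1) C R (gg j)" for j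
    by (induction j) (auto simp: gg_def st stable_walk)
  have gbd: "\<bar>gg j x\<bar> \<le> M + 1" for j x using gst[of j] by (simp add: stable_def)
  define s where "s j = s0 + real j * k" for j
  \<comment> \<open>The initial approximation error plus the loss of
    \<open>3 * C * k\<^sup>2\<close> in each step of \<open>heat_step\<close>.\<close>
  define e where "e j = \<delta> + 3 * C * k\<^sup>2 * real j" for j
  have e0: "e j \<ge> 0" for j using \<delta>(1) C0 by (simp add: e_def)
  \<comment> \<open>The drift \<open>- \<alpha>\<close> balances the constant in the equation of
    \<open>u\<close>. In \<open>\<Phi>2\<close> the drift is \<open>\<alpha> - c\<close>: the
    surplus of \<open>f\<close> allows a decrease at rate \<open>c\<close>, and this is the
    gain.\<close>
  define \<Phi>1 where "\<Phi>1 j z = BB z + ((- \<alpha>) * (snd z - s0) + e j)" for j and z :: "heis \<times> real"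
  define \<Phi>2 where "\<Phi>2 j z = (f z + BB z) + ((\<alpha> - c) * (snd z - s0) + e j)" for j and z :: "heis \<times> real"
  have cj1: "cjet \<Omega> (\<Phi>1 j) (\<lambda>z. TB z + (- \<alpha>)) (\<lambda>z. GB z + 0) (\<lambda>z. LB z + 0)" for j
    unfolding \<Phi>1_def using cjet_subset[OF cjB \<Omega>(1)] by (intro cjet_add cjet_time \<Omega>) auto
  have cj2: "cjet \<Omega> (\<Phi>2 j) (\<lambda>z. (T z + TB z) + (\<alpha> - c)) (\<lambda>z. (G z + GB z) + 0) (\<lambda>z. (L z + LB z) + 0)" for j
    unfolding \<Phi>2_def using cjet_subset[OF cjB \<Omega>(1)] by (intro cjet_add cjet_time \<Omega> cjf) auto
  have small: "\<bar>\<alpha> * (t - s0)\<bar> \<le> 1" "c * (t - s0) + \<bar>\<alpha> * (t - s0)\<bar> \<le> 1" if "s0 \<le> t" "t \<le> t1 + h" for t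
  proof -
    have "(\<bar>\<alpha>\<bar> + c) * (t - s0) \<le> (\<bar>\<alpha>\<bar> + c) * (2 * h)"
      using that c by (intro mult_left_mono) (auto simp: s0_def)
    then have *: "(\<bar>\<alpha>\<bar> + c) * (t - s0) \<le> 1" using h5 by linarith
    have "\<bar>\<alpha> * (t - s0)\<bar> = \<bar>\<alpha>\<bar> * (t - s0)" using that by (simp add: abs_mult)
    with * show "c * (t - s0) + \<bar>\<alpha> * (t - s0)\<bar> \<le> 1" by (simp add: algebra_simps)
    moreover have "c * (t - s0) \<ge> 0" using that c by simp
    ultimately show "\<bar>\<alpha> * (t - s0)\<bar> \<le> 1" by linarith
  qed
  have chain: "\<forall>q. dist p q \<le> r \<longrightarrow> u (q, s j) \<le> \<Phi>1 j (q, s j) + gg j q \<and> v (q, s j) \<le> \<Phi>2 j (q, s j) - gg j q"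
    if "j \<le> N" for j
    using that
  proof (induction j)
    case 0
    show ?case
    proof (intro allI impI)
      fix q assume q: "dist p q \<le> r"
      have "BB (q, s0) \<ge> 0" by (rule BB0) simp
      moreover have "u (q, s0) + v (q, s0) \<le> f (q, s0)"
        using uvf K\<Omega> inK[OF q, of s0] h(1) by (auto simp: s0_def)
      ultimately show "u (q, s 0) \<le> \<Phi>1 0 (q, s 0) + gg 0 q \<and> v (q, s 0) \<le> \<Phi>2 0 (q, s 0) - gg 0 q"
        using g(3)[OF q] by (simp add: \<Phi>1_def \<Phi>2_def s_def e_def gg_def abs_le_iff)
    qed
  next
    case (Suc j)
    then have IH: "\<And>q. dist p q \<le> r \<Longrightarrow> u (q, s j) \<le> \<Phi>1 j (q, s j) + 1 * gg j q"
      "\<And>q. dist p q \<le> r \<Longrightarrow> v (q, s j) \<le> \<Phi>2 j (q, s j) + (-1) * gg j q" by auto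
    have sj: "s0 \<le> s j" using k(1) by (simp add: s_def)
    \<comment> \<open>\<open>heat_step\<close> looks ahead by \<open>2 * k\<close>, so the last step
      reaches \<open>k\<close> beyond \<open>t1\<close>; the cylinder leaves room \<open>h\<close>
      there.\<close>
    have sj2: "s j + 2 * k \<le> t1 + h"
    proof -
      have "(real j + 2) * k \<le> (real N + 1) * k" using Suc.prems k(1) by (intro mult_right_mono) auto
      moreover have "1 * k \<le> real N * k" using N(1) k(1) by (intro mult_right_mono) auto
      ultimately show ?thesis using k(5) by (simp add: s_def s0_def algebra_simps)
    qed
    have sub: "cball p r \<times> {s j..s j + 2 * k} \<subseteq> K" using inK sj sj2 by auto
    have sub': "ball p r \<times> {s j<..<s j + 2 * k} \<subseteq> \<Omega>" using sub K\<Omega> by (auto simp: subset_iff)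
    have sub\<Omega>: "cball p r \<times> {s j..s j + 2 * k} \<subseteq> \<Omega>" using sub K\<Omega> by blast
    have g4: "smooth4 C R (gg j)" by (rule stable_smooth4[OF gst])
    have Ck: "2 * k * C \<le> 1" using k(3) by (simp add: mult.commute mult.left_commute)
    have ssuc: "s (Suc j) = s j + k" by (simp add: s_def algebra_simps)
    have esuc: "e (Suc j) = e j + 3 * C * k\<^sup>2" by (simp add: e_def algebra_simps)
    have gsuc: "gg (Suc j) = walk k (gg j)" by (simp add: gg_def)
    have 1: "u (q, s j + k) \<le> \<Phi>1 j (q, s j + k) + 1 * walk k (gg j) q + 3 * C * k\<^sup>2" if q: "dist p q \<le> r" for q
    proof (rule heat_step[OF vu sub' continuous_on_subset[OF cu sub\<Omega>] k(1,2) g4 _ r(1) _ gbd cj1 sub\<Omega>])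
      fix q t assume qt: "dist p q < r" "s j < t" "t < s j + 2 * k"
      show "0 \<le> TB (q, t) + - \<alpha> - (LB (q, t) + 0) + \<alpha>"
        using BBsup[of "(q, t)"] qt sj by simp
    next
      fix q t assume qt: "dist p q = r" "s j \<le> t" "t \<le> s j + 2 * k"
      have t: "s0 \<le> t" "t \<le> t1 + h" using qt sj sj2 by auto
      show "u (q, t) + (M + 1 + 2 * k * C) \<le> \<Phi>1 j (q, t)"
        using M(2)[OF inK[of q t]] qt(1) t BBr[OF qt(1) t(1)] small(1)[OF t] e0[of j] Ck M(1)
        by (simp add: \<Phi>1_def abs_le_iff)
    qed (use q IH(1) in \<open>auto simp: R_def\<close>)
    have 2: "v (q, s j + k) \<le> \<Phi>2 j (q, s j + k) + (-1) * walk k (gg j) q + 3 * C * k\<^sup>2" if q: "dist p q \<le> r" for q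
    proof (rule heat_step[OF vv sub' continuous_on_subset[OF cv sub\<Omega>] k(1,2) g4 _ r(1) _ gbd cj2 sub\<Omega>])
      fix q t assume qt: "dist p q < r" "s j < t" "t < s j + 2 * k"
      have "(q, t) \<in> K" using sub qt by auto
      then show "0 \<le> T (q, t) + TB (q, t) + (\<alpha> - c) - (L (q, t) + LB (q, t) + 0) + \<beta>"
        using BBsup[of "(q, t)"] Kc[of "(q, t)"] qt sj by simp
    next
      fix q t assume qt: "dist p q = r" "s j \<le> t" "t \<le> s j + 2 * k"
      have t: "s0 \<le> t" "t \<le> t1 + h" using qt sj sj2 by auto
      have "(\<alpha> - c) * (t - s0) \<ge> - 1" using small(2)[OF t] by (simp add: algebra_simps abs_le_iff)
      then show "v (q, t) + (M + 1 + 2 * k * C) \<le> \<Phi>2 j (q, t)"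
        using M(3)[OF inK[of q t]] M(4)[OF inK[of q t]] qt(1) t BBr[OF qt(1) t(1)] e0[of j] Ck M(1)
        by (simp add: \<Phi>2_def abs_le_iff)
    qed (use q IH(2) in \<open>auto simp: R_def\<close>)
    show ?case
    proof (intro allI impI)
      fix q assume q: "dist p q \<le> r"
      show "u (q, s (Suc j)) \<le> \<Phi>1 (Suc j) (q, s (Suc j)) + gg (Suc j) q \<and>
        v (q, s (Suc j)) \<le> \<Phi>2 (Suc j) (q, s (Suc j)) - gg (Suc j) q"
        using 1[OF q] 2[OF q] unfolding ssuc gsuc \<Phi>1_def \<Phi>2_def esuc by simp
    qed
  qed
  have sN: "s N = t1" using k(5) by (simp add: s_def s0_def)
  have "u (p, t1) \<le> \<Phi>1 N (p, t1) + gg N p" "v (p, t1) \<le> \<Phi>2 N (p, t1) - gg N p"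
    using chain[of N] r(1) sN by auto
  then have "u z1 + v z1 \<le> f z1 + 2 * BB (p, t1) - c * h + 2 * e N"
    by (simp add: z1 \<Phi>1_def \<Phi>2_def s0_def algebra_simps)
  moreover have "f z1 = u z1 + v z1" by (simp add: f_def)
  moreover have "2 * BB (p, t1) \<le> c * h / 4" using h4 by (simp add: BB_def s0_def)
  moreover have "2 * e N \<le> c * h / 4"
  proof -
    have eq: "3 * C * k\<^sup>2 * real N = 3 * C * k * h" by (simp only: k(5)[symmetric] power2_eq_square mult_ac)
    have "6 * C * k * h \<le> c * h / 8" using mult_right_mono[OF k(4), of h] h(1) by simp
    then have "2 * (3 * C * k\<^sup>2 * real N) \<le> c * h / 8" unfolding eq by simp
    moreover have "2 * (d + x) \<le> y / 4" if "2 * x \<le> y / 8" "d \<le> y / 16" for d x y :: real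
      using that by simp
    ultimately show ?thesis using \<delta>(3) unfolding e_def by blast
  qed
  \<comment> \<open>One quarter comes from the barrier at the centre, another from the accumulated
    errors.\<close>
  ultimately have "c * h \<le> c * h / 2" by linarith
  then show False using c h(1) by (simp add: mult_pos_pos)
qed

end

section \<open>Sup-convolutions along left translations\<close>

text \<open>The squared Euclidean norm of \<open>(q \<cdot>\<^sub>H heis_inv p, s - t)\<close> for \<open>y = (q, s)\<close>, \<open>z = (p, t)\<close>; hence
  \<open>cost (ltrans g s z) z\<close> does not depend on \<open>z\<close>.\<close>

definition cost :: "heis \<times> real \<Rightarrow> heis \<times> real \<Rightarrow> real" where
  "cost y z = (fst y $ 1 - fst z $ 1)\<^sup>2 + (fst y $ 2 - fst z $ 2)\<^sup>2 +
     (fst y $ 3 - fst z $ 3 - (fst y $ 1 * fst z $ 2 - fst z $ 1 * fst y $ 2) / 2)\<^sup>2 + (snd y - snd z)\<^sup>2"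

lemma cost_nonneg: "cost y z \<ge> 0"
  by (simp add: cost_def)

lemma cost_self [simp]: "cost z z = 0"
  by (simp add: cost_def)

lemma cost_eq_0D:
  assumes "cost y z = 0"
  shows "y = z"
proof -
  have "fst y $ 1 = fst z $ 1" "fst y $ 2 = fst z $ 2"
    "fst y $ 3 - fst z $ 3 - (fst y $ 1 * fst z $ 2 - fst z $ 1 * fst y $ 2) / 2 = 0" "snd y = snd z"
    using assms unfolding cost_def by (auto simp: add_nonneg_eq_0_iff)
  then show ?thesis by (simp add: prod_eq_iff vec_eq_iff forall_3)
qed

lemma continuous_cost [continuous_intros]:
  assumes "continuous_on S f" "continuous_on S g"
  shows "continuous_on S (\<lambda>x. cost (f x) (g x))"
  unfolding cost_def by (intro continuous_intros assms) auto

text \<open>\<open>cost\<close> is no metric, but it is continuous and vanishes only on the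
  diagonal, so it has a positive minimum on the pairs of \<open>K\<close> at distance at least
  \<open>\<delta>\<close>.\<close>

lemma compact_cost_close:
  assumes K: "compact K" and \<delta>: "0 < \<delta>"
  shows "\<exists>\<kappa>>0. \<forall>y\<in>K. \<forall>z\<in>K. cost y z < \<kappa> \<longrightarrow> dist y z < \<delta>"
proof -
  define D where "D = (K \<times> K) \<inter> {x. \<delta> \<le> dist (fst x) (snd x)}"
  have "closed {x::(heis \<times> real) \<times> (heis \<times> real). \<delta> \<le> dist (fst x) (snd x)}"
    by (intro closed_Collect_le continuous_intros)
  then have D: "compact D" unfolding D_def by (intro compact_Int_closed compact_Times K)
  show ?thesis
  proof (cases "D = {}")
    case True
    then have "\<forall>y\<in>K. \<forall>z\<in>K. dist y z < \<delta>" by (auto simp: D_def not_le)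
    then show ?thesis by (intro exI[of _ 1]) auto
  next
    case False
    have "\<exists>x\<in>D. \<forall>y\<in>D. cost (fst x) (snd x) \<le> cost (fst y) (snd y)"
      by (intro continuous_attains_inf[OF D False] continuous_intros)
    then obtain x where x: "x \<in> D" "\<And>y. y \<in> D \<Longrightarrow> cost (fst x) (snd x) \<le> cost (fst y) (snd y)" by blast
    have "fst x \<noteq> snd x" using x(1) \<delta> by (auto simp: D_def)
    then have "cost (fst x) (snd x) > 0"
      using cost_eq_0D cost_nonneg by (metis order_le_less)
    moreover have "dist y z < \<delta>" if "y \<in> K" "z \<in> K" "cost y z < cost (fst x) (snd x)" for y z
    proof (rule ccontr)
      assume "\<not> dist y z < \<delta>"
      then have "(y, z) \<in> D" using that by (simp add: D_def)
      from x(2)[OF this] that(3) show False by simp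
    qed
    ultimately show ?thesis by blast
  qed
qed

text \<open>The supremum runs over a compact set, so that it is attained without any growth
  condition. Interiority of the maximizers is shown separately where it is used.\<close>

definition supconv :: "(heis \<times> real) set \<Rightarrow> real \<Rightarrow> (heis \<times> real \<Rightarrow> real) \<Rightarrow> heis \<times> real \<Rightarrow> real" where
  "supconv K n u z = (SUP y\<in>K. u y - n * cost y z)"

definition opt :: "(heis \<times> real) set \<Rightarrow> real \<Rightarrow> (heis \<times> real \<Rightarrow> real) \<Rightarrow> heis \<times> real \<Rightarrow> heis \<times> real \<Rightarrow> bool" where
  "opt K n u z y \<longleftrightarrow> y \<in> K \<and> supconv K n u z = u y - n * cost y z"

lemma supconv_attained:
  assumes K: "compact K" "K \<noteq> {}" and u: "continuous_on K u"
  shows "(\<exists>y. opt K n u z y) \<and> (\<forall>y\<in>K. u y - n * cost y z \<le> supconv K n u z)"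
proof -
  have "\<exists>y\<in>K. \<forall>y'\<in>K. u y' - n * cost y' z \<le> u y - n * cost y z"
    by (intro continuous_attains_sup K continuous_intros u)
  then obtain y where y: "y \<in> K" "\<And>y'. y' \<in> K \<Longrightarrow> u y' - n * cost y' z \<le> u y - n * cost y z" by blast
  have "supconv K n u z = u y - n * cost y z"
    unfolding supconv_def by (rule cSup_eq_maximum) (use y in auto)
  then show ?thesis unfolding opt_def using y by (intro conjI ballI exI[of _ y]) simp_all
qed

lemma supconv_continuous:
  assumes K: "compact K" "K \<noteq> {}" and u: "continuous_on K u"
  shows "continuous_on S (supconv K n u)"
proof -
  note att = supconv_attained[OF K u, of n]
  have "isCont (supconv K n u) z0" for z0
    unfolding continuous_at_eps_delta
  proof (intro allI impI)
    fix e :: real assume e: "e > 0"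
    define B where "B = K \<times> cball z0 1"
    have "compact B" unfolding B_def by (intro compact_Times K compact_cball)
    moreover have "continuous_on B (\<lambda>x. u (fst x) - n * cost (fst x) (snd x))"
      by (intro continuous_intros continuous_on_compose2[OF u]) (auto simp: B_def)
    ultimately have "uniformly_continuous_on B (\<lambda>x. u (fst x) - n * cost (fst x) (snd x))"
      by (rule compact_uniformly_continuous[rotated])
    then obtain d where d: "d > 0" "\<And>x x'. x \<in> B \<Longrightarrow> x' \<in> B \<Longrightarrow> dist x' x < d \<Longrightarrow>
        dist (u (fst x') - n * cost (fst x') (snd x')) (u (fst x) - n * cost (fst x) (snd x)) < e"
      using e unfolding uniformly_continuous_on_def by metis
    show "\<exists>d>0. \<forall>z. dist z z0 < d \<longrightarrow> dist (supconv K n u z) (supconv K n u z0) < e"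
    proof (intro exI[of _ "min d 1"] conjI allI impI)
      fix z assume z: "dist z z0 < min d 1"
      have cl: "\<bar>(u y - n * cost y z) - (u y - n * cost y z0)\<bar> < e" if "y \<in> K" for y
        using d(2)[of "(y, z0)" "(y, z)"] z that by (simp add: B_def dist_Pair_Pair dist_commute dist_real_def)
      obtain y y0 where y: "opt K n u z y" "opt K n u z0 y0" using att by blast
      have "supconv K n u z < supconv K n u z0 + e"
        using cl[of y] y(1) att[of z0] unfolding opt_def by fastforce
      moreover have "supconv K n u z0 < supconv K n u z + e"
        using cl[of y0] y(2) att[of z] unfolding opt_def by fastforce
      ultimately show "dist (supconv K n u z) (supconv K n u z0) < e" by (simp add: dist_real_def)
    qed (use d in auto)
  qed
  then show ?thesis by (simp add: continuous_at_imp_continuous_on)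
qed

section \<open>Test functions and slopes of sup-convolutions\<close>

context horizontal_pair
begin

text \<open>The horizontal gradient of \<open>cost y\<close> at \<open>z\<close>, in closed form
  because its joint continuity in \<open>y\<close> and \<open>z\<close> is needed to pass to
  limits.\<close>

definition costG :: "heis \<times> real \<Rightarrow> heis \<times> real \<Rightarrow> real ^ 2" where
  "costG y z = (- 2 * (fst y $ 1 - fst z $ 1)) *\<^sub>R axis 1 1 + (- 2 * (fst y $ 2 - fst z $ 2)) *\<^sub>R axis 2 1 +
     (2 * (fst y $ 3 - fst z $ 3 - (fst y $ 1 * fst z $ 2 - fst z $ 1 * fst y $ 2) / 2)) *\<^sub>R
       (((fst z $ 2 + fst y $ 2) / 2) *\<^sub>R axis 1 1 + (- (fst z $ 1 + fst y $ 1) / 2) *\<^sub>R axis 2 1)"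

lemma continuous_costG:
  assumes "continuous_on S f" "continuous_on S g"
  shows "continuous_on S (\<lambda>x. costG (f x) (g x))"
  unfolding costG_def by (intro continuous_intros assms) auto

lemma cjet_cost: "\<exists>T L. cjet UNIV (cost y) T (costG y) L"
proof -
  have lin: "cjet UNIV (\<lambda>z. c + c1 * fst z $ 1 + c2 * fst z $ 2 + c3 * fst z $ 3) (\<lambda>_. 0)
     (\<lambda>z. c1 *\<^sub>R axis 1 1 + c2 *\<^sub>R axis 2 1 + c3 *\<^sub>R vector [- (fst z $ 2) / 2, fst z $ 1 / 2]) (\<lambda>_. 0)" for c c1 c2 c3
    using cjet_add[OF cjet_add[OF cjet_add[OF cjet_const[OF open_UNIV, of c]
        cjet_scale[OF cjet_nth(1)[OF open_UNIV], of c1]]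
        cjet_scale[OF cjet_nth(2)[OF open_UNIV], of c2]]
        cjet_scale[OF cjet_nth(3)[OF open_UNIV], of c3]] by simp
  note j1 = cjet_square[OF lin[of "fst y $ 1" "-1" 0 0]]
  note j2 = cjet_square[OF lin[of "fst y $ 2" 0 "-1" 0]]
  note j3 = cjet_square[OF lin[of "fst y $ 3" "fst y $ 2 / 2" "- fst y $ 1 / 2" "-1"]]
  note j4 = cjet_square[OF cjet_time[OF open_UNIV, of "-1" 0 "snd y"]]
  note full = cjet_add[OF cjet_add[OF cjet_add[OF j1 j2] j3] j4]
  have e: "cost y = (\<lambda>z. (fst y $ 1 + - 1 * fst z $ 1 + 0 * fst z $ 2 + 0 * fst z $ 3)\<^sup>2 +
     (fst y $ 2 + 0 * fst z $ 1 + - 1 * fst z $ 2 + 0 * fst z $ 3)\<^sup>2 +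
     (fst y $ 3 + fst y $ 2 / 2 * fst z $ 1 + (- fst y $ 1 / 2) * fst z $ 2 + - 1 * fst z $ 3)\<^sup>2 +
     (- 1 * (snd z - 0) + snd y)\<^sup>2)"
    unfolding cost_def by (simp add: algebra_simps diff_divide_distrib)
  show ?thesis
    unfolding e
    by (intro exI, rule cjet_cong[OF full refl _ refl])
      (simp add: costG_def vec_eq_iff forall_2, simp add: axis_def field_simps)
qed

lemma ltrans_inverse:
  "ltrans (heis_inv g) (- s) (ltrans g s z) = z" "ltrans g s (ltrans (heis_inv g) (- s) z) = z"
  by (simp_all add: ltrans_def prod_eq_iff vec_eq_iff forall_3) (simp_all add: field_simps)

lemma cost_ltrans: "cost (ltrans g s z) z = (g$1)\<^sup>2 + (g$2)\<^sup>2 + (g$3)\<^sup>2 + s\<^sup>2"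
proof -
  have "fst (ltrans g s z) $ 3 - fst z $ 3 - (fst (ltrans g s z) $ 1 * fst z $ 2 - fst z $ 1 * fst (ltrans g s z) $ 2) / 2 = g$3"
    by (simp add: ltrans_def field_simps)
  then have "cost (ltrans g s z) z = (fst (ltrans g s z) $ 1 - fst z $ 1)\<^sup>2 + (fst (ltrans g s z) $ 2 - fst z $ 2)\<^sup>2 +
     (g$3)\<^sup>2 + (snd (ltrans g s z) - snd z)\<^sup>2"
    by (simp only: cost_def)
  then show ?thesis by (simp add: ltrans_def)
qed

lemma ltrans_to: "ltrans (fst y \<cdot>\<^sub>H heis_inv (fst z)) (snd y - snd z) z = y"
  by (simp add: ltrans_def prod_eq_iff vec_eq_iff forall_3) (simp add: field_simps)

text \<open>Let \<open>S\<close> be the left translation from \<open>z\<close> to the maximizer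
  \<open>y\<close>. The cost between a point and its translate is constant, so a test function at
  \<open>z\<close> composed with the inverse of \<open>S\<close> tests \<open>u\<close> at
  \<open>y\<close>. The translation leaves the jet unchanged; only the base point in
  \<open>f\<close> moves.\<close>

lemma supconv_touch:
  assumes vs: "vsub f \<Omega> u" and K: "compact K" "K \<subseteq> \<Omega>" and u: "continuous_on K u"
    and y: "opt K n u z y" "y \<in> interior K"
    and cj: "cjet V \<phi> T G L" "z \<in> V" and m: "\<forall>\<^sub>F x in nhds z. supconv K n u x - \<phi> x \<le> supconv K n u z - \<phi> z"
  shows "T z - L z + f (fst y) (G z) \<le> 0"
proof -
  define g where "g = fst y \<cdot>\<^sub>H heis_inv (fst z)"
  define s where "s = snd y - snd z"
  define S where "S = ltrans g s"
  define S' where "S' = ltrans (heis_inv g) (- s)"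
  have S: "S z = y" by (simp add: S_def g_def s_def ltrans_to)
  have SS': "S' (S x) = x" "S (S' x) = x" for x by (simp_all add: S_def S'_def ltrans_inverse)
  have S'y: "S' y = z" using SS'(1)[of z] S by simp
  have Kne: "K \<noteq> {}" using y by (auto simp: opt_def)
  note att = supconv_attained[OF K(1) Kne u, of n]
  have cjS: "cjet (S' -` V) (\<phi> \<circ> S') (T \<circ> S') (G \<circ> S') (L \<circ> S')"
    unfolding S'_def by (rule cjet_ltrans[OF cj(1)])
  have "isCont S' y"
    unfolding S'_def by (rule has_derivative_continuous[OF ltrans_has_derivative])
  then have "filterlim S' (nhds z) (nhds y)"
    using S'y tendsto_at_iff_tendsto_nhds[of S' y] by (simp add: isCont_def)
  with m have "\<forall>\<^sub>F x in nhds y. supconv K n u (S' x) - \<phi> (S' x) \<le> supconv K n u z - \<phi> z"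
    by (rule eventually_compose_filterlim)
  moreover have "\<forall>\<^sub>F x in nhds y. x \<in> interior K"
    using y(2) by (intro eventually_nhds_in_open) auto
  ultimately have "\<forall>\<^sub>F x in nhds y. u x - (\<phi> \<circ> S') x \<le> u y - (\<phi> \<circ> S') y"
  proof eventually_elim
    case (elim x)
    have "x \<in> K" using elim(2) interior_subset by blast
    then have "u x - n * cost x (S' x) \<le> supconv K n u (S' x)" using att by blast
    moreover have "cost x (S' x) = cost y z"
      using cost_ltrans[of g s "S' x"] cost_ltrans[of g s z] SS'(2)[of x] S by (simp add: S_def)
    moreover have "supconv K n u z = u y - n * cost y z" using y(1) by (simp add: opt_def)
    ultimately show ?case using elim(1) S'y by simp
  qed
  moreover have "y \<in> \<Omega>" using y(1) K(2) by (auto simp: opt_def)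
  moreover have "y \<in> S' -` V" using S'y cj(2) by simp
  ultimately show ?thesis using vsubD[OF vs _ cjS, of y] S'y by simp
qed

text \<open>For a maximizer \<open>y\<close>, freezing it in the supremum gives the smooth function
  \<open>u y - n * cost y x\<close>, which touches the sup-convolution from below at
  \<open>z\<close>. Any test function from above then touches this one and shares its
  gradient.\<close>

lemma supconv_touch_gradient:
  assumes K: "compact K" and u: "continuous_on K u"
    and y: "opt K n u z y"
    and cj: "cjet V \<phi> T G L" "z \<in> V" and m: "\<forall>\<^sub>F x in nhds z. supconv K n u x - \<phi> x \<le> supconv K n u z - \<phi> z"
  shows "G z = (- n) *\<^sub>R costG y z"
proof -
  have Kne: "K \<noteq> {}" using y by (auto simp: opt_def)
  note att = supconv_attained[OF K Kne u, of n]
  obtain Tc Lc where c: "cjet UNIV (cost y) Tc (costG y) Lc" using cjet_cost by blast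
  have "\<forall>\<^sub>F x in nhds z. (- n) * cost y x - \<phi> x \<le> (- n) * cost y z - \<phi> z"
    using m
  proof eventually_elim
    case (elim x)
    have "u y - n * cost y x \<le> supconv K n u x" using att y by (auto simp: opt_def)
    moreover have "supconv K n u z = u y - n * cost y z" using y by (simp add: opt_def)
    ultimately show ?case using elim by simp
  qed
  from cjet_touch_gradient[OF cjet_scale[OF c, of "- n"] cj(1) _ cj(2) this]
  show ?thesis by simp
qed

text \<open>Since the supremum is attained on a compact set, the slopes of test functions at nearby points
  converge to the slope at \<open>z1\<close> as soon as the latter is unique.\<close>

lemma supconv_gradient_near:
  assumes K: "compact K" "K \<noteq> {}" and u: "continuous_on K u"
    and P: "\<And>y. opt K n u z1 y \<Longrightarrow> (- n) *\<^sub>R costG y z1 = P" and \<kappa>: "0 < \<kappa>"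
  shows "\<exists>d>0. \<forall>z y. dist z z1 < d \<longrightarrow> opt K n u z y \<longrightarrow> norm ((- n) *\<^sub>R costG y z - P) < \<kappa>"
proof (rule ccontr)
  assume "\<not> ?thesis"
  then have "\<forall>i. \<exists>z y. dist z z1 < inverse (real (Suc i)) \<and> opt K n u z y \<and> \<kappa> \<le> norm ((- n) *\<^sub>R costG y z - P)"
    by (metis inverse_positive_iff_positive not_less of_nat_0_less_iff zero_less_Suc)
  then obtain Z Y where ZY: "\<And>i. dist (Z i) z1 < inverse (real (Suc i))" "\<And>i. opt K n u (Z i) (Y i)"
      "\<And>i. \<kappa> \<le> norm ((- n) *\<^sub>R costG (Y i) (Z i) - P)" by metis
  have Z: "Z \<longlonglongrightarrow> z1"
    by (rule metric_tendsto_imp_tendsto[OF LIMSEQ_inverse_real_of_nat])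
      (use ZY(1) in \<open>auto simp: less_imp_le dist_real_def\<close>)
  have YK: "\<And>i. Y i \<in> K" using ZY(2) by (simp add: opt_def)
  then obtain y \<rho> where y: "y \<in> K" "strict_mono \<rho>" "(Y \<circ> \<rho>) \<longlonglongrightarrow> y"
    using K(1) unfolding compact_eq_seq_compact_metric seq_compact_def by metis
  have Z\<rho>: "(Z \<circ> \<rho>) \<longlonglongrightarrow> z1" using LIMSEQ_subseq_LIMSEQ[OF Z y(2)] .
  have pr: "(\<lambda>i. ((Y \<circ> \<rho>) i, (Z \<circ> \<rho>) i)) \<longlonglongrightarrow> (y, z1)" by (intro tendsto_Pair y Z\<rho>)
  have "(\<lambda>i. supconv K n u ((Z \<circ> \<rho>) i)) \<longlonglongrightarrow> supconv K n u z1"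
    using continuous_on_tendsto_compose[OF supconv_continuous[OF K u, of UNIV n] Z\<rho>] by simp
  moreover have "(\<lambda>i. u ((Y \<circ> \<rho>) i) - n * cost ((Y \<circ> \<rho>) i) ((Z \<circ> \<rho>) i)) \<longlonglongrightarrow> u y - n * cost y z1"
  proof (intro tendsto_intros)
    show "(\<lambda>i. u ((Y \<circ> \<rho>) i)) \<longlonglongrightarrow> u y"
      by (rule continuous_on_tendsto_compose[OF u y(3) y(1)]) (simp add: YK)
    have "continuous_on UNIV (\<lambda>x. cost (fst x) (snd x))" by (intro continuous_intros)
    from continuous_on_tendsto_compose[OF this pr]
    show "(\<lambda>i. cost ((Y \<circ> \<rho>) i) ((Z \<circ> \<rho>) i)) \<longlonglongrightarrow> cost y z1" by simp
  qed
  moreover have "supconv K n u ((Z \<circ> \<rho>) i) = u ((Y \<circ> \<rho>) i) - n * cost ((Y \<circ> \<rho>) i) ((Z \<circ> \<rho>) i)" for i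
    using ZY(2) by (simp add: opt_def)
  ultimately have "supconv K n u z1 = u y - n * cost y z1"
    using LIMSEQ_unique by fastforce
  then have "opt K n u z1 y" using y(1) by (simp add: opt_def)
  from P[OF this] have Py: "(- n) *\<^sub>R costG y z1 - P = 0" by simp
  have "continuous_on UNIV (\<lambda>x. norm ((- n) *\<^sub>R costG (fst x) (snd x) - P))"
    by (intro continuous_intros continuous_costG)
  from continuous_on_tendsto_compose[OF this pr]
  have "(\<lambda>i. norm ((- n) *\<^sub>R costG ((Y \<circ> \<rho>) i) ((Z \<circ> \<rho>) i) - P)) \<longlonglongrightarrow> 0" using Py by simp
  then have "\<kappa> \<le> 0"
    by (rule LIMSEQ_le_const) (use ZY(3) in auto)
  with \<kappa> show False by simp
qed

text \<open>One \<open>\<eta>\<close> pays for replacing the slope by \<open>P\<close>, using the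
  Lipschitz bound, and one for replacing the base point by \<open>fst z1\<close>, using the modulus.
  The result is an equation with constant right-hand side.\<close>

lemma supconv_vsub_const:
  assumes vs: "vsub f \<Omega> u" and K: "compact K" "K \<subseteq> \<Omega>" and ne: "K \<noteq> {}" and u: "continuous_on K u"
    and P: "\<And>y. opt K n u z1 y \<Longrightarrow> (- n) *\<^sub>R costG y z1 = P"
    and \<delta>: "0 < \<delta>" and r: "0 < r"
    and near: "\<And>z y. dist z z1 < r \<Longrightarrow> opt K n u z y \<Longrightarrow> y \<in> interior K \<and> dist z y < \<delta>"
    and Lip: "\<And>p w w'. \<bar>f p w - f p w'\<bar> \<le> Lf * norm (w - w')" and Lf: "0 \<le> Lf"
    and mod: "\<And>y w. y \<in> K \<Longrightarrow> dist y z1 < 2 * \<delta> \<Longrightarrow> \<bar>f (fst y) w - f (fst z1) w\<bar> \<le> \<eta>" and \<eta>: "0 < \<eta>"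
  shows "\<exists>d>0. \<forall>d'. 0 < d' \<longrightarrow> d' \<le> d \<longrightarrow> vsub (\<lambda>_ _. f (fst z1) P - 2 * \<eta>) (ball z1 d') (supconv K n u)"
proof -
  note att = supconv_attained[OF K(1) ne u, of n]
  \<comment> \<open>Adding 1 keeps the quotient meaningful when \<open>Lf = 0\<close>.\<close>
  have "0 < \<eta> / (Lf + 1)" using \<eta> Lf by simp
  from supconv_gradient_near[OF K(1) ne u P this]
  obtain d where d: "d > 0" "\<And>z y. dist z z1 < d \<Longrightarrow> opt K n u z y \<Longrightarrow> norm ((- n) *\<^sub>R costG y z - P) < \<eta> / (Lf + 1)"
    by blast
  show ?thesis
  proof (intro exI[of _ "min d (min r \<delta>)"] conjI allI impI)
    fix d' assume d': "0 < d'" "d' \<le> min d (min r \<delta>)"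
    show "vsub (\<lambda>_ _. f (fst z1) P - 2 * \<eta>) (ball z1 d') (supconv K n u)"
      unfolding vsub_def
    proof (intro ballI allI impI)
      fix z \<phi> V T G L
      assume z: "z \<in> ball z1 d'" "z \<in> V" and cj: "cjet V \<phi> T G L"
        and m: "\<forall>\<^sub>F x in nhds z. supconv K n u x - \<phi> x \<le> supconv K n u z - \<phi> z"
      have zz: "dist z z1 < d" "dist z z1 < r" "dist z z1 < \<delta>" using z(1) d'(2) by (auto simp: dist_commute)
      obtain y where y: "opt K n u z y" using att by blast
      have yK: "y \<in> K" using y by (simp add: opt_def)
      have yi: "y \<in> interior K" "dist z y < \<delta>" using near[OF zz(2) y] by auto
      have 1: "T z - L z + f (fst y) (G z) \<le> 0"
        by (rule supconv_touch[OF vs K u y yi(1) cj z(2) m])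
      have "G z = (- n) *\<^sub>R costG y z" by (rule supconv_touch_gradient[OF K(1) u y cj z(2) m])
      then have "norm (G z - P) < \<eta> / (Lf + 1)" using d(2)[OF zz(1) y] by simp
      then have "(Lf + 1) * norm (G z - P) \<le> \<eta>" using Lf by (simp add: pos_less_divide_eq mult.commute less_imp_le)
      then have "Lf * norm (G z - P) \<le> \<eta>" using norm_ge_zero[of "G z - P"] unfolding distrib_right mult_1 by linarith
      then have 2: "\<bar>f (fst z1) (G z) - f (fst z1) P\<bar> \<le> \<eta>" using Lip[of "fst z1" "G z" P] by linarith
      have "dist y z1 < 2 * \<delta>" using dist_triangle[of y z1 z] yi(2) zz(3) by (simp add: dist_commute)
      from mod[OF yK this, of "G z"] 1 2 show "T z - L z + (f (fst z1) P - 2 * \<eta>) \<le> 0" by linarith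
    qed
  qed (use d r \<delta> in auto)
qed


text \<open>A penalty that makes a maximum strict without changing the first and second order data
  there. The distance itself is not smooth; its fourth power is the square of a smooth function
  vanishing at \<open>z0\<close>.\<close>

lemma cjet_quartic:
  fixes z0 :: "heis \<times> real"
  shows "\<exists>T G L. cjet UNIV (\<lambda>z. (dist z0 z) ^ 4) T G L \<and> T z0 = 0 \<and> G z0 = 0 \<and> L z0 = 0"
proof -
  obtain \<Lambda> G L where cj: "cjet UNIV (\<lambda>z. (dist (fst z0) (fst z))\<^sup>2) (\<lambda>_. 0) G L"
     and bd: "\<And>z. dist (fst z0) (fst z) \<le> 1 \<Longrightarrow> gam (G z) (G z) \<le> 2 * \<Lambda> * (dist (fst z0) (fst z))\<^sup>2"
    using cjet_dist_square[of "fst z0" 1] by blast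
  have e: "(dist z0 z) ^ 4 = ((dist (fst z0) (fst z))\<^sup>2 + (1 * (snd z - snd z0) + 0)\<^sup>2)\<^sup>2" for z
  proof -
    have "(dist z0 z)\<^sup>2 = (dist (fst z0) (fst z))\<^sup>2 + (1 * (snd z - snd z0) + 0)\<^sup>2"
      by (simp add: dist_prod_def dist_real_def power2_commute)
    then have "((dist z0 z)\<^sup>2)\<^sup>2 = ((dist (fst z0) (fst z))\<^sup>2 + (1 * (snd z - snd z0) + 0)\<^sup>2)\<^sup>2" by simp
    then show ?thesis by simp
  qed
  have "gam (G z0) (G z0) \<le> 0" using bd[of z0] by simp
  moreover have "gam (G z0) (G z0) \<ge> 0" by (simp add: gam_def)
  ultimately have g0: "gam (G z0) (G z0) = 0" by simp
  show ?thesis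
    unfolding e
    by (intro exI conjI, rule cjet_square[OF cjet_add[OF cj cjet_square[OF cjet_time[OF open_UNIV]]]])
      (simp_all add: g0)
qed

text \<open>Uniform continuity on a bounded set, where the quantity vanishes on the diagonal; (A2)
  thereby becomes a modulus for the Euclidean distance.\<close>

lemma koranyi_close:
  assumes "0 < \<epsilon>"
  shows "\<exists>d>0. \<forall>p q. norm p \<le> \<rho> \<longrightarrow> norm q \<le> \<rho> \<longrightarrow> dist p q < d \<longrightarrow> koranyi (p \<cdot>\<^sub>H heis_inv q) < \<epsilon>"
proof -
  define B where "B = cball (0::heis) \<rho> \<times> cball (0::heis) \<rho>"
  define k where "k x = koranyi (fst x \<cdot>\<^sub>H heis_inv (snd x))" for x
  have "continuous_on B k"
    unfolding k_def koranyi_def heis_mult_nth heis_inv_nth by (intro continuous_intros)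
  moreover have "compact B" unfolding B_def by (intro compact_Times compact_cball)
  ultimately have "uniformly_continuous_on B k" by (rule compact_uniformly_continuous)
  then obtain d where d: "d > 0" "\<And>x x'. x \<in> B \<Longrightarrow> x' \<in> B \<Longrightarrow> dist x' x < d \<Longrightarrow> dist (k x') (k x) < \<epsilon>"
    using assms unfolding uniformly_continuous_on_def by metis
  have k0: "k (q, q) = 0" for q by (simp add: k_def koranyi_def)
  have "koranyi (p \<cdot>\<^sub>H heis_inv q) < \<epsilon>" if "norm p \<le> \<rho>" "norm q \<le> \<rho>" "dist p q < d" for p q
    using d(2)[of "(q, q)" "(p, q)"] that k0[of q] by (simp add: B_def dist_Pair_Pair k_def dist_real_def abs_less_iff)
  then show ?thesis using d(1) by blast
qed

text \<open>The inequality is shown up to \<open>4 * \<eta>\<close> at points \<open>z1\<close>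
  converging to \<open>z0\<close>, where the regularized sum is touched, and passes to the limit by
  continuity of \<open>E\<close>.\<close>

lemma vsub_sum:
  assumes cu: "continuous_on (UNIV \<times> {0<..}) u" and cv: "continuous_on (UNIV \<times> {0<..}) v"
    and vu: "vsub f1 (UNIV \<times> {0<..}) u" and vv: "vsub f2 (UNIV \<times> {0<..}) v" and L1: "0 \<le> L1"
    and Lip1: "\<And>p w w'. \<bar>f1 p w - f1 p w'\<bar> \<le> L1 * norm (w - w')"
    and Lip2: "\<And>p w w'. \<bar>f2 p w - f2 p w'\<bar> \<le> L1 * norm (w - w')"
    and mod1: "\<And>\<rho>. \<rho> > 0 \<Longrightarrow> \<exists>C>0. \<forall>p q w. norm p \<le> \<rho> \<longrightarrow> norm q \<le> \<rho> \<longrightarrow> \<bar>f1 p w - f1 q w\<bar> \<le> C * koranyi (p \<cdot>\<^sub>H heis_inv q)"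
    and mod2: "\<And>\<rho>. \<rho> > 0 \<Longrightarrow> \<exists>C>0. \<forall>p q w. norm p \<le> \<rho> \<longrightarrow> norm q \<le> \<rho> \<longrightarrow> \<bar>f2 p w - f2 q w\<bar> \<le> C * koranyi (p \<cdot>\<^sub>H heis_inv q)"
    and comb: "\<And>p w w'. - L1 * norm (w + w') \<le> f1 p w + f2 p w'"
  shows "vsub (\<lambda>_ w. - L1 * norm w) (UNIV \<times> {0<..}) (\<lambda>z. u z + v z)"
  unfolding vsub_def
proof (intro ballI allI impI)
  fix z0 \<phi> V T G L
  assume z0: "z0 \<in> UNIV \<times> {0<..}" "z0 \<in> V" and cj: "cjet V \<phi> T G L"
    and m: "\<forall>\<^sub>F z in nhds z0. u z + v z - \<phi> z \<le> u z0 + v z0 - \<phi> z0"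
  let ?\<Omega> = "UNIV \<times> {0<..} :: (heis \<times> real) set"
  obtain TQ GQ LQ where Q: "cjet UNIV (\<lambda>z. (dist z0 z) ^ 4) TQ GQ LQ" "TQ z0 = 0" "GQ z0 = 0" "LQ z0 = 0"
    using cjet_quartic[of z0] by blast
  define \<psi> where "\<psi> z = \<phi> z + (dist z0 z) ^ 4" for z
  have cj\<psi>: "cjet V \<psi> (\<lambda>z. T z + TQ z) (\<lambda>z. G z + GQ z) (\<lambda>z. L z + LQ z)"
    unfolding \<psi>_def by (intro cjet_add cj cjet_subset[OF Q(1)] cjet_open[OF cj]) auto
  define E where "E z = (T z + TQ z) - (L z + LQ z) - L1 * norm (G z + GQ z)" for z
  have cE: "continuous_on V E"
    unfolding E_def
    by (intro continuous_on_diff continuous_on_mult continuous_on_const continuous_on_norm cjet_continuous[OF cj\<psi>])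
  obtain O' where O': "open O'" "z0 \<in> O'" "\<And>z. z \<in> O' \<Longrightarrow> u z + v z - \<phi> z \<le> u z0 + v z0 - \<phi> z0"
    using m unfolding eventually_nhds by blast
  have "open (V \<inter> ?\<Omega> \<inter> O')" by (intro open_Int cjet_open[OF cj] open_Times O') auto
  moreover have "z0 \<in> V \<inter> ?\<Omega> \<inter> O'" using z0 O' by blast
  ultimately obtain r' where r': "r' > 0" "cball z0 r' \<subseteq> V \<inter> ?\<Omega> \<inter> O'" by (meson open_contains_cball)
  define r where "r = r' / 2"
  define K where "K = cball z0 (2 * r)"
  have r: "r > 0" using r'(1) by (simp add: r_def)
  have KV: "K \<subseteq> V" "K \<subseteq> ?\<Omega>" "K \<subseteq> O'" using r'(2) by (auto simp: K_def r_def)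
  have K: "compact K" "K \<noteq> {}" using r by (auto simp: K_def)
  have intK: "interior K = ball z0 (2 * r)" by (simp add: K_def interior_cball)
  have cuK: "continuous_on K u" and cvK: "continuous_on K v"
    using continuous_on_subset[OF cu KV(2)] continuous_on_subset[OF cv KV(2)] by auto
  have key: "\<exists>z1. dist z0 z1 < \<eta> \<and> z1 \<in> K \<and> E z1 \<le> 4 * \<eta>" if \<eta>: "0 < \<eta>" "\<eta> < r" for \<eta>
  proof -
    have bdd: "\<exists>M. \<forall>z\<in>K. \<bar>w z\<bar> \<le> M" if "continuous_on K w" for w :: "heis \<times> real \<Rightarrow> real"
    proof -
      have "bounded (w ` K)" using compact_imp_bounded[OF compact_continuous_image[OF that K(1)]] .
      then show ?thesis by (auto simp: bounded_iff)
    qed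
    obtain Mu Mv where "\<forall>z\<in>K. \<bar>u z\<bar> \<le> Mu" "\<forall>z\<in>K. \<bar>v z\<bar> \<le> Mv" using bdd[OF cuK] bdd[OF cvK] by blast
    then obtain M where M: "M > 0" "\<And>z. z \<in> K \<Longrightarrow> \<bar>u z\<bar> \<le> M" "\<And>z. z \<in> K \<Longrightarrow> \<bar>v z\<bar> \<le> M"
      by (intro that[of "max 1 (max Mu Mv)"]) (auto simp: le_max_iff_disj)
    \<comment> \<open>Replacing \<open>u\<close> and \<open>v\<close> by their sup-convolutions
      changes the sum by at most \<open>2 * \<omega> < \<eta> ^ 4\<close>, so the quartic penalty
      keeps \<open>z1\<close> within \<open>\<eta>\<close> of \<open>z0\<close>.\<close>
    define \<omega> where "\<omega> = \<eta> ^ 4 / 4"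
    have \<omega>: "\<omega> > 0" using \<eta> by (simp add: \<omega>_def)
    obtain du where du: "du > 0" "\<And>z z'. z \<in> K \<Longrightarrow> z' \<in> K \<Longrightarrow> dist z' z < du \<Longrightarrow> dist (u z') (u z) < \<omega>"
      using compact_uniformly_continuous[OF cuK K(1)] \<omega> unfolding uniformly_continuous_on_def by metis
    obtain dv where dv: "dv > 0" "\<And>z z'. z \<in> K \<Longrightarrow> z' \<in> K \<Longrightarrow> dist z' z < dv \<Longrightarrow> dist (v z') (v z) < \<omega>"
      using compact_uniformly_continuous[OF cvK K(1)] \<omega> unfolding uniformly_continuous_on_def by metis
    define \<rho> where "\<rho> = norm z0 + 2 * r"
    have \<rho>: "\<rho> > 0" using r norm_ge_zero[of z0] unfolding \<rho>_def by linarith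
    have f\<rho>: "norm (fst z) \<le> \<rho>" if "z \<in> K" for z
    proof -
      have "norm z \<le> \<rho>" using that norm_triangle_sub[of z z0] by (simp add: K_def \<rho>_def dist_norm norm_minus_commute)
      moreover have "norm (fst z) \<le> norm z" by (metis norm_fst_le prod.collapse)
      ultimately show ?thesis by simp
    qed
    obtain C1 where C1: "C1 > 0" "\<And>p q w. norm p \<le> \<rho> \<Longrightarrow> norm q \<le> \<rho> \<Longrightarrow> \<bar>f1 p w - f1 q w\<bar> \<le> C1 * koranyi (p \<cdot>\<^sub>H heis_inv q)"
      using mod1[OF \<rho>] by blast
    obtain C2 where C2: "C2 > 0" "\<And>p q w. norm p \<le> \<rho> \<Longrightarrow> norm q \<le> \<rho> \<Longrightarrow> \<bar>f2 p w - f2 q w\<bar> \<le> C2 * koranyi (p \<cdot>\<^sub>H heis_inv q)"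
      using mod2[OF \<rho>] by blast
    have "0 < \<eta> / max C1 C2" using \<eta> C1(1) by simp
    from koranyi_close[OF this, of \<rho>]
    obtain dk where dk: "dk > 0" "\<And>p q. norm p \<le> \<rho> \<Longrightarrow> norm q \<le> \<rho> \<Longrightarrow> dist p q < dk \<Longrightarrow> koranyi (p \<cdot>\<^sub>H heis_inv q) < \<eta> / max C1 C2"
      by blast
    have kk: "C * koranyi (p \<cdot>\<^sub>H heis_inv q) \<le> \<eta>" if "norm p \<le> \<rho>" "norm q \<le> \<rho>" "dist p q < dk" "C \<le> max C1 C2" for p q C
    proof -
      have "koranyi (p \<cdot>\<^sub>H heis_inv q) \<ge> 0" by (simp add: koranyi_def)
      then have "C * koranyi (p \<cdot>\<^sub>H heis_inv q) \<le> max C1 C2 * koranyi (p \<cdot>\<^sub>H heis_inv q)"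
        using that(4) by (rule mult_right_mono[rotated])
      also have "\<dots> \<le> \<eta>" using dk(2)[OF that(1-3)] C1(1)
        by (simp add: pos_less_divide_eq mult.commute less_imp_le less_max_iff_disj)
      finally show ?thesis .
    qed
    \<comment> \<open>\<open>du\<close> and \<open>dv\<close> control the regularization error,
      \<open>dk / 2\<close> the modulus of (A2) at distance \<open>2 * \<delta>\<close>, and
      \<open>r\<close> keeps the maximizers inside \<open>K\<close>.\<close>
    define \<delta> where "\<delta> = min (min du dv) (min (dk / 2) r)"
    have \<delta>: "\<delta> > 0" "\<delta> \<le> du" "\<delta> \<le> dv" "2 * \<delta> \<le> dk" "\<delta> \<le> r" using du dv dk r by (auto simp: \<delta>_def)
    obtain \<kappa> where \<kappa>: "\<kappa> > 0" "\<And>y z. y \<in> K \<Longrightarrow> z \<in> K \<Longrightarrow> cost y z < \<kappa> \<Longrightarrow> dist y z < \<delta>"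
      using compact_cost_close[OF K(1) \<delta>(1)] by blast
    \<comment> \<open>The value at a maximizer is no worse than at \<open>z\<close> itself, so its
      penalty is at most \<open>2 * M\<close>; this \<open>n\<close> forces its cost below
      \<open>\<kappa>\<close>.\<close>
    define n where "n = 2 * M / \<kappa> + 1"
    have n: "n > 0" "2 * M < n * \<kappa>" using M(1) \<kappa>(1) by (auto simp: n_def field_simps add_pos_pos)
    have optclose: "dist y z < \<delta>" if w: "continuous_on K w" "\<And>z. z \<in> K \<Longrightarrow> \<bar>w z\<bar> \<le> M" and y: "opt K n w z y" "z \<in> K" for w y z
    proof -
      have "w z - n * cost z z \<le> supconv K n w z" using supconv_attained[OF K w(1)] y(2) by blast
      moreover have "supconv K n w z = w y - n * cost y z" "y \<in> K" using y(1) by (auto simp: opt_def)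
      ultimately have "n * cost y z \<le> 2 * M" using w(2)[of y] w(2)[OF y(2)] by simp
      then have "n * cost y z < n * \<kappa>" using n(2) by simp
      then have "cost y z < \<kappa>" using n(1) by simp
      then show ?thesis using \<kappa>(2) y(2) \<open>y \<in> K\<close> by blast
    qed
    define U where "U = supconv K n u"
    define W where "W = supconv K n v"
    have attU: "(\<exists>y. opt K n u z y) \<and> (\<forall>y\<in>K. u y - n * cost y z \<le> U z)" for z
      unfolding U_def by (rule supconv_attained[OF K cuK])
    have attW: "(\<exists>y. opt K n v z y) \<and> (\<forall>y\<in>K. v y - n * cost y z \<le> W z)" for z
      unfolding W_def by (rule supconv_attained[OF K cvK])
    have lower: "u z \<le> U z" "v z \<le> W z" if "z \<in> K" for z
      using attU[of z] attW[of z] that by force+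
    have upper: "U z \<le> u z + \<omega>" "W z \<le> v z + \<omega>" if z: "z \<in> K" for z
    proof -
      obtain y where y: "opt K n u z y" using attU by blast
      then have "U z \<le> u y" "y \<in> K" using n(1) cost_nonneg[of y z] by (auto simp: opt_def U_def)
      moreover have "dist (u y) (u z) < \<omega>"
        using du(2)[OF z \<open>y \<in> K\<close>] optclose[OF cuK M(2) y z] \<delta>(2) by linarith
      ultimately show "U z \<le> u z + \<omega>" by (simp add: dist_real_def abs_less_iff)
      obtain y where y: "opt K n v z y" using attW by blast
      then have "W z \<le> v y" "y \<in> K" using n(1) cost_nonneg[of y z] by (auto simp: opt_def W_def)
      moreover have "dist (v y) (v z) < \<omega>"
        using dv(2)[OF z \<open>y \<in> K\<close>] optclose[OF cvK M(3) y z] \<delta>(3) by linarith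
      ultimately show "W z \<le> v z + \<omega>" by (simp add: dist_real_def abs_less_iff)
    qed
    have cUW: "continuous_on S U" "continuous_on S W" for S
      unfolding U_def W_def by (intro supconv_continuous K cuK cvK)+
    have c\<psi>: "continuous_on K \<psi>" by (rule continuous_on_subset[OF cjet_continuous(1)[OF cj\<psi>] KV(1)])
    have "\<exists>z1\<in>K. \<forall>z\<in>K. U z + W z - \<psi> z \<le> U z1 + W z1 - \<psi> z1"
      by (intro continuous_attains_sup K continuous_intros cUW c\<psi>)
    then obtain z1 where z1: "z1 \<in> K" "\<And>z. z \<in> K \<Longrightarrow> U z + W z - \<psi> z \<le> U z1 + W z1 - \<psi> z1" by blast
    have z0K: "z0 \<in> K" using r by (simp add: K_def)
    have "(dist z0 z1) ^ 4 \<le> 2 * \<omega>"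
      using z1(2)[OF z0K] lower[OF z0K] upper[OF z1(1)] O'(3)[of z1] z1(1) KV(3) by (auto simp: \<psi>_def)
    also have "\<dots> < \<eta> ^ 4" using \<eta> by (simp add: \<omega>_def)
    finally have dz1: "dist z0 z1 < \<eta>" using \<eta> by (simp add: power_less_imp_less_base)
    have ballK: "z \<in> K" if "dist z z1 < r" for z
      using that dz1 \<eta>(2) dist_triangle[of z0 z z1] by (simp add: K_def dist_commute)
    have near: "y \<in> interior K \<and> dist z y < \<delta>"
      if w: "continuous_on K w" "\<And>z. z \<in> K \<Longrightarrow> \<bar>w z\<bar> \<le> M" and z: "dist z z1 < r - \<eta>" and y: "opt K n w z y" for w z y
    proof -
      have d: "dist y z < \<delta>" using optclose[OF w y] ballK[of z] z \<eta> by simp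
      have "dist z0 y \<le> dist z0 z1 + dist z1 z + dist z y"
        using dist_triangle[of z0 y z1] dist_triangle[of z1 y z] by linarith
      also have "\<dots> < 2 * r" using dz1 z d \<delta>(5) \<eta> by (simp add: dist_commute)
      finally show ?thesis using d by (simp add: intK dist_commute)
    qed
    have evK: "\<forall>\<^sub>F z in nhds z1. z \<in> K"
      using eventually_nhds_in_open[OF open_ball, of z1 z1 r] r
      by (auto elim!: eventually_mono intro: ballK simp: dist_commute)
    obtain yu yv where yu: "opt K n u z1 yu" and yv: "opt K n v z1 yv" using attU attW by blast
    define P where "P = (- n) *\<^sub>R costG yu z1"
    define P' where "P' = (- n) *\<^sub>R costG yv z1"
    have z1V: "z1 \<in> V" using z1(1) KV(1) by blast
    \<comment> \<open>Freezing a maximizer \<open>y'\<close> for \<open>v\<close> bounds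
      \<open>W\<close> from below by a smooth function, so \<open>\<psi>\<close> plus a multiple of
      the cost touches \<open>U\<close> from above at \<open>z1\<close>. Its gradient must agree
      with the slope from every maximizer \<open>y\<close> for \<open>u\<close>. As the sum is the
      same for all pairs, each of the two slopes is unique.\<close>
    have slope: "(- n) *\<^sub>R costG y z1 + (- n) *\<^sub>R costG y' z1 = G z1 + GQ z1"
      if y: "opt K n u z1 y" and y': "opt K n v z1 y'" for y y'
    proof -
      obtain Tc Lc where c: "cjet UNIV (cost y') Tc (costG y') Lc" using cjet_cost by blast
      note cc = cjet_add[OF cj\<psi> cjet_scale[OF cjet_subset[OF c cjet_open[OF cj]], of n]]
      have "\<forall>\<^sub>F z in nhds z1. supconv K n u z - (\<psi> z + n * cost y' z) \<le> supconv K n u z1 - (\<psi> z1 + n * cost y' z1)"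
        using evK
      proof eventually_elim
        case (elim z)
        have "v y' - n * cost y' z \<le> W z" using attW y' by (auto simp: opt_def)
        moreover have "W z1 = v y' - n * cost y' z1" using y' by (simp add: opt_def W_def)
        ultimately show ?case using z1(2)[OF elim] by (simp add: U_def)
      qed
      from supconv_touch_gradient[OF K(1) cuK y cc z1V this, symmetric]
      show ?thesis by simp
    qed
    have PP: "P + P' = G z1 + GQ z1" unfolding P_def P'_def by (rule slope[OF yu yv])
    have uniq: "(- n) *\<^sub>R costG y z1 = P" if "opt K n u z1 y" for y
      using slope[OF that yv] PP unfolding P'_def by (metis add_right_cancel)
    have uniq': "(- n) *\<^sub>R costG y z1 = P'" if "opt K n v z1 y" for y
      using slope[OF yu that] PP unfolding P_def by (metis add_left_cancel)
    have z1\<rho>: "norm (fst z1) \<le> \<rho>" by (rule f\<rho>[OF z1(1)])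
    have dfst: "dist (fst y) (fst z1) < dk" if "dist y z1 < 2 * \<delta>" for y
      using that \<delta>(4) dist_fst_le[of y z1] by linarith
    have m1: "\<bar>f1 (fst y) w - f1 (fst z1) w\<bar> \<le> \<eta>" if "y \<in> K" "dist y z1 < 2 * \<delta>" for y w
      using order_trans[OF C1(2)[OF f\<rho>[OF that(1)] z1\<rho>] kk[OF f\<rho>[OF that(1)] z1\<rho> dfst[OF that(2)]]] by simp
    have m2: "\<bar>f2 (fst y) w - f2 (fst z1) w\<bar> \<le> \<eta>" if "y \<in> K" "dist y z1 < 2 * \<delta>" for y w
      using order_trans[OF C2(2)[OF f\<rho>[OF that(1)] z1\<rho>] kk[OF f\<rho>[OF that(1)] z1\<rho> dfst[OF that(2)]]] by simp
    have r\<eta>: "0 < r - \<eta>" using \<eta> by simp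
    obtain d1 where d1: "d1 > 0" "\<And>d'. 0 < d' \<Longrightarrow> d' \<le> d1 \<Longrightarrow> vsub (\<lambda>_ _. f1 (fst z1) P - 2 * \<eta>) (ball z1 d') U"
      using supconv_vsub_const[OF vu K(1) KV(2) K(2) cuK uniq \<delta>(1) r\<eta> near[OF cuK M(2)] Lip1 L1 m1 \<eta>(1)]
      unfolding U_def by blast
    obtain d2 where d2: "d2 > 0" "\<And>d'. 0 < d' \<Longrightarrow> d' \<le> d2 \<Longrightarrow> vsub (\<lambda>_ _. f2 (fst z1) P' - 2 * \<eta>) (ball z1 d') W"
      using supconv_vsub_const[OF vv K(1) KV(2) K(2) cvK uniq' \<delta>(1) r\<eta> near[OF cvK M(3)] Lip2 L1 m2 \<eta>(1)]
      unfolding W_def by blast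
    define d where "d = min (min d1 d2) r"
    have d: "d > 0" "d \<le> d1" "d \<le> d2" "d \<le> r" using d1(1) d2(1) r by (auto simp: d_def)
    have bK: "ball z1 d \<subseteq> K" using ballK d(4) by (auto simp: dist_commute)
    \<comment> \<open>Both sup-convolutions now satisfy equations with constant right-hand sides
      near \<open>z1\<close>; each has lost \<open>2 * \<eta>\<close>, which is the source of
      \<open>4 * \<eta>\<close>.\<close>
    have "T z1 + TQ z1 - (L z1 + LQ z1) + (f1 (fst z1) P - 2 * \<eta>) + (f2 (fst z1) P' - 2 * \<eta>) \<le> 0"
      by (rule vsub_linear_sum[OF open_ball _ cUW d1(2)[OF d(1,2)] d2(2)[OF d(1,3)] cjet_subset[OF cj\<psi> open_ball]])
        (use d(1) bK KV(1) z1(2) in auto)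
    moreover have "- L1 * norm (G z1 + GQ z1) \<le> f1 (fst z1) P + f2 (fst z1) P'"
      using comb[of P P' "fst z1"] by (simp add: PP)
    ultimately have "E z1 \<le> 4 * \<eta>" by (simp add: E_def)
    with dz1 z1(1) show ?thesis by blast
  qed
  have "E z0 \<le> 0"
  proof (rule ccontr)
    assume "\<not> E z0 \<le> 0"
    then have pos: "E z0 > 0" by simp
    have "isCont E z0" using cE z0(2) cjet_open[OF cj] by (simp add: continuous_on_eq_continuous_at)
    then obtain d where d: "d > 0" "\<And>z. dist z z0 < d \<Longrightarrow> dist (E z) (E z0) < E z0 / 2"
      unfolding continuous_at_eps_delta using pos by (metis half_gt_zero)
    define \<eta> where "\<eta> = min (min d (r / 2)) (E z0 / 16)"
    have "0 < \<eta>" "\<eta> < r" using d(1) r pos by (auto simp: \<eta>_def)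
    from key[OF this] obtain z1 where z1: "dist z0 z1 < \<eta>" "E z1 \<le> 4 * \<eta>" by blast
    have "dist (E z1) (E z0) < E z0 / 2" using d(2)[of z1] z1(1) by (simp add: \<eta>_def dist_commute)
    then have "\<bar>E z1 - E z0\<bar> < E z0 / 2" by (simp add: dist_real_def)
    then have "E z1 > E z0 / 2" by linarith
    moreover have "4 * \<eta> \<le> E z0 / 4" by (simp add: \<eta>_def)
    ultimately show False using z1(2) pos by linarith
  qed
  then show "T z0 - L z0 + - L1 * norm (G z0) \<le> 0" using Q by (simp add: E_def)
qed

end

section \<open>Growth at infinity and uniqueness\<close>

text \<open>Cholesky factorization: \<open>a\<close> and \<open>b\<close> are the columns of the
  lower triangular factor. A vanishing first diagonal entry forces the off-diagonal entry to
  vanish.\<close>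

lemma symmetric_psd_rank_one_sum:
  fixes A :: "real ^ 2 ^ 2"
  assumes "symmetric_psd A"
  shows "\<exists>a b. \<forall>i j. A $ i $ j = a $ i * a $ j + b $ i * b $ j"
proof -
  have sym: "A $ 2 $ 1 = A $ 1 $ 2"
  proof -
    have "transpose A $ 1 $ 2 = A $ 1 $ 2" using assms by (simp add: symmetric_psd_def)
    then show ?thesis by (simp add: transpose_def)
  qed
  have q: "0 \<le> A$1$1 * x\<^sup>2 + 2 * (A$1$2 * x * y) + A$2$2 * y\<^sup>2" for x y
  proof -
    have "0 \<le> vector [x, y] \<bullet> (A *v vector [x, y])" using assms by (simp add: symmetric_psd_def)
    then show ?thesis
      by (simp add: inner_vec_def matrix_vector_mult_def sum_2 sym power2_eq_square algebra_simps)
  qed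
  have p11: "A$1$1 \<ge> 0" and p22: "A$2$2 \<ge> 0" using q[of 1 0] q[of 0 1] by auto
  show ?thesis
  proof (cases "A$1$1 = 0")
    case True
    have "A$1$2 = 0"
    proof (rule ccontr)
      assume ne: "A$1$2 \<noteq> 0"
      \<comment> \<open>The argument is chosen so that the quadratic form would take the value
        -1.\<close>
      have "2 * (A$1$2 * (- (A$2$2 + 1) / (2 * A$1$2)) * 1) = - (A$2$2 + 1)" using ne by simp
      then show False using q[of "- (A$2$2 + 1) / (2 * A$1$2)" 1] True by simp
    qed
    then show ?thesis
      using True sym p22
      by (intro exI[of _ "vector [0, sqrt (A$2$2)]"] exI[of _ 0]) (simp add: forall_2)
  next
    case False
    then have pos: "A$1$1 > 0" using p11 by simp
    have "0 \<le> A$1$1 * (A$1$1 * A$2$2 - (A$1$2)\<^sup>2)"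
      using q[of "- A$1$2" "A$1$1"] by (simp add: power2_eq_square algebra_simps)
    then have "(A$1$2)\<^sup>2 \<le> A$1$1 * A$2$2" using pos by (simp add: zero_le_mult_iff)
    then have d: "0 \<le> A$2$2 - (A$1$2)\<^sup>2 / A$1$1" using pos by (simp add: field_simps)
    have s: "sqrt (A$1$1) * sqrt (A$1$1) = A$1$1" "sqrt (A$1$1) \<noteq> 0" using pos by auto
    have "A$1$2 / sqrt (A$1$1) * (A$1$2 / sqrt (A$1$1)) = (A$1$2)\<^sup>2 / A$1$1"
      using s by (simp add: power2_eq_square)
    then show ?thesis
      using pos sym d s
      by (intro exI[of _ "vector [sqrt (A$1$1), A$1$2 / sqrt (A$1$1)]"]
          exI[of _ "vector [0, sqrt (A$2$2 - (A$1$2)\<^sup>2 / A$1$1)]"])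
        (simp add: forall_2)
  qed
qed

text \<open>The coordinate bounds express the anisotropic weights 1, 1, 2. The last bound makes the
  bracket tend to infinity with the Euclidean norm.\<close>

lemma heis_bracket_facts:
  fixes p :: heis
  defines "n \<equiv> 1 + (p$1)^4 + (p$2)^4 + 16 * (p$3)\<^sup>2"
  shows "1 \<le> heis_bracket p" "heis_bracket p ^ 4 = n" "heis_bracket p = n powr (1/4)"
    "\<bar>p$1\<bar> \<le> heis_bracket p" "\<bar>p$2\<bar> \<le> heis_bracket p" "4 * \<bar>p$3\<bar> \<le> (heis_bracket p)\<^sup>2"
    "norm p \<le> (heis_bracket p)\<^sup>2"
proof -
  have n1: "n \<ge> 1" by (simp add: n_def)
  show e: "heis_bracket p ^ 4 = n"
    using n1 by (simp add: heis_bracket_def n_def real_root_pow_pos2)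
  show ge1: "1 \<le> heis_bracket p"
    by (simp add: heis_bracket_def)
  show "heis_bracket p = n powr (1/4)"
    using n1 root_powr_inverse[of 4 n] by (simp add: heis_bracket_def n_def)
  have le: "\<bar>x\<bar> \<le> heis_bracket p" if "x ^ 4 \<le> n" for x
    using that e ge1 power_mono_iff[of "\<bar>x\<bar>" "heis_bracket p" 4] by (simp add: power_even_abs)
  show "\<bar>p$1\<bar> \<le> heis_bracket p" "\<bar>p$2\<bar> \<le> heis_bracket p" by (rule le, simp add: n_def)+
  have e2: "((heis_bracket p)\<^sup>2)\<^sup>2 = n" using e by simp
  have le2: "x \<le> (heis_bracket p)\<^sup>2" if "x\<^sup>2 \<le> n" for x
    using that e2 by (intro power2_le_imp_le[of x]) auto
  show "4 * \<bar>p$3\<bar> \<le> (heis_bracket p)\<^sup>2"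
    by (rule le2) (simp add: n_def power_mult_distrib)
  have "x\<^sup>2 \<le> x ^ 4 + 1 / 2" for x :: real
  proof -
    have "0 \<le> (x\<^sup>2 - 1 / 2)\<^sup>2" by simp
    then show ?thesis by (simp add: power2_eq_square power4_eq_xxxx algebra_simps)
  qed
  note this[of "p$1"] this[of "p$2"]
  moreover have "(norm p)\<^sup>2 = (p$1)\<^sup>2 + (p$2)\<^sup>2 + (p$3)\<^sup>2"
    unfolding power2_norm_eq_inner by (simp add: inner_vec_def sum_3 power2_eq_square)
  ultimately have "(norm p)\<^sup>2 \<le> n" using zero_le_power2[of "p$3"] unfolding n_def by linarith
  then show "norm p \<le> (heis_bracket p)\<^sup>2" by (rule le2)
qed

context horizontal_pair
begin

lemma gam_le: "gam v v \<le> ((norm a)\<^sup>2 + (norm b)\<^sup>2) * (norm v)\<^sup>2"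
proof -
  have "(v \<bullet> e)\<^sup>2 \<le> (norm e)\<^sup>2 * (norm v)\<^sup>2" for e
    using Cauchy_Schwarz_ineq[of v e] by (simp add: power2_norm_eq_inner mult.commute)
  from add_mono[OF this[of a] this[of b]] show ?thesis
    by (simp add: gam_def power2_eq_square algebra_simps)
qed

text \<open>With \<open>n\<close> the fourth power of the bracket, its horizontal gradient is of
  order bracket cubed and the operator applied to it of order bracket squared. The derivative of the
  fourth root supplies bracket to the power -3, so the exponential is reproduced up to a constant
  factor.\<close>

lemma exp_bracket_jet:
  assumes \<kappa>: "0 \<le> \<kappa>" and L1: "0 \<le> L1"
  shows "\<exists>K G L. cjet UNIV (\<lambda>z. exp (\<kappa> * heis_bracket (fst z))) (\<lambda>_. 0) G L \<and>
    (\<forall>z. L z + L1 * norm (G z) \<le> K * exp (\<kappa> * heis_bracket (fst z)))"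
proof -
  define n where "n p = 1 + (p$1)^4 + (p$2)^4 + 16 * (p$3)\<^sup>2" for p :: heis
  define g3 :: "heis \<times> real \<Rightarrow> real ^ 2" where "g3 z = vector [- (fst z $ 2) / 2, fst z $ 1 / 2]" for z
  define Gn where "Gn z = (4 * (fst z $ 1) ^ 3) *\<^sub>R axis 1 1 + (4 * (fst z $ 2) ^ 3) *\<^sub>R axis 2 1 + (32 * fst z $ 3) *\<^sub>R g3 z"
    for z :: "heis \<times> real"
  define Ln where "Ln z = 12 * (fst z $ 1)\<^sup>2 * gam (axis 1 1) (axis 1 1) + 12 * (fst z $ 2)\<^sup>2 * gam (axis 2 1) (axis 2 1)
     + 32 * gam (g3 z) (g3 z)" for z
  note j1 = cjet_square[OF cjet_square[OF cjet_nth(1)[OF open_UNIV]]]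
  note j2 = cjet_square[OF cjet_square[OF cjet_nth(2)[OF open_UNIV]]]
  note j3 = cjet_scale[OF cjet_square[OF cjet_nth(3)[OF open_UNIV]], of 16]
  have en: "(\<lambda>z::heis \<times> real. 1 + ((fst z $ 1)\<^sup>2)\<^sup>2 + ((fst z $ 2)\<^sup>2)\<^sup>2 + 16 * (fst z $ 3)\<^sup>2) = (\<lambda>z. n (fst z))"
    by (simp add: n_def)
  have cjn: "cjet UNIV (\<lambda>z. n (fst z)) (\<lambda>_. 0) Gn Ln"
    by (rule cjet_cong[OF cjet_add[OF cjet_add[OF cjet_add[OF cjet_const[OF open_UNIV, of 1] j1] j2] j3, unfolded en]])
      (auto simp: Gn_def Ln_def g3_def gam_bilinear power2_eq_square power3_eq_cube algebra_simps)
  have n1: "n p \<ge> 1" for p by (simp add: n_def)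
  define h where "h s = exp (\<kappa> * s powr (1/4))" for s :: real
  define h' where "h' s = h s * (\<kappa> * (1/4 * s powr (-3/4)))" for s
  define h'' where "h'' s = h s * (\<kappa> * (1/4 * s powr (-3/4)))\<^sup>2 + h s * (\<kappa> * (1/4 * (-3/4 * s powr (-7/4))))" for s
  have d1: "(h has_real_derivative h' s) (at s)" if "s > 0" for s
    unfolding h_def h'_def using that by (auto intro!: derivative_eq_intros)
  have d2: "(h' has_real_derivative h'' s) (at s)" if "s > 0" for s
  proof -
    have "((\<lambda>s. \<kappa> * (1/4 * s powr (-3/4))) has_real_derivative \<kappa> * (1/4 * (-3/4 * s powr (-7/4)))) (at s)"
      using that by (auto intro!: derivative_eq_intros)
    from DERIV_mult[OF d1[OF that] this] show ?thesis
      unfolding h'_def[abs_def] by (simp add: h''_def h'_def power2_eq_square algebra_simps)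
  qed
  have "continuous_on {0<..} h''"
    unfolding h''_def h_def by (intro continuous_intros) auto
  then have c: "continuous_on ((\<lambda>z::heis \<times> real. n (fst z)) ` UNIV) h''"
    by (rule continuous_on_subset) (use n1 in \<open>auto intro: less_le_trans[OF zero_less_one]\<close>)
  have pn: "0 < n p" for p using n1[of p] by linarith
  note cjE = cjet_compose[OF cjn d1[OF pn] d2[OF pn] c]
  have hE: "h (n p) = exp (\<kappa> * heis_bracket p)" for p
    using heis_bracket_facts(3)[of p] by (simp add: h_def n_def)
  define S where "S = (norm a)\<^sup>2 + (norm b)\<^sup>2"
  have S: "S \<ge> 0" by (simp add: S_def)
  have bound: "h' (n (fst z)) * Ln z + h'' (n (fst z)) * gam (Gn z) (Gn z) + L1 * norm (h' (n (fst z)) *\<^sub>R Gn z)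
     \<le> (10 * \<kappa> * S + 16 * \<kappa>\<^sup>2 * S + 4 * \<kappa> * L1) * exp (\<kappa> * heis_bracket (fst z))" for z
  proof -
    define \<nu> where "\<nu> = heis_bracket (fst z)"
    define E where "E = exp (\<kappa> * \<nu>)"
    have \<nu>: "\<nu> \<ge> 1" "n (fst z) = \<nu> ^ 4" "\<bar>fst z $ 1\<bar> \<le> \<nu>" "\<bar>fst z $ 2\<bar> \<le> \<nu>" "4 * \<bar>fst z $ 3\<bar> \<le> \<nu>\<^sup>2"
      unfolding \<nu>_def n_def by (rule heis_bracket_facts heis_bracket_facts(2)[symmetric])+
    have E0: "E \<ge> 0" by (simp add: E_def)
    have pw: "n (fst z) powr (-3/4) = 1 / \<nu> ^ 3"
    proof -
      have "n (fst z) = \<nu> powr 4" using \<nu> by simp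
      then have "n (fst z) powr (-3/4) = \<nu> powr (-3)" by (simp add: powr_powr)
      also have "\<dots> = 1 / \<nu> ^ 3" using \<nu>(1) by (simp add: powr_minus divide_inverse)
      finally show ?thesis .
    qed
    have h1: "h' (n (fst z)) = E * \<kappa> / (4 * \<nu> ^ 3)"
      unfolding h'_def pw hE by (simp add: E_def \<nu>_def)
    \<comment> \<open>The other summand of \<open>h''\<close> comes from the concave function
      \<open>s powr (1/4)\<close>, is nonpositive, and is dropped.\<close>
    have h2: "h'' (n (fst z)) \<le> E * \<kappa>\<^sup>2 / (16 * \<nu> ^ 6)"
    proof -
      have "h'' (n (fst z)) = E * (\<kappa> * (1/4 * (1 / \<nu> ^ 3)))\<^sup>2 - E * (\<kappa> * (3/16 * n (fst z) powr (-7/4)))"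
        unfolding h''_def pw hE by (simp add: E_def \<nu>_def)
      moreover have "0 \<le> E * (\<kappa> * (3/16 * n (fst z) powr (-7/4)))" using E0 \<kappa> by simp
      moreover have "E * (\<kappa> * (1/4 * (1 / \<nu> ^ 3)))\<^sup>2 = E * \<kappa>\<^sup>2 / (16 * \<nu> ^ 6)"
        by (simp add: power2_eq_square power_mult_distrib power_divide flip: power_add)
      ultimately show ?thesis by linarith
    qed
    have sq: "x\<^sup>2 \<le> \<nu>\<^sup>2" if "\<bar>x\<bar> \<le> \<nu>" for x using power_mono[OF that, of 2] by simp
    have ax: "gam (axis i 1) (axis i 1) \<le> S" for i :: 2
      using gam_le[of "axis i 1"] by (simp add: S_def)
    have gam0: "0 \<le> gam v v" for v by (simp add: gam_def)
    have n3: "(norm (g3 z))\<^sup>2 \<le> \<nu>\<^sup>2 / 2"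
    proof -
      have "(norm (g3 z))\<^sup>2 = ((fst z $ 1)\<^sup>2 + (fst z $ 2)\<^sup>2) / 4"
        unfolding power2_norm_eq_inner by (simp add: g3_def inner_vec_def sum_2 power2_eq_square)
      then show ?thesis using sq[OF \<nu>(3)] sq[OF \<nu>(4)] by simp
    qed
    have Ln: "Ln z \<le> 40 * S * \<nu>\<^sup>2"
    proof -
      have "(fst z $ 1)\<^sup>2 * gam (axis 1 1) (axis 1 1) \<le> \<nu>\<^sup>2 * S"
        by (intro mult_mono sq \<nu> ax gam0) auto
      moreover have "(fst z $ 2)\<^sup>2 * gam (axis 2 1) (axis 2 1) \<le> \<nu>\<^sup>2 * S"
        by (intro mult_mono sq \<nu> ax gam0) auto
      moreover have "gam (g3 z) (g3 z) \<le> S * (\<nu>\<^sup>2 / 2)"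
        using order_trans[OF gam_le mult_left_mono[OF n3 S[unfolded S_def]]] by (simp add: S_def)
      ultimately show ?thesis unfolding Ln_def by (simp add: algebra_simps)
    qed
    have Gn: "norm (Gn z) \<le> 16 * \<nu> ^ 3"
    proof -
      have comp: "Gn z $ 1 = 4 * (fst z $ 1) ^ 3 - 16 * fst z $ 3 * fst z $ 2" "Gn z $ 2 = 4 * (fst z $ 2) ^ 3 + 16 * fst z $ 3 * fst z $ 1"
        by (simp_all add: Gn_def g3_def axis_def)
      have cube: "\<bar>x ^ 3\<bar> \<le> \<nu> ^ 3" if "\<bar>x\<bar> \<le> \<nu>" for x using that by (simp add: power_abs power_mono)
      have pr: "\<bar>16 * fst z $ 3 * x\<bar> \<le> 4 * \<nu> ^ 3" if "\<bar>x\<bar> \<le> \<nu>" for x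
      proof -
        have "(4 * \<bar>fst z $ 3\<bar>) * \<bar>x\<bar> \<le> \<nu>\<^sup>2 * \<nu>" by (intro mult_mono \<nu> that) auto
        then show ?thesis by (simp add: abs_mult power2_eq_square power3_eq_cube mult_ac)
      qed
      have "norm (Gn z) \<le> \<bar>Gn z $ 1\<bar> + \<bar>Gn z $ 2\<bar>" using norm_le_l1_cart[of "Gn z"] by (simp add: sum_2)
      then show ?thesis
        unfolding comp using cube[OF \<nu>(3)] cube[OF \<nu>(4)] pr[OF \<nu>(3)] pr[OF \<nu>(4)] by linarith
    qed
    have gG: "gam (Gn z) (Gn z) \<le> 256 * S * \<nu> ^ 6"
    proof -
      have "(norm (Gn z))\<^sup>2 \<le> (16 * \<nu> ^ 3)\<^sup>2" using Gn by (intro power_mono) auto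
      also have "\<dots> = 256 * \<nu> ^ 6" by (simp add: power_mult_distrib flip: power_mult)
      finally have "S * (norm (Gn z))\<^sup>2 \<le> S * (256 * \<nu> ^ 6)" by (intro mult_left_mono S)
      then show ?thesis using gam_le[of "Gn z"] by (simp add: S_def mult.commute mult.left_commute)
    qed
    have 1: "h' (n (fst z)) * Ln z \<le> 10 * \<kappa> * S * E"
    proof -
      have "h' (n (fst z)) * Ln z \<le> E * \<kappa> / (4 * \<nu> ^ 3) * (40 * S * \<nu>\<^sup>2)"
        unfolding h1 using E0 \<kappa> \<nu>(1) Ln by (intro mult_left_mono) auto
      also have "\<dots> = 10 * \<kappa> * S * E * (1 / \<nu>)"
        using \<nu>(1) by (simp add: power2_eq_square power3_eq_cube)
      also have "\<dots> \<le> 10 * \<kappa> * S * E * 1"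
        using E0 \<kappa> S \<nu>(1) by (intro mult_left_mono) auto
      finally show ?thesis by simp
    qed
    have 2: "h'' (n (fst z)) * gam (Gn z) (Gn z) \<le> 16 * \<kappa>\<^sup>2 * S * E"
    proof -
      have "h'' (n (fst z)) * gam (Gn z) (Gn z) \<le> E * \<kappa>\<^sup>2 / (16 * \<nu> ^ 6) * gam (Gn z) (Gn z)"
        by (intro mult_right_mono h2 gam0)
      also have "\<dots> \<le> E * \<kappa>\<^sup>2 / (16 * \<nu> ^ 6) * (256 * S * \<nu> ^ 6)"
        using E0 \<nu>(1) by (intro mult_left_mono gG) auto
      also have "\<dots> = 16 * \<kappa>\<^sup>2 * S * E" using \<nu>(1) by simp
      finally show ?thesis .
    qed
    have 3: "L1 * norm (h' (n (fst z)) *\<^sub>R Gn z) \<le> 4 * \<kappa> * L1 * E"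
    proof -
      have "norm (h' (n (fst z)) *\<^sub>R Gn z) = E * \<kappa> / (4 * \<nu> ^ 3) * norm (Gn z)"
        unfolding h1 using E0 \<kappa> \<nu>(1) by simp
      also have "\<dots> \<le> E * \<kappa> / (4 * \<nu> ^ 3) * (16 * \<nu> ^ 3)"
        using E0 \<kappa> \<nu>(1) by (intro mult_left_mono Gn) auto
      also have "\<dots> = 4 * \<kappa> * E" using \<nu>(1) by simp
      finally have "L1 * norm (h' (n (fst z)) *\<^sub>R Gn z) \<le> L1 * (4 * \<kappa> * E)"
        by (rule mult_left_mono[OF _ L1])
      also have "\<dots> = 4 * \<kappa> * L1 * E" by simp
      finally show ?thesis .
    qed
    show ?thesis using add_mono[OF add_mono[OF 1 2] 3] by (simp add: E_def \<nu>_def algebra_simps)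
  qed
  have "cjet UNIV (\<lambda>z. exp (\<kappa> * heis_bracket (fst z))) (\<lambda>_. 0) (\<lambda>z. h' (n (fst z)) *\<^sub>R Gn z)
      (\<lambda>z. h' (n (fst z)) * Ln z + h'' (n (fst z)) * gam (Gn z) (Gn z))"
    using cjE unfolding hE by simp
  with bound show ?thesis by blast
qed

text \<open>An exponential rate larger than that of \<open>w\<close> makes any positive multiple of
  the supersolution dominate \<open>w\<close> on large spheres, which reduces the claim to
  comparison on a bounded cylinder.\<close>

lemma vsub_exp_growth_nonpos:
  assumes L1: "0 \<le> L1" and cw: "continuous_on (UNIV \<times> {0..}) w"
    and vw: "vsub (\<lambda>_ y. - L1 * norm y) (UNIV \<times> {0<..}) w"
    and init: "\<And>p. w (p, 0) \<le> 0"
    and growth: "\<And>T. T > 0 \<Longrightarrow> \<exists>k>0. \<exists>C>0. \<forall>p. \<forall>t\<in>{0..T}. w (p, t) \<le> C * exp (k * heis_bracket p)"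
    and t: "0 \<le> t"
  shows "w (p, t) \<le> 0"
proof (rule ccontr)
  assume "\<not> w (p, t) \<le> 0"
  then have wpos: "w (p, t) > 0" by simp
  \<comment> \<open>Adding 1 keeps the window nondegenerate for \<open>t = 0\<close>; growth is
    needed up to \<open>2 * T\<close>, the window of \<open>vsub_comparison\<close>.\<close>
  define T where "T = t + 1"
  have T: "T > 0" "t \<le> T" using t by (auto simp: T_def)
  obtain k C where k: "k > 0" "C > 0" "\<And>p t. 0 \<le> t \<Longrightarrow> t \<le> 2 * T \<Longrightarrow> w (p, t) \<le> C * exp (k * heis_bracket p)"
    using growth[of "2 * T"] T(1) by auto
  define \<kappa> where "\<kappa> = k + 1"
  have \<kappa>: "\<kappa> \<ge> 0" using k by (simp add: \<kappa>_def)
  obtain K0 G0 L0 where E0: "cjet UNIV (\<lambda>z. exp (\<kappa> * heis_bracket (fst z))) (\<lambda>_. 0) G0 L0"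
     "\<And>z. L0 z + L1 * norm (G0 z) \<le> K0 * exp (\<kappa> * heis_bracket (fst z))"
    using exp_bracket_jet[OF \<kappa> L1] by blast
  define K where "K = max K0 0"
  have K: "K \<ge> 0" "L0 z + L1 * norm (G0 z) \<le> K * exp (\<kappa> * heis_bracket (fst z))" for z
  proof -
    have "K0 * exp (\<kappa> * heis_bracket (fst z)) \<le> K * exp (\<kappa> * heis_bracket (fst z))"
      by (intro mult_right_mono) (auto simp: K_def)
    with E0(2)[of z] show "L0 z + L1 * norm (G0 z) \<le> K * exp (\<kappa> * heis_bracket (fst z))" by linarith
  qed (simp add: K_def)
  have tj: "cjet UNIV (\<lambda>z. exp (K * snd z)) (\<lambda>z. K * exp (K * snd z) * 1) (\<lambda>z. (K * exp (K * snd z)) *\<^sub>R 0)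
     (\<lambda>z. K * exp (K * snd z) * 0 + K * (K * exp (K * snd z)) * gam 0 0)"
    by (rule cjet_compose[OF cjet_snd[OF open_UNIV], where h = "\<lambda>s. exp (K * s)" and h' = "\<lambda>s. K * exp (K * s)"
          and h'' = "\<lambda>s. K * (K * exp (K * s))"])
      (auto intro!: derivative_eq_intros continuous_intros)
  define E where "E z = exp (\<kappa> * heis_bracket (fst z)) * exp (K * snd z)" for z :: "heis \<times> real"
  \<comment> \<open>The supersolution then equals half of \<open>w (p, t)\<close> at the point in
    question, so a single comparison already gives the contradiction.\<close>
  define \<sigma> where "\<sigma> = w (p, t) / (2 * E (p, t))"
  have Epos: "E z > 0" for z by (simp add: E_def)
  have \<sigma>: "\<sigma> > 0" using wpos Epos by (simp add: \<sigma>_def)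
  note full = cjet_scale[OF cjet_mult[OF E0(1) tj], of \<sigma>]
  \<comment> \<open>A bracket of at least \<open>ln (C / \<sigma>)\<close> yields domination. Since
    the Euclidean norm is at most the squared bracket, the radius \<open>X\<^sup>2\<close> ensures
    this on the sphere.\<close>
  define X where "X = max 0 (ln (C / \<sigma>))"
  define R where "R = max (norm p) (X\<^sup>2)"
  have "w (p, t) \<le> \<sigma> * (exp (\<kappa> * heis_bracket (fst (p, t))) * exp (K * snd (p, t)))"
  proof (rule vsub_comparison[OF vw, of 0 R 0 T, OF _ T(1) _ full])
    show "continuous_on (cball 0 R \<times> {0..0 + 2 * T}) w"
      by (rule continuous_on_subset[OF cw]) auto
    fix q :: heis and s :: real
    have "L1 * norm (exp (K * s) *\<^sub>R G0 (q, s)) = exp (K * s) * (L1 * norm (G0 (q, s)))" by simp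
    moreover have "exp (K * s) * (L0 (q, s) + L1 * norm (G0 (q, s))) \<le> exp (K * s) * (K * exp (\<kappa> * heis_bracket q))"
      using K(2)[of "(q, s)"] by (intro mult_left_mono) auto
    ultimately have "0 \<le> \<sigma> * (K * exp (\<kappa> * heis_bracket q) * exp (K * s) - exp (K * s) * L0 (q, s) - L1 * norm (exp (K * s) *\<^sub>R G0 (q, s)))"
      using \<sigma> by (intro mult_nonneg_nonneg) (auto simp: algebra_simps)
    then show "0 \<le> \<sigma> * (exp (\<kappa> * heis_bracket (fst (q, s))) * (K * exp (K * snd (q, s)) * 1) + exp (K * snd (q, s)) * 0) -
        \<sigma> * (exp (\<kappa> * heis_bracket (fst (q, s))) * (K * exp (K * snd (q, s)) * 0 + K * (K * exp (K * snd (q, s))) * gam 0 0) +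
          exp (K * snd (q, s)) * L0 (q, s) + 2 * gam (G0 (q, s)) ((K * exp (K * snd (q, s))) *\<^sub>R 0)) +
        - L1 * norm (\<sigma> *\<^sub>R (exp (\<kappa> * heis_bracket (fst (q, s))) *\<^sub>R (K * exp (K * snd (q, s))) *\<^sub>R 0 + exp (K * snd (q, s)) *\<^sub>R G0 (q, s)))"
      using \<sigma> by (simp add: gam_bilinear algebra_simps)
  next
    fix q :: heis
    show "w (q, 0) \<le> \<sigma> * (exp (\<kappa> * heis_bracket (fst (q, 0::real))) * exp (K * snd (q, 0)))"
      using \<sigma> by (intro order_trans[OF init]) simp
  next
    fix q :: heis and s :: real assume q: "dist 0 q = R" and s: "0 \<le> s" "s \<le> 0 + 2 * T"
    have "X\<^sup>2 \<le> R" unfolding R_def by (rule max.cobounded2)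
    also have "R = norm q" using q by (simp add: dist_norm)
    also have "norm q \<le> (heis_bracket q)\<^sup>2" by (rule heis_bracket_facts)
    finally have "X\<^sup>2 \<le> (heis_bracket q)\<^sup>2" .
    then have "X \<le> heis_bracket q" by (rule power2_le_imp_le) (use heis_bracket_facts(1)[of q] in linarith)
    then have "ln (C / \<sigma>) \<le> heis_bracket q" by (simp add: X_def)
    then have "exp (ln (C / \<sigma>)) \<le> exp (heis_bracket q)" by simp
    then have "C / \<sigma> \<le> exp (heis_bracket q)" using k(2) \<sigma> by simp
    then have "C \<le> \<sigma> * exp (heis_bracket q)" using \<sigma> by (simp add: pos_divide_le_eq mult.commute)
    then have "C * exp (k * heis_bracket q) \<le> \<sigma> * exp (heis_bracket q) * exp (k * heis_bracket q)"
      by (intro mult_right_mono) auto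
    also have "\<dots> = \<sigma> * exp (\<kappa> * heis_bracket q)" by (simp add: \<kappa>_def algebra_simps exp_add)
    also have "\<dots> \<le> \<sigma> * (exp (\<kappa> * heis_bracket q) * exp (K * s))"
      using \<sigma> K(1) s(1) by (intro mult_left_mono) auto
    finally show "w (q, s) \<le> \<sigma> * (exp (\<kappa> * heis_bracket (fst (q, s))) * exp (K * snd (q, s)))"
      using k(3)[OF s(1), of q] s(2) by simp
  qed (use t T in \<open>auto simp: R_def\<close>)
  also have "\<dots> = w (p, t) / 2" using Epos[of "(p, t)"] by (simp add: \<sigma>_def E_def)
  finally show False using wpos by simp
qed

end

text \<open>For \<open>f1 p w = f p w\<close> and \<open>f2 p w = - f p (- w)\<close>, (A1) bounds
  \<open>f1 p w + f2 p w'\<close> below by \<open>- L1 * norm (w + w')\<close>. This is how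
  \<open>f\<close> disappears from the inequality for the difference. The roles of \<open>u\<close>
  and \<open>v\<close> can be exchanged, which gives equality.\<close>

lemma viscosity_comparison:
  fixes A :: "real ^ 2 ^ 2"
  assumes A: "symmetric_psd A"
    and A1: "\<exists>L1>0. \<forall>p w1 w2. \<bar>f p w1 - f p w2\<bar> \<le> L1 * norm (w1 - w2)"
    and A2: "\<forall>\<rho>>0. \<exists>L2>0. \<forall>p q w. norm p \<le> \<rho> \<longrightarrow> norm q \<le> \<rho> \<longrightarrow>
               \<bar>f p w - f q w\<bar> \<le> L2 * koranyi (p \<cdot>\<^sub>H heis_inv q)"
    and u: "continuous_viscosity_solution A f u0 u" "exponential_growth u"
    and v: "continuous_viscosity_solution A f u0 v" "exponential_growth v"
    and t: "0 \<le> t"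
  shows "u (p, t) \<le> v (p, t)"
proof -
  obtain a b where ab: "\<And>i j. A $ i $ j = a $ i * a $ j + b $ i * b $ j"
    using symmetric_psd_rank_one_sum[OF A] by blast
  interpret horizontal_pair a b .
  obtain L1 where L1: "L1 > 0" "\<And>p w1 w2. \<bar>f p w1 - f p w2\<bar> \<le> L1 * norm (w1 - w2)" using A1 by blast
  have u': "continuous_on (UNIV \<times> {0..}) u" "viscosity_subsolution A f u" "\<And>p. u (p, 0) = u0 p"
    and v': "continuous_on (UNIV \<times> {0..}) v" "viscosity_supersolution A f v" "\<And>p. v (p, 0) = u0 p"
    using u(1) v(1) by (auto simp: continuous_viscosity_solution_def)
  have sub: "vsub (\<lambda>_ w. - L1 * norm w) (UNIV \<times> {0<..}) (\<lambda>z. u z + - v z)"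
  proof (rule vsub_sum[OF _ _ vsub_viscosity_subsolution[OF ab u'(2)] vsub_viscosity_supersolution[OF ab v'(2)]])
    show "continuous_on (UNIV \<times> {0<..}) u" by (rule continuous_on_subset[OF u'(1)]) auto
    show "continuous_on (UNIV \<times> {0<..}) (\<lambda>z. - v z)"
      by (intro continuous_intros continuous_on_subset[OF v'(1)]) auto
    show "\<bar>f p w - f p w'\<bar> \<le> L1 * norm (w - w')" for p w w' by (rule L1(2))
    show "\<bar>- f p (- w) - - f p (- w')\<bar> \<le> L1 * norm (w - w')" for p w w'
      using L1(2)[of p "- w'" "- w"] by (simp add: algebra_simps)
    fix \<rho> :: real assume "\<rho> > 0"
    with A2 obtain C where C: "C > 0"
      "\<And>p q w. norm p \<le> \<rho> \<Longrightarrow> norm q \<le> \<rho> \<Longrightarrow> \<bar>f p w - f q w\<bar> \<le> C * koranyi (p \<cdot>\<^sub>H heis_inv q)" by blast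
    then show "\<exists>C>0. \<forall>p q w. norm p \<le> \<rho> \<longrightarrow> norm q \<le> \<rho> \<longrightarrow> \<bar>f p w - f q w\<bar> \<le> C * koranyi (p \<cdot>\<^sub>H heis_inv q)"
      by blast
    have "\<bar>- f p (- w) - - f q (- w)\<bar> \<le> C * koranyi (p \<cdot>\<^sub>H heis_inv q)" if "norm p \<le> \<rho>" "norm q \<le> \<rho>" for p q w
      using C(2)[OF that, of "- w"] by linarith
    then show "\<exists>C>0. \<forall>p q w. norm p \<le> \<rho> \<longrightarrow> norm q \<le> \<rho> \<longrightarrow> \<bar>- f p (- w) - - f q (- w)\<bar> \<le> C * koranyi (p \<cdot>\<^sub>H heis_inv q)"
      using C(1) by blast
  next
    fix p w w'
    show "- L1 * norm (w + w') \<le> f p w + - f p (- w')"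
      using L1(2)[of p w "- w'"] by simp
  qed (use L1 in auto)
  have "u (p, t) + - v (p, t) \<le> 0"
  proof (rule vsub_exp_growth_nonpos[OF _ _ sub _ _ t])
    show "continuous_on (UNIV \<times> {0..}) (\<lambda>z. u z + - v z)" by (intro continuous_intros u' v')
    show "u (p, 0) + - v (p, 0) \<le> 0" for p by (simp add: u' v')
    fix T :: real assume T: "T > 0"
    obtain k1 C1 where 1: "k1 > 0" "C1 > 0" "\<And>p t. t \<in> {0..T} \<Longrightarrow> \<bar>u (p, t)\<bar> \<le> C1 * exp (k1 * heis_bracket p)"
      using u(2) T unfolding exponential_growth_def by meson
    obtain k2 C2 where 2: "k2 > 0" "C2 > 0" "\<And>p t. t \<in> {0..T} \<Longrightarrow> \<bar>v (p, t)\<bar> \<le> C2 * exp (k2 * heis_bracket p)"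
      using v(2) T unfolding exponential_growth_def by meson
    have "u (p, t) + - v (p, t) \<le> (C1 + C2) * exp (max k1 k2 * heis_bracket p)" if t: "t \<in> {0..T}" for p t
    proof -
      have br: "0 \<le> heis_bracket p" using heis_bracket_facts(1)[of p] by linarith
      have "C1 * exp (k1 * heis_bracket p) \<le> C1 * exp (max k1 k2 * heis_bracket p)"
        using 1(2) br by (intro mult_left_mono) (auto intro: mult_right_mono)
      moreover have "C2 * exp (k2 * heis_bracket p) \<le> C2 * exp (max k1 k2 * heis_bracket p)"
        using 2(2) br by (intro mult_left_mono) (auto intro: mult_right_mono)
      ultimately show ?thesis
        using 1(3)[OF t, of p] 2(3)[OF t, of p] unfolding distrib_right by linarith
    qed
    then show "\<exists>k>0. \<exists>C>0. \<forall>p. \<forall>t\<in>{0..T}. u (p, t) + - v (p, t) \<le> C * exp (k * heis_bracket p)"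
      using 1(1,2) 2(1,2) by (intro exI[of _ "max k1 k2"] exI[of _ "C1 + C2"] conjI) auto
  qed (use L1 in auto)
  then show ?thesis by simp
qed

theorem corollary3p1:
  fixes A :: "real ^ 2 ^ 2"
    and f :: "heis \<Rightarrow> real ^ 2 \<Rightarrow> real"
    and u0 :: "heis \<Rightarrow> real"
    and u v :: "heis \<times> real \<Rightarrow> real"
  assumes A: "symmetric_psd A"
    and A1: "\<exists>L1>0. \<forall>p w1 w2. \<bar>f p w1 - f p w2\<bar> \<le> L1 * norm (w1 - w2)"
    and A2: "\<forall>\<rho>>0. \<exists>L2>0. \<forall>p q w. norm p \<le> \<rho> \<longrightarrow> norm q \<le> \<rho> \<longrightarrow>
               \<bar>f p w - f q w\<bar> \<le> L2 * koranyi (p \<cdot>\<^sub>H heis_inv q)"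
    and u0: "continuous_on UNIV u0"
    and u: "continuous_viscosity_solution A f u0 u" "exponential_growth u"
    and v: "continuous_viscosity_solution A f u0 v" "exponential_growth v"
  shows "\<forall>p. \<forall>t\<ge>0. u (p, t) = v (p, t)"
  using viscosity_comparison[OF A A1 A2 u v] viscosity_comparison[OF A A1 A2 v u]
  by (auto intro: antisym)

end
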